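(* Let $2\le\nu<5$, $R_0\ge 2\xi_1(\nu)$, and let $(\Theta_\varepsilon)_{0<\varepsilon\le\varepsilon_1}$ be a family of distorted Lane-Emden functions (see context). Then there exist $\varepsilon_0\in(0,\varepsilon_1]$ and $C>0$ such that for every $0<\varepsilon\le\varepsilon_0$, $\Theta=\Theta_\varepsilon$ has the following properties. (1) As a function of $\vec{x}=(x,y,z)$ with $|\vec x|\le R_0$, $\Theta$ is continuously differentiable, and $\sup|\nabla\Theta-\nabla\theta|\le C\varepsilon$, where $\nabla=(\partial_x,\partial_y,\partial_z)^T$. Moreover, $\Theta$ is twice differentiable as a function of $\vec x$ and its second derivatives are Hölder continuous. (2) For each $\zeta\in[-1,1]$ there exists a unique $\Xi_1(\zeta)=\Xi_1(\zeta;\nu,\varepsilon)\in(0,2\xi_1)$ such that $\Theta(r,\zeta)>0$ for $0\le r<\Xi_1(\zeta)$, $\Theta(\Xi_1(\zeta),\zeta)=0$, and $\Theta(r,\zeta)<0$ for $\Xi_1(\zeta)<r\le2\xi_1$. Moreover, $\Xi_1$ is continuously differentiable on $(-1,1)$. (3) Let $\mathfrak{D}=\{\vec x\in\mathbb{R}^3: |\vec x|\le R_0,\ \Theta>0\}$, with unit outer normal vector $\vec N$ along $\partial\mathfrak{D}$. Then $\Theta$ satisfies the physical vacuum boundary condition $$-\infty<\frac{\partial\Theta}{\partial\vec N}=\nabla\Theta\cdot\vec N<0\quad\text{on }\partial\mathfrak{D}.$$ (4) The boundary $\partial\mathfrak{D}=\{\vec x: |\vec x|\le R_0,\ \Theta=0\}$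 is a $C^1$-submanifold of $\mathbb{R}^3$.
   Context: For $1<\nu<5$, the Lane-Emden function $\theta=\theta(r;\nu)$ is the unique solution of $\theta''+\frac2r\theta'+\theta^\nu=0$ with $\theta=1+O(r^2)$ as $r\to0$, considered up to its first zero $\xi_1=\xi_1(\nu)\in(0,\infty)$ ($\theta>0$ and $\theta'<0$ on $(0,\xi_1)$). Put $\mu_1=\mu_1(\nu)=\int_0^{\xi_1}\theta^\nu r^2dr=-\xi_1^2\theta'(\xi_1)$, and extend $\theta$ to $[0,\infty)$ as a $C^2$ function by $\theta(r)=-\mu_1\left(\frac1{\xi_1}-\frac1r\right)$ for $r>\xi_1$. Coordinates on $\mathbb{R}^3$: $x=r\sqrt{1-\zeta^2}\cos\phi$, $y=r\sqrt{1-\zeta^2}\sin\phi$, $z=r\zeta$; a function of $(r,\zeta)$ constant in $\zeta$ at $r=0$ is regarded as an axisymmetric function of $\vec x$, and a function of $r$ alone as a function of $(r,\zeta)$. $\mathfrak{E}$ is the space of all $u\in C([0,R_0]\times[-1,1])$ with $u(0,\zeta)=u(0,0)$ and $u(r,\zeta)=u(r,-\zeta)$ for all $r,\zeta$, with the norm $\|u\|_{\mathfrak{E}}=\sup|u|$. Write $u_\sharp=\max\{0,u\}$, $$K(r,\zeta,r',\zeta')=\int_0^{2\pi}\frac{d\beta}{\sqrt{r^2+r'^2-2rr'(\sqrt{1-\zeta^2}\sqrt{1-\zeta'^2}\cos\beta+\zeta\zeta')}},$$ $\mathfrak{g}(r,\zeta)=\frac14(1-\zeta^2)r^2$, and $$\mathcal{G}(u)(r,\zeta)=1+\frac1{4\pi}\int_{-1}^1\int_0^{R_0}K(r,\zeta,r',\zeta')u_\sharp(r',\zeta')^\nu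 r'^2dr'd\zeta'-\frac12\int_{-1}^1\int_0^{R_0}u_\sharp(r',\zeta')^\nu r'dr'd\zeta'.$$ A family of distorted Lane-Emden functions consists of constants $\varepsilon_1>0$, $C_1>0$ and, for each $0<\varepsilon\le\varepsilon_1$, a function $\Theta_\varepsilon\in\mathfrak{E}$ such that $\Theta_\varepsilon=\varepsilon\mathfrak{g}+\mathcal{G}(\Theta_\varepsilon)$ on $[0,R_0]\times[-1,1]$ and $\|\Theta_\varepsilon-\theta\|_{\mathfrak{E}}\le C_1\varepsilon$. Where needed (derivatives at $|\vec x|=R_0$), $\Theta_\varepsilon$ is extended to $r>R_0$ by the same formula $\varepsilon\mathfrak{g}+\mathcal{G}(\Theta_\varepsilon)$, whose right-hand side is defined for all $r\ge0$. *)

theory Defs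
  imports "HOL-Analysis.Analysis" "HOL-Library.Landau_Symbols"
begin

section \<open>The Lane-Emden function\<close>

definition lane_emden_mass :: "real \<Rightarrow> real \<Rightarrow> (real \<Rightarrow> real) \<Rightarrow> real" where
  "lane_emden_mass \<nu> \<xi>1 \<theta> = (LINT r:{0..\<xi>1}|lborel. \<theta> r powr \<nu> * r\<^sup>2)"

text \<open>
  \<open>\<theta>\<close> is the Lane-Emden function of index \<open>\<nu>\<close> with first zero \<open>\<xi>1\<close>, continued beyond \<open>\<xi>1\<close> by the
  harmonic function. These conditions determine \<open>\<xi>1\<close> and the values of \<open>\<theta>\<close> on \<open>[0, \<infinity>)\<close>; the values
  at negative arguments are irrelevant.
\<close>

definition lane_emden :: "real \<Rightarrow> real \<Rightarrow> (real \<Rightarrow> real) \<Rightarrow> bool" where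
  "lane_emden \<nu> \<xi>1 \<theta> \<longleftrightarrow>
     0 < \<xi>1 \<and>
     (\<exists>\<theta>' \<theta>''. \<forall>r\<in>{0<..<\<xi>1}.
        (\<theta> has_real_derivative \<theta>' r) (at r) \<and>
        (\<theta>' has_real_derivative \<theta>'' r) (at r) \<and>
        \<theta>'' r + 2 / r * \<theta>' r + \<theta> r powr \<nu> = 0) \<and>
     \<theta> 0 = 1 \<and> (\<lambda>r. \<theta> r - 1) \<in> O[at_right 0](\<lambda>r. r\<^sup>2) \<and>
     continuous_on {0..\<xi>1} \<theta> \<and>
     (\<forall>r\<in>{0<..<\<xi>1}. \<theta> r > 0) \<and> \<theta> \<xi>1 = 0 \<and>
     (\<forall>r>\<xi>1. \<theta> r = - lane_emden_mass \<nu> \<xi>1 \<theta> * (1 / \<xi>1 - 1 / r))"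

section \<open>The integral equation\<close>

text \<open>Functions of \<open>(r, \<zeta>)\<close> are curried; only their values on \<open>[0, R0] \<times> [-1, 1]\<close> matter.\<close>

definition space_E :: "real \<Rightarrow> (real \<Rightarrow> real \<Rightarrow> real) set" where
  "space_E R0 = {u. continuous_on ({0..R0} \<times> {-1..1}) (\<lambda>(r, \<zeta>). u r \<zeta>) \<and>
     (\<forall>\<zeta>\<in>{-1..1}. u 0 \<zeta> = u 0 0) \<and>
     (\<forall>r\<in>{0..R0}. \<forall>\<zeta>\<in>{-1..1}. u r \<zeta> = u r (- \<zeta>))}"

definition norm_E :: "real \<Rightarrow> (real \<Rightarrow> real \<Rightarrow> real) \<Rightarrow> real" where
  "norm_E R0 u = (SUP (r, \<zeta>)\<in>{0..R0} \<times> {-1..1}. \<bar>u r \<zeta>\<bar>)"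

text \<open>
  The kernel is infinite only for \<open>(r, \<zeta>) = (r', \<zeta>')\<close> and for \<open>r = r' = 0\<close>; there the definition
  yields a conventional finite value. For fixed \<open>(r, \<zeta>)\<close> this is a null set of \<open>(r', \<zeta>')\<close>.
\<close>

definition kernel_K :: "real \<Rightarrow> real \<Rightarrow> real \<Rightarrow> real \<Rightarrow> real" where
  "kernel_K r \<zeta> r' \<zeta>' =
     (LINT \<beta>:{0..2*pi}|lborel.
        1 / sqrt (r\<^sup>2 + r'\<^sup>2
                  - 2 * r * r' * (sqrt (1 - \<zeta>\<^sup>2) * sqrt (1 - \<zeta>'\<^sup>2) * cos \<beta> + \<zeta> * \<zeta>')))"

definition centrifugal_g :: "real \<Rightarrow> real \<Rightarrow> real" where
  "centrifugal_g r \<zeta> = 1/4 * (1 - \<zeta>\<^sup>2) * r\<^sup>2"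

definition operator_G :: "real \<Rightarrow> real \<Rightarrow> (real \<Rightarrow> real \<Rightarrow> real) \<Rightarrow> real \<Rightarrow> real \<Rightarrow> real" where
  "operator_G \<nu> R0 u r \<zeta> =
     1 + 1 / (4 * pi) *
           (LINT \<zeta>':{-1..1}|lborel. LINT r':{0..R0}|lborel.
              kernel_K r \<zeta> r' \<zeta>' * (max 0 (u r' \<zeta>')) powr \<nu> * r'\<^sup>2)
       - 1/2 * (LINT \<zeta>':{-1..1}|lborel. LINT r':{0..R0}|lborel.
              (max 0 (u r' \<zeta>')) powr \<nu> * r')"

definition distorted_lane_emden_family ::
    "real \<Rightarrow> real \<Rightarrow> (real \<Rightarrow> real) \<Rightarrow> real \<Rightarrow> real \<Rightarrow> (real \<Rightarrow> real \<Rightarrow> real \<Rightarrow> real) \<Rightarrow> bool" where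
  "distorted_lane_emden_family \<nu> R0 \<theta> \<epsilon>1 C1 \<Theta> \<longleftrightarrow>
     \<epsilon>1 > 0 \<and> C1 > 0 \<and>
     (\<forall>\<epsilon>. 0 < \<epsilon> \<and> \<epsilon> \<le> \<epsilon>1 \<longrightarrow>
        \<Theta> \<epsilon> \<in> space_E R0 \<and>
        (\<forall>r\<in>{0..R0}. \<forall>\<zeta>\<in>{-1..1}.
           \<Theta> \<epsilon> r \<zeta> = \<epsilon> * centrifugal_g r \<zeta> + operator_G \<nu> R0 (\<Theta> \<epsilon>) r \<zeta>) \<and>
        norm_E R0 (\<lambda>r \<zeta>. \<Theta> \<epsilon> r \<zeta> - \<theta> r) \<le> C1 * \<epsilon>)"

definition extension ::
    "real \<Rightarrow> real \<Rightarrow> real \<Rightarrow> (real \<Rightarrow> real \<Rightarrow> real) \<Rightarrow> real \<Rightarrow> real \<Rightarrow> real" where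
  "extension \<nu> R0 \<epsilon> u r \<zeta> =
     (if r \<le> R0 then u r \<zeta> else \<epsilon> * centrifugal_g r \<zeta> + operator_G \<nu> R0 u r \<zeta>)"

text \<open>
  With \<open>r = |x|\<close> and \<open>\<zeta> = z / r\<close>. At the origin \<open>\<zeta>\<close> evaluates to \<open>0 / 0 = 0\<close>, which is harmless for
  functions that do not depend on \<open>\<zeta>\<close> at \<open>r = 0\<close>.
\<close>

definition cartesian :: "(real \<Rightarrow> real \<Rightarrow> real) \<Rightarrow> real^3 \<Rightarrow> real" where
  "cartesian u x = u (norm x) (x $ 3 / norm x)"

section \<open>Differential calculus and geometry\<close>

definition partial_deriv :: "'n::finite \<Rightarrow> (real^'n \<Rightarrow> real) \<Rightarrow> real^'n \<Rightarrow> real" where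
  "partial_deriv i f x = frechet_derivative f (at x) (axis i 1)"

definition grad :: "(real^'n \<Rightarrow> real) \<Rightarrow> real^'n \<Rightarrow> real^'n" where
  "grad f x = (\<chi> i. partial_deriv i f x)"

definition holder_continuous_on :: "'a::metric_space set \<Rightarrow> ('a \<Rightarrow> 'b::metric_space) \<Rightarrow> bool" where
  "holder_continuous_on S f \<longleftrightarrow>
     (\<exists>\<alpha> M. 0 < \<alpha> \<and> \<alpha> \<le> 1 \<and> (\<forall>x\<in>S. \<forall>y\<in>S. dist (f x) (f y) \<le> M * dist x y powr \<alpha>))"

definition C1_map_on :: "'a::real_normed_vector set \<Rightarrow> ('a \<Rightarrow> 'b::real_normed_vector) \<Rightarrow> bool" where
  "C1_map_on U f \<longleftrightarrow>
     (\<exists>f' :: 'a \<Rightarrow> 'a \<Rightarrow>\<^sub>L 'b.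
        (\<forall>x\<in>U. (f has_derivative blinfun_apply (f' x)) (at x)) \<and> continuous_on U f')"

text \<open>\<open>M\<close> is an embedded submanifold without boundary, of dimension \<open>k\<close> and class \<open>C\<^sup>1\<close>.\<close>

definition C1_submanifold :: "nat \<Rightarrow> 'a::euclidean_space set \<Rightarrow> bool" where
  "C1_submanifold k M \<longleftrightarrow>
     (\<forall>p\<in>M. \<exists>U V L \<phi> \<psi>.
        open U \<and> p \<in> U \<and> open V \<and> subspace (L :: 'a set) \<and> dim L = k \<and>
        homeomorphism U V \<phi> \<psi> \<and> C1_map_on U \<phi> \<and> C1_map_on V \<psi> \<and>
        \<phi> ` (U \<inter> M) = V \<inter> L)"

definition tangent_vector :: "'a::real_normed_vector set \<Rightarrow> 'a \<Rightarrow> 'a \<Rightarrow> bool" where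
  "tangent_vector M p v \<longleftrightarrow>
     (\<exists>\<gamma>. \<gamma> 0 = p \<and> (\<forall>\<^sub>F t in nhds (0::real). \<gamma> t \<in> M) \<and> (\<gamma> has_vector_derivative v) (at 0))"

definition unit_outer_normal :: "'a::real_inner set \<Rightarrow> 'a \<Rightarrow> 'a \<Rightarrow> bool" where
  "unit_outer_normal D p N \<longleftrightarrow>
     norm N = 1 \<and>
     (\<forall>v. tangent_vector (frontier D) p v \<longrightarrow> N \<bullet> v = 0) \<and>
     (\<forall>\<^sub>F t in at_right (0::real). p + t *\<^sub>R N \<notin> closure D \<and> p - t *\<^sub>R N \<in> interior D)"

definition surface_radius :: "(real \<Rightarrow> real \<Rightarrow> real) \<Rightarrow> real \<Rightarrow> real \<Rightarrow> real \<Rightarrow> bool" where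
  "surface_radius u \<xi>1 \<zeta> X \<longleftrightarrow>
     0 < X \<and> X < 2 * \<xi>1 \<and>
     (\<forall>r. 0 \<le> r \<and> r < X \<longrightarrow> u r \<zeta> > 0) \<and> u X \<zeta> = 0 \<and>
     (\<forall>r. X < r \<and> r \<le> 2 * \<xi>1 \<longrightarrow> u r \<zeta> < 0)"

end

theory Submission
  imports Defs
begin

text \<open>
  Let \<open>\<rho>\<close> be the positive part of \<open>\<Theta>\<close> to the power \<open>\<nu>\<close> on the ball, and \<open>0\<close> outside. In spherical coordinates
  the integral equation says that, on all of space, \<open>\<Theta>\<close> is a constant plus \<open>\<epsilon> (x\<^sup>2 + y\<^sup>2) / 4\<close> plus
  \<open>1 / (4 \<pi>)\<close> times the Newtonian potential of \<open>\<rho>\<close>. For small \<open>\<epsilon>\<close> the density \<open>\<rho>\<close> is continuous with compact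
  support, so \<open>\<Theta>\<close> is \<open>C\<^sup>1\<close>, hence so is \<open>\<rho>\<close>. Moving the second derivative to the density, the Hessian of the
  potential is the convolution of the gradient kernel \<open>- z / |z|\<^sup>3\<close> with \<open>\<nabla>\<rho>\<close>, which is Lipschitz because
  \<open>\<nu> - 1 \<ge> 1\<close>; so the second derivatives are even Lipschitz.

  As \<open>\<epsilon> \<rightarrow> 0\<close> the integral equation passes to \<open>\<theta>\<close>, so \<open>\<nabla>\<Theta> - \<nabla>\<theta>\<close> is \<open>\<epsilon>\<close> times a horizontal vector plus the
  field of a density of size \<open>O(\<epsilon>)\<close>. The exterior formula for \<open>\<theta>\<close> gives the radial derivative
  \<open>- \<mu>\<^sub>1 / \<xi>\<^sub>1\<^sup>2 < 0\<close> at \<open>\<xi>\<^sub>1\<close>. Hence \<open>\<Theta>\<close> is strictly decreasing along rays in a shell around the sphere of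
  radius \<open>\<xi>\<^sub>1\<close> and has the sign of \<open>\<theta>\<close> off the shell, and the implicit function theorem gives the rest.
\<close>

section \<open>Locally integrable kernels and convolutions\<close>

text \<open>The gradient kernel has a singularity of order 2, which is integrable in dimension 3;
  its own derivative has order 3, which is not. Hence the two differentiations differ in kind. The
  first falls on the kernel and asks of the density only that it be bounded, measurable and
  compactly supported. The second must fall on the density, and can do so only because the first has
  made the density \<open>C^1\<close>. The truncation of the density at radius \<open>R0\<close>
  does no harm, because \<Theta> is negative near that sphere and the density vanishes there.

  The constants are uniform in \<epsilon> because a convolution is bounded by the supremum of the
  density times the mass of the kernel on a fixed ball: the uniform distance of two densities
  controls potentials and fields alike. The definition of the Lane-Emden function provides no
  derivative at 0 or at \<xi>1. Its gradient is therefore obtained as the Newtonian field of its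
  density, which is continuous everywhere, and the slope at the surface is read off from the
  exterior formula by continuity.\<close>

definition locally_integrable :: "('a::euclidean_space \<Rightarrow> 'b::{banach, second_countable_topology}) \<Rightarrow> bool" where
  "locally_integrable k \<longleftrightarrow> k \<in> borel_measurable borel \<and> (\<forall>R. set_integrable lborel (cball 0 R) k)"

definition kernel_mass :: "('a::euclidean_space \<Rightarrow> 'b::{banach, second_countable_topology}) \<Rightarrow> real \<Rightarrow> real" where
  "kernel_mass k R = (LINT z:cball 0 R|lborel. norm (k z))"

text \<open>The point \<open>x\<close> enters through the density, and the singularity of the kernel
  stays at the origin. Estimates that use the regularity of \<open>\<rho>\<close> can therefore
  ignore how singular \<open>k\<close> is.\<close>

definition conv :: "('a::euclidean_space \<Rightarrow> real) \<Rightarrow> ('a \<Rightarrow> 'b::{banach, second_countable_topology}) \<Rightarrow> 'a \<Rightarrow> 'b" where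
  "conv \<rho> k x = (LINT z|lborel. \<rho> (x - z) *\<^sub>R k z)"

lemma locally_integrable_measurable: "locally_integrable k \<Longrightarrow> k \<in> borel_measurable borel"
  by (simp add: locally_integrable_def)

lemma locally_integrable_norm_integrable:
  assumes "locally_integrable k"
  shows "integrable lborel (\<lambda>z. indicator (cball 0 R) z * norm (k z))"
  using set_integrable_norm[of lborel "cball 0 R" k] assms
  by (simp add: locally_integrable_def set_integrable_def)

lemma kernel_mass_nonneg: "0 \<le> kernel_mass k R"
  by (auto simp: kernel_mass_def set_lebesgue_integral_def intro!: integral_nonneg_AE)

text \<open>The common source of the estimates below: \<open>w\<close> will be a translated density,
  a difference of two translates, or the error of a linear approximation to the density. Only its
  size and its support enter.\<close>

lemma weighted_kernel:
  fixes k :: "'a::euclidean_space \<Rightarrow> 'b::{banach, second_countable_topology}"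
  assumes k: "locally_integrable k"
    and w: "w \<in> borel_measurable borel" "\<And>z. \<bar>w z\<bar> \<le> M" "\<And>z. norm z > S \<Longrightarrow> w z = 0"
  shows weighted_kernel_integrable: "integrable lborel (\<lambda>z. w z *\<^sub>R k z)"
    and weighted_kernel_bound: "norm (LINT z|lborel. w z *\<^sub>R k z) \<le> M * kernel_mass k S"
proof -
  note [measurable] = w(1) locally_integrable_measurable[OF k]
  have int: "integrable lborel (\<lambda>z. M * (indicator (cball 0 S) z * norm (k z)))"
    using locally_integrable_norm_integrable[OF k] by (rule integrable_mult_right)
  have le: "norm (w z *\<^sub>R k z) \<le> M * (indicator (cball 0 S) z * norm (k z))" for z
    using w(2)[of z] w(3)[of z] by (cases "norm z > S") (auto simp: mult_right_mono)
  show "integrable lborel (\<lambda>z. w z *\<^sub>R k z)"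
    by (rule Bochner_Integration.integrable_bound[OF int])
       (auto intro!: AE_I2 order_trans[OF le[unfolded norm_scaleR]])
  then have "norm (LINT z|lborel. w z *\<^sub>R k z) \<le> (LINT z|lborel. M * (indicator (cball 0 S) z * norm (k z)))"
    using int le by (intro Bochner_Integration.integral_norm_bound_integral) auto
  then show "norm (LINT z|lborel. w z *\<^sub>R k z) \<le> M * kernel_mass k S"
    by (simp add: kernel_mass_def set_lebesgue_integral_def)
qed

lemma measurable_translate [measurable]:
  fixes \<rho> :: "'a::euclidean_space \<Rightarrow> real"
  assumes [measurable]: "\<rho> \<in> borel_measurable borel"
  shows "(\<lambda>z. \<rho> (x - z)) \<in> borel_measurable borel"
  by measurable

lemma norm_diff_gt_radius: "norm x + R \<le> S \<Longrightarrow> norm z > S \<Longrightarrow> norm (x - z) > R"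
  using norm_triangle_ineq2[of z x] by (simp add: norm_minus_commute)

lemma translate_support:
  "norm x + R \<le> S \<Longrightarrow> (\<And>y. norm y > R \<Longrightarrow> f y = 0) \<Longrightarrow> norm z > S \<Longrightarrow> f (x - z) = 0"
  using norm_diff_gt_radius by blast

lemma conv_integrable:
  assumes "locally_integrable k" "\<rho> \<in> borel_measurable borel" "\<And>y. \<bar>\<rho> y\<bar> \<le> M" "\<And>y. norm y > R \<Longrightarrow> \<rho> y = 0"
  shows "integrable lborel (\<lambda>z. \<rho> (x - z) *\<^sub>R k z)"
  by (rule weighted_kernel_integrable[OF assms(1), where M=M and S="norm x + R"])
     (use assms in \<open>auto intro: translate_support[where f=\<rho> and R=R]\<close>)

lemma conv_bound:
  assumes "locally_integrable k" "\<rho> \<in> borel_measurable borel" "\<And>y. \<bar>\<rho> y\<bar> \<le> M" "\<And>y. norm y > R \<Longrightarrow> \<rho> y = 0"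
    and "norm x + R \<le> S"
  shows "norm (conv \<rho> k x) \<le> M * kernel_mass k S"
  unfolding conv_def
  by (rule weighted_kernel_bound[OF assms(1)])
     (use assms in \<open>auto intro: translate_support[where f=\<rho> and R=R]\<close>)

lemma distr_lborel_reflect: "distr lborel borel (\<lambda>z::'a::euclidean_space. x - z) = lborel"
proof -
  have "lborel = density (distr lborel borel (\<lambda>z::'a. x + (-1) *\<^sub>R z)) (\<lambda>_. \<bar>-1::real\<bar> ^ DIM('a))"
    by (rule lborel_affine) simp
  then show ?thesis by (simp add: density_1)
qed

text \<open>The substitution \<open>y = x - z\<close> moves the singularity to \<open>x\<close>.
  This form serves when the derivative falls on the kernel, and it is the one that spherical
  coordinates produce.\<close>

lemma conv_alt:
  fixes k :: "'a::euclidean_space \<Rightarrow> 'b::{banach, second_countable_topology}"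
  assumes [measurable]: "k \<in> borel_measurable borel" "\<rho> \<in> borel_measurable borel"
  shows "conv \<rho> k x = (LINT y|lborel. \<rho> y *\<^sub>R k (x - y))"
proof -
  have "conv \<rho> k x = (LINT z|distr lborel borel (\<lambda>z::'a. x - z). \<rho> (x - z) *\<^sub>R k z)"
    by (simp add: conv_def distr_lborel_reflect)
  also have "\<dots> = (LINT y|lborel. \<rho> y *\<^sub>R k (x - y))"
    by (subst integral_distr) auto
  finally show ?thesis .
qed

lemma conv_alt_integrable:
  fixes k :: "'a::euclidean_space \<Rightarrow> 'b::{banach, second_countable_topology}"
  assumes k: "locally_integrable k" and \<rho>: "\<rho> \<in> borel_measurable borel"
    and "\<And>y. \<bar>\<rho> y\<bar> \<le> M" "\<And>y. norm y > R \<Longrightarrow> \<rho> y = 0"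
  shows "integrable lborel (\<lambda>y. \<rho> y *\<^sub>R k (x - y))"
proof -
  note [measurable] = \<rho> locally_integrable_measurable[OF k]
  have "integrable (distr lborel borel (\<lambda>z::'a. x - z)) (\<lambda>z. \<rho> (x - z) *\<^sub>R k z)"
    unfolding distr_lborel_reflect by (rule conv_integrable) fact+
  then show ?thesis
    by (subst (asm) integrable_distr_eq) auto
qed

lemma conv_diff_density:
  assumes k: "locally_integrable k"
    and "\<rho> \<in> borel_measurable borel" "\<And>y. \<bar>\<rho> y\<bar> \<le> M" "\<And>y. norm y > R \<Longrightarrow> \<rho> y = 0"
    and "\<sigma> \<in> borel_measurable borel" "\<And>y. \<bar>\<sigma> y\<bar> \<le> M'" "\<And>y. norm y > R \<Longrightarrow> \<sigma> y = 0"
  shows "conv (\<lambda>y. \<rho> y - \<sigma> y) k x = conv \<rho> k x - conv \<sigma> k x"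
  unfolding conv_def scaleR_diff_left
  by (rule Bochner_Integration.integral_diff; rule conv_integrable) fact+

text \<open>Both integrals contain the same factor \<open>k z\<close>, so a modulus of continuity of
  the density passes to the convolution, multiplied by the mass of the kernel.\<close>

lemma conv_diff_point:
  assumes k: "locally_integrable k"
    and \<rho>: "\<rho> \<in> borel_measurable borel" "\<And>y. \<bar>\<rho> y\<bar> \<le> M" "\<And>y. norm y > R \<Longrightarrow> \<rho> y = 0"
    and le: "\<And>y. \<bar>\<rho> (x + y) - \<rho> (x' + y)\<bar> \<le> e" and S: "norm x + R \<le> S" "norm x' + R \<le> S"
  shows "norm (conv \<rho> k x - conv \<rho> k x') \<le> e * kernel_mass k S"
proof -
  have "conv \<rho> k x - conv \<rho> k x' = (LINT z|lborel. (\<rho> (x - z) - \<rho> (x' - z)) *\<^sub>R k z)"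
    unfolding conv_def scaleR_diff_left
    by (rule Bochner_Integration.integral_diff[symmetric]; rule conv_integrable) fact+
  also have "norm \<dots> \<le> e * kernel_mass k S"
  proof (rule weighted_kernel_bound[OF k])
    show "\<rho> (x - z) - \<rho> (x' - z) = 0" if "norm z > S" for z
      using translate_support[where f=\<rho>, OF S(1) \<rho>(3) that] translate_support[where f=\<rho>, OF S(2) \<rho>(3) that] by simp
    show "\<bar>\<rho> (x - z) - \<rho> (x' - z)\<bar> \<le> e" for z using le[of "- z"] by simp
  qed (use \<rho>(1) in measurable)
  finally show ?thesis .
qed

text \<open>Continuity is uniform on the compact ball of radius \<open>R + 1\<close>. If two points
  at distance below 1 do not both lie in it, then both have norm above \<open>R\<close>, where
  \<open>f\<close> vanishes.\<close>

lemma compact_support_uniformly_continuous: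
  fixes f :: "'a::euclidean_space \<Rightarrow> 'b::real_normed_vector"
  assumes cont: "continuous_on UNIV f" and supp: "\<And>y. norm y > R \<Longrightarrow> f y = 0"
  shows "uniformly_continuous_on UNIV f"
proof (unfold uniformly_continuous_on_def, intro allI impI)
  fix e :: real assume e: "e > 0"
  have "uniformly_continuous_on (cball 0 (R + 1)) f"
    by (intro compact_uniformly_continuous continuous_on_subset[OF cont]) auto
  then obtain d where d: "d > 0"
    "\<And>x y. x \<in> cball 0 (R + 1) \<Longrightarrow> y \<in> cball 0 (R + 1) \<Longrightarrow> dist y x < d \<Longrightarrow> dist (f y) (f x) < e"
    unfolding uniformly_continuous_on_def using e by metis
  show "\<exists>d>0. \<forall>x\<in>UNIV. \<forall>x'\<in>UNIV. dist x' x < d \<longrightarrow> dist (f x') (f x) < e"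
  proof (intro exI[of _ "min d 1"] conjI ballI impI)
    fix x y :: 'a assume xy: "dist y x < min d 1"
    have n: "\<bar>norm x - norm y\<bar> < 1"
      using xy norm_triangle_ineq3[of x y] by (simp add: dist_norm norm_minus_commute)
    show "dist (f y) (f x) < e"
    proof (cases "norm x \<le> R + 1 \<and> norm y \<le> R + 1")
      case True then show ?thesis using d(2)[of x y] xy by auto
    next
      case False
      then have "f x = 0" "f y = 0" using n by (auto intro!: supp)
      then show ?thesis using e by simp
    qed
  qed (use d in auto)
qed

lemma compact_support_bounded:
  fixes f :: "'a::euclidean_space \<Rightarrow> 'b::real_normed_vector"
  assumes cont: "continuous_on UNIV f" and supp: "\<And>y. norm y > R \<Longrightarrow> f y = 0"
  obtains M where "M \<ge> 0" "\<And>y. norm (f y) \<le> M"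
proof -
  have "bounded (f ` cball 0 R)"
    by (intro compact_imp_bounded compact_continuous_image continuous_on_subset[OF cont]) auto
  then obtain M where M: "\<And>y. y \<in> cball 0 R \<Longrightarrow> norm (f y) \<le> M" unfolding bounded_iff by blast
  show thesis
  proof
    show "norm (f y) \<le> max M 0" for y
      using M[of y] supp[of y] by (cases "norm y \<le> R") (auto simp: le_max_iff_disj)
  qed simp
qed

section \<open>Regularity that a convolution inherits from its density\<close>

lemma conv_continuous:
  fixes k :: "'a::euclidean_space \<Rightarrow> 'b::{banach, second_countable_topology}"
  assumes k: "locally_integrable k"
    and cont: "continuous_on UNIV \<rho>" and supp: "\<And>y. norm y > R \<Longrightarrow> \<rho> y = 0"
  shows "continuous_on UNIV (conv \<rho> k)"
proof (unfold continuous_on_iff, intro ballI allI impI)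
  fix x :: 'a and e :: real assume e: "e > 0"
  obtain M where M: "\<And>y. norm (\<rho> y) \<le> M" using compact_support_bounded[OF cont supp] by blast
  have meas: "\<rho> \<in> borel_measurable borel" using cont by (rule borel_measurable_continuous_onI)
  \<comment> \<open>This radius covers the supports of all translates by points within distance 1 of
    \<open>x\<close>. The summand 1 in \<open>e'\<close> keeps the denominator positive when the
    kernel mass is 0.\<close>
  define S where "S = norm x + 1 + R"
  define e' where "e' = e / (kernel_mass k S + 1)"
  have pos: "kernel_mass k S + 1 > 0" using kernel_mass_nonneg[of k S] by linarith
  have e': "e' > 0" using e pos by (simp add: e'_def)
  obtain d where d: "d > 0" "\<And>y z. dist z y < d \<Longrightarrow> dist (\<rho> z) (\<rho> y) < e'"
    using compact_support_uniformly_continuous[OF cont supp] e'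
    unfolding uniformly_continuous_on_def by (metis UNIV_I)
  show "\<exists>d>0. \<forall>x'\<in>UNIV. dist x' x < d \<longrightarrow> dist (conv \<rho> k x') (conv \<rho> k x) < e"
  proof (intro exI[of _ "min d 1"] conjI ballI impI)
    fix x' assume x': "dist x' x < min d 1"
    have "norm x' \<le> norm x + norm (x' - x)" by (metis add.commute diff_add_cancel norm_triangle_ineq)
    then have "norm x' + R \<le> S" using x' by (simp add: S_def dist_norm)
    then have "norm (conv \<rho> k x' - conv \<rho> k x) \<le> e' * kernel_mass k S"
      using d(2)[of "x' + y" "x + y" for y] x'
      by (intro conv_diff_point[OF k meas M[unfolded real_norm_def] supp])
         (auto simp: S_def dist_real_def intro: less_imp_le)
    also have "\<dots> < e' * (kernel_mass k S + 1)" using e' by simp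
    also have "\<dots> = e" using pos by (simp add: e'_def)
    finally show "dist (conv \<rho> k x') (conv \<rho> k x) < e" by (simp add: dist_norm)
  qed (use d in auto)
qed

lemma conv_lipschitz:
  fixes k :: "'a::euclidean_space \<Rightarrow> 'b::{banach, second_countable_topology}"
  assumes k: "locally_integrable k"
    and \<rho>: "continuous_on UNIV \<rho>" "\<And>y. norm y > R \<Longrightarrow> \<rho> y = 0"
    and lip: "\<And>y z. \<bar>\<rho> y - \<rho> z\<bar> \<le> L * norm (y - z)" and S: "norm x \<le> S" "norm x' \<le> S"
  shows "norm (conv \<rho> k x - conv \<rho> k x') \<le> L * norm (x - x') * kernel_mass k (S + R)"
proof -
  obtain M where M: "\<And>y. norm (\<rho> y) \<le> M" using compact_support_bounded[OF \<rho>] by blast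
  have meas: "\<rho> \<in> borel_measurable borel" using \<rho>(1) by (rule borel_measurable_continuous_onI)
  show ?thesis
    using lip[of "x + y" "x' + y" for y] S
    by (intro conv_diff_point[OF k meas M[unfolded real_norm_def] \<rho>(2)]) auto
qed

text \<open>The derivative falls on the density, so local integrability of \<open>k\<close>
  suffices. With \<open>k = newton_grad\<close> this yields the second derivatives of a potential,
  although the derivative of that kernel is not locally integrable in dimension 3.\<close>

lemma conv_has_derivative:
  fixes k :: "'a::euclidean_space \<Rightarrow> 'b::{banach, second_countable_topology}"
  assumes k: "locally_integrable k"
    and der: "\<And>y. (\<rho> has_derivative (\<lambda>h. r y \<bullet> h)) (at y)"
    and cont: "continuous_on UNIV r"
    and supp: "\<And>y. norm y > R \<Longrightarrow> \<rho> y = 0" "\<And>y. norm y > R \<Longrightarrow> r y = 0"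
  shows "(conv \<rho> k has_derivative (\<lambda>h. conv (\<lambda>y. r y \<bullet> h) k x)) (at x)"
proof -
  have cont\<rho>: "continuous_on UNIV \<rho>"
    by (rule has_derivative_continuous_on) (rule has_derivative_at_withinI[OF der])
  have contr: "continuous_on UNIV (\<lambda>y. r y \<bullet> h)" for h
    by (intro continuous_intros cont)
  obtain M where M: "\<And>y. norm (\<rho> y) \<le> M" using compact_support_bounded[OF cont\<rho> supp(1)] by blast
  obtain M' where M': "M' \<ge> 0" "\<And>y. norm (r y) \<le> M'" using compact_support_bounded[OF cont supp(2)] by blast
  have bd: "\<bar>r y \<bullet> h\<bar> \<le> M' * norm h" for y h
    by (rule order_trans[OF Cauchy_Schwarz_ineq2 mult_right_mono[OF M'(2)]]) simp
  have suppr: "r y \<bullet> h = 0" if "norm y > R" for y h using supp(2)[OF that] by simp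
  have meas [measurable]: "\<rho> \<in> borel_measurable borel" "(\<lambda>y. r y \<bullet> h) \<in> borel_measurable borel" for h
    using cont\<rho> contr by (auto intro: borel_measurable_continuous_onI)
  have int: "integrable lborel (\<lambda>z. \<rho> (y - z) *\<^sub>R k z)" for y
    by (rule conv_integrable[OF k meas(1) M[unfolded real_norm_def] supp(1)])
  have intr: "integrable lborel (\<lambda>z. (r (y - z) \<bullet> h) *\<^sub>R k z)" for y h
    by (rule conv_integrable[OF k meas(2) bd suppr])
  have lin: "linear (\<lambda>h. conv (\<lambda>y. r y \<bullet> h) k x)"
  proof (rule linearI)
    fix a b show "conv (\<lambda>y. r y \<bullet> (a + b)) k x = conv (\<lambda>y. r y \<bullet> a) k x + conv (\<lambda>y. r y \<bullet> b) k x"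
      unfolding conv_def inner_add_right scaleR_add_left
      by (rule Bochner_Integration.integral_add[OF intr intr])
  next
    fix c a show "conv (\<lambda>y. r y \<bullet> (c *\<^sub>R a)) k x = c *\<^sub>R conv (\<lambda>y. r y \<bullet> a) k x"
      unfolding conv_def by (simp flip: scaleR_scaleR)
  qed
  show ?thesis
    unfolding has_derivative_at_alt
  proof (intro conjI allI impI)
    show "bounded_linear (\<lambda>h. conv (\<lambda>y. r y \<bullet> h) k x)"
      using lin by (simp add: linear_conv_bounded_linear)
    fix e :: real assume e: "e > 0"
    define S where "S = norm x + 1 + R"
    define e' where "e' = e / (kernel_mass k S + 1)"
    have pos: "kernel_mass k S + 1 > 0" using kernel_mass_nonneg[of k S] by linarith
    have e': "e' > 0" using e pos by (simp add: e'_def)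
    obtain d where d: "d > 0" "\<And>y z. dist z y < d \<Longrightarrow> dist (r z) (r y) < e'"
      using compact_support_uniformly_continuous[OF cont supp(2)] e'
      unfolding uniformly_continuous_on_def by (metis UNIV_I)
    \<comment> \<open>Uniform continuity of the gradient \<open>r\<close> makes the linearization
      error small at all points \<open>y\<close> at once; this uniformity allows the error to be
      taken out of the integral.\<close>
    have lin_rem: "\<bar>\<rho> (y + h) - \<rho> y - r y \<bullet> h\<bar> \<le> norm h * e'" if h: "norm h < d" for y h
    proof -
      have "norm (\<rho> (y + h) - \<rho> y - r y \<bullet> (y + h - y)) \<le> norm (y + h - y) * e'"
      proof (rule differentiable_bound_linearization[where S="ball y d" and f'="\<lambda>y h. r y \<bullet> h"])
        show "(\<rho> has_derivative (\<lambda>h. r v \<bullet> h)) (at v within ball y d)" for v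
          using der by (rule has_derivative_at_withinI)
        fix t :: real assume "t \<in> {0..1}"
        then have "norm (t *\<^sub>R h) \<le> norm h" by (auto simp: mult_left_le_one_le)
        then show "y + t *\<^sub>R (y + h - y) \<in> ball y d" using h by (simp add: dist_norm)
      next
        fix v assume "v \<in> ball y d"
        then have le: "norm (r v - r y) \<le> e'"
          using d(2)[of v y] by (simp add: dist_norm norm_minus_commute)
        show "onorm ((\<lambda>h. r v \<bullet> h) - (\<lambda>h. r y \<bullet> h)) \<le> e'"
        proof (rule onorm_le)
          fix u
          have "\<bar>(r v - r y) \<bullet> u\<bar> \<le> e' * norm u"
            by (rule order_trans[OF Cauchy_Schwarz_ineq2 mult_right_mono[OF le]]) simp
          then show "norm (((\<lambda>h. r v \<bullet> h) - (\<lambda>h. r y \<bullet> h)) u) \<le> e' * norm u"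
            by (simp add: inner_diff_left)
        qed
      qed (use d in auto)
      then show ?thesis by simp
    qed
    show "\<exists>d>0. \<forall>x'. norm (x' - x) < d \<longrightarrow>
       norm (conv \<rho> k x' - conv \<rho> k x - conv (\<lambda>y. r y \<bullet> (x' - x)) k x) \<le> e * norm (x' - x)"
    proof (intro exI[of _ "min d 1"] conjI allI impI)
      fix x' assume x': "norm (x' - x) < min d 1"
      define h where "h = x' - x"
      have nx': "norm x' \<le> norm x + norm h" unfolding h_def by (metis add.commute diff_add_cancel norm_triangle_ineq)
      have "conv \<rho> k x' - conv \<rho> k x - conv (\<lambda>y. r y \<bullet> h) k x =
         (LINT z|lborel. (\<rho> (x' - z) - \<rho> (x - z) - r (x - z) \<bullet> h) *\<^sub>R k z)"
        unfolding conv_def scaleR_diff_left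
        by (simp add: int intr)
      also have "norm \<dots> \<le> (norm h * e') * kernel_mass k S"
      proof (rule weighted_kernel_bound[OF k])
        show "\<bar>\<rho> (x' - z) - \<rho> (x - z) - r (x - z) \<bullet> h\<bar> \<le> norm h * e'" for z
          using lin_rem[of h "x - z"] x' by (simp add: h_def algebra_simps)
        show "\<rho> (x' - z) - \<rho> (x - z) - r (x - z) \<bullet> h = 0" if "norm z > S" for z
        proof -
          have "norm (x' - z) > R" "norm (x - z) > R"
            using that nx' x' by (auto intro!: norm_diff_gt_radius[of _ R S] simp: S_def h_def)
          then show ?thesis by (simp add: supp)
        qed
        have [measurable]: "(\<lambda>z. r (x - z) \<bullet> h) \<in> borel_measurable borel"
          using measurable_translate[OF meas(2)] .
        show "(\<lambda>z. \<rho> (x' - z) - \<rho> (x - z) - r (x - z) \<bullet> h) \<in> borel_measurable borel"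
          by measurable
      qed
      also have "\<dots> \<le> (norm h * e') * (kernel_mass k S + 1)" using e' by (intro mult_left_mono) auto
      also have "\<dots> = e * norm h" using pos by (simp add: e'_def)
      finally show "norm (conv \<rho> k x' - conv \<rho> k x - conv (\<lambda>y. r y \<bullet> (x' - x)) k x) \<le> e * norm (x' - x)"
        by (simp add: h_def)
    qed (use d in auto)
  qed
qed

section \<open>The Newtonian kernel in three dimensions\<close>

text \<open>Division by zero makes this function, its gradient and the majorant below vanish at the
  origin. The remainder estimate holds with these values too, so no exceptional points have to be
  removed from the integrals.\<close>

definition newton :: "'a::real_inner \<Rightarrow> real" where
  "newton z = 1 / norm z"

definition newton_grad :: "'a::real_inner \<Rightarrow> 'a" where
  "newton_grad z = (- (1 / norm z ^ 3)) *\<^sub>R z"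

text \<open>The order 5/2 lies midway between the orders 2 and 3 of the two remainder estimates and
  stays below the dimension 3. On bounded sets this function also dominates the kernel and its
  gradient, so a single integrability proof serves all three.\<close>

definition newton_majorant :: "'a::real_inner \<Rightarrow> real" where
  "newton_majorant z = 1 / (norm z ^ 2 * sqrt (norm z))"

text \<open>To be read with \<open>u = 1 / sqrt |z|\<close>, \<open>v = 1 / sqrt |z + h|\<close> and
  \<open>D = sqrt |h|\<close>. The product of the two bounds is a perfect square; its root contains
  the mixed term \<open>u^3 * v^2\<close>, which is at most \<open>u^5 + v^5\<close> by comparing
  \<open>u\<close> and \<open>v\<close>.\<close>

lemma geometric_mean_bound:
  fixes t D u v :: real
  assumes "D \<ge> 0" "u \<ge> 0" "v \<ge> 0"
    and 1: "\<bar>t\<bar> \<le> D^2 * (u^2 * v^2 + u^4)" and 2: "\<bar>t\<bar> \<le> D^4 * (u^4 * v^2 + u^6)"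
  shows "\<bar>t\<bar> \<le> 2 * D^3 * (u^5 + v^5)"
proof -
  have "\<bar>t\<bar> * \<bar>t\<bar> \<le> (D^2 * (u^2 * v^2 + u^4)) * (D^4 * (u^4 * v^2 + u^6))"
    by (rule mult_mono[OF 1 2]) auto
  also have "\<dots> = (D^3 * (u^3 * v^2 + u^5))\<^sup>2" by algebra
  finally have "\<bar>t\<bar>\<^sup>2 \<le> (D^3 * (u^3 * v^2 + u^5))\<^sup>2" by (simp add: power2_eq_square)
  then have *: "\<bar>t\<bar> \<le> D^3 * (u^3 * v^2 + u^5)"
    by (rule power2_le_imp_le) (use assms in auto)
  have "u^3 * v^2 \<le> u^5 + v^5"
  proof (cases "u \<le> v")
    case True
    then have "u^3 * v^2 \<le> v^3 * v^2" using assms by (intro mult_right_mono power_mono) auto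
    also have "\<dots> = v^5" by (simp flip: power_add)
    finally show ?thesis using assms by (smt (verit) zero_le_power)
  next
    case False
    then have "u^3 * v^2 \<le> u^3 * u^2" using assms by (intro mult_left_mono power_mono) auto
    also have "\<dots> = u^5" by (simp flip: power_add)
    finally show ?thesis using assms by (smt (verit) zero_le_power)
  qed
  have aux: "x + p \<le> 2 * (p + q)" if "x \<le> p + q" "0 \<le> q" for x p q :: real
    using that by simp
  have "u^3 * v^2 + u^5 \<le> 2 * (u^5 + v^5)"
    by (rule aux) (use assms \<open>u^3 * v^2 \<le> u^5 + v^5\<close> in auto)
  then have "D^3 * (u^3 * v^2 + u^5) \<le> D^3 * (2 * (u^5 + v^5))"
    using assms by (intro mult_left_mono) auto
  also have "\<dots> = 2 * D^3 * (u^5 + v^5)" by (simp add: algebra_simps)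
  finally show ?thesis using * by (rule order_trans[rotated])
qed

text \<open>
  The first-order Taylor remainder is at most of order \<open>|h|\<close> with a singularity of order 2, and at most
  of order \<open>|h|\<^sup>2\<close> with a singularity of order 3; the geometric mean of the two bounds is integrable.
\<close>

lemma newton_taylor_remainder:
  fixes z h :: "'a::real_inner"
  shows "\<bar>newton (z + h) - newton z - newton_grad z \<bullet> h\<bar>
    \<le> 2 * sqrt (norm h) ^ 3 * (newton_majorant z + newton_majorant (z + h))"
proof -
  define a b d where "a = norm z" and "b = norm (z + h)" and "d = norm h"
  have nonneg: "a \<ge> 0" "b \<ge> 0" "d \<ge> 0" by (simp_all add: a_def b_def d_def)
  have tri: "a \<le> b + d" "b \<le> a + d" "d \<le> a + b"
    using norm_triangle_ineq4[of "z + h" h] norm_triangle_ineq[of z h] norm_triangle_ineq4[of "z + h" z]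
    by (simp_all add: a_def b_def d_def)
  have inner: "2 * (z \<bullet> h) = b^2 - a^2 - d^2"
    unfolding a_def b_def d_def power2_norm_eq_inner by (simp add: inner_add inner_commute)
  define t where "t = newton (z + h) - newton z - newton_grad z \<bullet> h"
  have t: "t = 1 / b - 1 / a + (z \<bullet> h) / a^3"
    by (simp add: t_def newton_def newton_grad_def a_def b_def)
  have maj: "newton_majorant z + newton_majorant (z + h) = 1 / (a^2 * sqrt a) + 1 / (b^2 * sqrt b)"
    by (simp add: newton_majorant_def a_def b_def)
  have sq: "sqrt x ^ 3 = x * sqrt x" if "x \<ge> 0" for x
    using that by (simp add: power3_eq_cube)
  consider "z = 0" | "z \<noteq> 0" "z + h = 0" | "a > 0" "b > 0"
    by (auto simp: a_def b_def)
  then have "\<bar>t\<bar> \<le> 2 * sqrt d ^ 3 * (1 / (a^2 * sqrt a) + 1 / (b^2 * sqrt b))"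
  proof cases
    case 1
    then have "a = 0" "b = d" by (simp_all add: a_def b_def d_def)
    then show ?thesis using 1 nonneg unfolding t sq[OF nonneg(3)]
      by (cases "d = 0") (simp_all add: power2_eq_square divide_right_mono)
  next
    \<comment> \<open>By convention \<open>newton (z + h) = 0\<close>, so \<open>t = - 2 / d\<close>
      and the claim is an equality: the constant 2 is sharp.\<close>
    case 2
    then have "h = - z" by (simp add: eq_neg_iff_add_eq_0 add.commute)
    then have "b = 0" "a = d" "d > 0" "z \<bullet> h = - (d^2)"
      using 2 by (simp_all add: a_def b_def d_def power2_norm_eq_inner)
    then show ?thesis unfolding t sq[OF nonneg(3)]
      by (simp add: power2_eq_square power3_eq_cube)
  next
    case 3
    define u v D where "u = 1 / sqrt a" and "v = 1 / sqrt b" and "D = sqrt d"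
    have a: "1 / a = u^2" and b: "1 / b = v^2" and d: "d = D^2"
      using 3 nonneg by (simp_all add: u_def v_def D_def power_divide)
    have a3: "(z \<bullet> h) / a^3 = (z \<bullet> h) * u^6"
    proof -
      have "u^6 = (1/a)^3" unfolding a by (simp flip: power_mult)
      then show ?thesis by (simp add: power_divide)
    qed
    have ab: "\<bar>a - b\<bar> \<le> d" using tri by linarith
    have au: "a * u^2 = 1" and bv: "b * v^2 = 1" using 3 by (simp_all flip: a b)
    have "\<bar>t\<bar> \<le> 2 * D^3 * (u^5 + v^5)"
    proof (rule geometric_mean_bound)
      have 1: "1/b - 1/a = (a - b) * (u^2 * v^2)" using 3 by (simp flip: a b add: field_simps)
      have 2: "\<bar>(a - b) * (u^2 * v^2)\<bar> \<le> d * (u^2 * v^2)"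
        using ab by (simp add: abs_mult mult_right_mono)
      have "\<bar>(z \<bullet> h) * u^6\<bar> \<le> (a * d) * u^6"
        using Cauchy_Schwarz_ineq2[of z h] by (simp add: a_def d_def abs_mult mult_right_mono)
      also have "\<dots> = d * u^4" using au by algebra
      finally have 3: "\<bar>(z \<bullet> h) * u^6\<bar> \<le> d * u^4" .
      show "\<bar>t\<bar> \<le> D^2 * (u^2 * v^2 + u^4)"
        unfolding t a3 1 using 2 3 by (simp add: d distrib_left)
    next
      \<comment> \<open>Expressing the inner product by the three lengths cancels the first-order
        part. What remains is quadratic in \<open>a - b\<close> and \<open>d\<close>, and
        \<open>|a - b| \<le> d\<close>.\<close>
      have "2 * t = 2 * v^2 - 2 * u^2 + (b^2 - a^2 - d^2) * u^6"
        unfolding t a3 a b inner[symmetric] by (simp add: algebra_simps)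
      also have "\<dots> = (a - b)^2 * (2 * a + b) * (u^6 * v^2) - d^2 * u^6"
        using au bv by algebra
      finally have t2: "2 * t = (a - b)^2 * (2 * a + b) * (u^6 * v^2) - d^2 * u^6" .
      have "(a - b)^2 \<le> d^2" using ab by (metis abs_ge_zero power2_abs power_mono)
      then have le: "(a - b)^2 * ((2 * a + b) * (u^6 * v^2)) \<le> d^2 * ((2 * a + b) * (u^6 * v^2))"
        using 3 by (intro mult_right_mono) auto
      have eq: "d^2 * ((2 * a + b) * (u^6 * v^2)) = D^4 * (2 * u^4 * v^2 + u^6)"
        using au bv d by algebra
      have ge: "(a - b)^2 * (2 * a + b) * (u^6 * v^2) \<ge> 0" using 3 by auto
      have d4: "d^2 = D^4" using d by simp
      have pos: "D^4 * (u^4 * v^2) \<ge> 0" "D^4 * u^6 \<ge> 0" by auto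
      have "2 * t \<le> D^4 * (2 * u^4 * v^2 + u^6) - d^2 * u^6" using t2 le eq by (simp add: mult.assoc)
      then have "t \<le> D^4 * (u^4 * v^2)" unfolding d4 by (simp add: algebra_simps)
      moreover have "- (D^4 * u^6) \<le> 2 * t" using t2 ge unfolding d4 by linarith
      ultimately show "\<bar>t\<bar> \<le> D^4 * (u^4 * v^2 + u^6)"
        using pos by (simp only: abs_le_iff distrib_left) linarith
    qed (use 3 nonneg in \<open>auto simp: u_def v_def D_def\<close>)
    moreover have "u^5 = 1 / (a^2 * sqrt a)" "v^5 = 1 / (b^2 * sqrt b)"
      using 3 by (simp_all add: u_def v_def power_divide eval_nat_numeral)
    ultimately show ?thesis by (simp add: D_def)
  qed
  then show ?thesis unfolding maj t_def d_def .
qed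

section \<open>Integrability of the kernels near the singularity\<close>

lemma newton_majorant_nonneg: "0 \<le> newton_majorant z"
  by (simp add: newton_majorant_def)

lemma borel_measurable_newton [measurable]:
  "(newton :: 'a::euclidean_space \<Rightarrow> real) \<in> borel_measurable borel"
  "(newton_majorant :: 'a \<Rightarrow> real) \<in> borel_measurable borel"
  "(newton_grad :: 'a \<Rightarrow> 'a) \<in> borel_measurable borel"
  unfolding newton_def newton_majorant_def newton_grad_def by measurable

text \<open>For the least \<open>k\<close> with \<open>R / 4 ^ Suc k < norm z\<close>, the point
  \<open>z\<close> lies in the ball of radius \<open>R / 4 ^ k\<close>, and this single term of the
  sum dominates. The ratio 4 makes the square root exact, so the majorant grows by
  \<open>16 * 2 = 32\<close> from one scale to the next.\<close>

lemma newton_majorant_le_dyadic_sum: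
  fixes z :: "'a::euclidean_space"
  assumes R: "R > 0"
  shows "ennreal (newton_majorant z) * indicator (cball 0 R) z
    \<le> (\<Sum>k. ennreal (32 ^ Suc k / (R\<^sup>2 * sqrt R)) * indicator (cball 0 (R / 4 ^ k)) z)"
proof (cases "z = 0 \<or> norm z > R")
  case True
  then show ?thesis by (auto simp: newton_majorant_def)
next
  case False
  define P where "P k \<longleftrightarrow> R / 4 ^ Suc k < norm z" for k :: nat
  obtain n where "R / norm z < 4 ^ n" using real_arch_pow[of 4 "R / norm z"] by auto
  then have "R / 4 ^ n < norm z" using False R by (simp add: field_simps)
  moreover have "R / 4 ^ Suc n \<le> R / 4 ^ n" using R by (simp add: field_simps)
  ultimately have "P n" unfolding P_def by linarith
  then have Pk: "P (LEAST k. P k)" by (rule LeastI)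
  define k where "k = (LEAST k. P k)"
  have low: "R / 4 ^ Suc k < norm z" using Pk by (simp add: P_def k_def)
  have up: "norm z \<le> R / 4 ^ k"
  proof (cases k)
    case 0 then show ?thesis using False by simp
  next
    case (Suc j)
    then have "\<not> P j" unfolding k_def using not_less_Least by (metis lessI)
    then show ?thesis by (simp add: P_def Suc)
  qed
  have sq: "sqrt (4 ^ Suc k) = 2 ^ Suc k"
    by (rule real_sqrt_unique) (simp_all add: power2_eq_square flip: power_mult_distrib)
  define \<delta> where "\<delta> = R / 4 ^ Suc k"
  have \<delta>: "\<delta> > 0" using R by (simp add: \<delta>_def)
  have "\<delta>\<^sup>2 * sqrt \<delta> \<le> norm z ^ 2 * sqrt (norm z)"
    using low \<delta> unfolding \<delta>_def[symmetric] by (intro mult_mono power_mono) auto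
  then have "newton_majorant z \<le> 1 / (\<delta>\<^sup>2 * sqrt \<delta>)"
    unfolding newton_majorant_def using \<delta> by (intro divide_left_mono) (use False in auto)
  also have "\<dots> = (16 ^ Suc k * 2 ^ Suc k) / (R\<^sup>2 * sqrt R)"
    unfolding \<delta>_def real_sqrt_divide sq by (simp add: power_divide power2_eq_square flip: power_mult_distrib)
  also have "\<dots> = 32 ^ Suc k / (R\<^sup>2 * sqrt R)" by (simp flip: power_mult_distrib)
  finally have "ennreal (newton_majorant z) * indicator (cball 0 R) z
    \<le> ennreal (32 ^ Suc k / (R\<^sup>2 * sqrt R)) * indicator (cball 0 (R / 4 ^ k)) z"
    using False up by (simp add: ennreal_leI)
  also have "\<dots> \<le> (\<Sum>k. ennreal (32 ^ Suc k / (R\<^sup>2 * sqrt R)) * indicator (cball 0 (R / 4 ^ k)) z)"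
    using sum_le_suminf[of "\<lambda>k. ennreal (32 ^ Suc k / (R\<^sup>2 * sqrt R)) * indicator (cball 0 (R / 4 ^ k)) z" "{k}"]
    by (simp del: sum_mult_indicator)
  finally show ?thesis .
qed

text \<open>The factor may depend on the radius, since a weaker singularity is dominated by a
  stronger one only on bounded sets.\<close>

lemma locally_integrableI_le:
  fixes k :: "'a::euclidean_space \<Rightarrow> 'b::{banach, second_countable_topology}" and g :: "'a \<Rightarrow> real"
  assumes "k \<in> borel_measurable borel" and g: "locally_integrable g"
    and "\<And>R z. R > 0 \<Longrightarrow> norm z \<le> R \<Longrightarrow> norm (k z) \<le> c R * g z"
  shows "locally_integrable k"
  unfolding locally_integrable_def
proof (intro conjI allI)
  note [measurable] = assms(1)
  fix R
  \<comment> \<open>The comparison requires a positive radius, while \<open>R\<close> may be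
    negative or 0 here; hence \<open>\<bar>R\<bar> + 1\<close>.\<close>
  have "integrable lborel (\<lambda>z. c (\<bar>R\<bar> + 1) * (indicator (cball 0 R) z *\<^sub>R g z))"
    using g by (intro integrable_mult_right) (auto simp: locally_integrable_def set_integrable_def)
  then show "set_integrable lborel (cball 0 R) k"
    unfolding set_integrable_def
  proof (rule Bochner_Integration.integrable_bound)
    show "AE z in lborel. norm (indicat_real (cball 0 R) z *\<^sub>R k z)
         \<le> norm (c (\<bar>R\<bar> + 1) * (indicat_real (cball 0 R) z *\<^sub>R g z))"
      using assms(3)[of "\<bar>R\<bar> + 1"] by (auto simp: indicator_def intro!: AE_I2 order_trans[OF _ abs_ge_self])
  qed (auto intro!: borel_measurable_scaleR borel_measurable_indicator)
qed fact

text \<open>On the ball of radius \<open>R / 4 ^ k\<close> the coefficient grows like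
  \<open>32 ^ k\<close> while the volume shrinks like \<open>1 / 64 ^ k\<close>, so the integrals
  form a geometric series of ratio 1/2.\<close>

lemma locally_integrable_newton_majorant:
  "locally_integrable (newton_majorant :: real^3 \<Rightarrow> real)"
  unfolding locally_integrable_def
proof (intro conjI allI)
  fix R0 :: real
  define R where "R = \<bar>R0\<bar> + 1"
  have R: "R > 0" by (simp add: R_def)
  define C where "C = 32 * unit_ball_vol 3 * R ^ 3 / (R\<^sup>2 * sqrt R)"
  have C: "C \<ge> 0" using R by (simp add: C_def unit_ball_vol_nonneg)
  have "(\<integral>\<^sup>+ z. ennreal (newton_majorant z) * indicator (cball (0::real^3) R) z \<partial>lborel)
    \<le> (\<integral>\<^sup>+ z. (\<Sum>k. ennreal (32 ^ Suc k / (R\<^sup>2 * sqrt R)) * indicator (cball (0::real^3) (R / 4 ^ k)) z) \<partial>lborel)"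
    by (intro nn_integral_mono newton_majorant_le_dyadic_sum R)
  also have "\<dots> = (\<Sum>k. \<integral>\<^sup>+ z. ennreal (32 ^ Suc k / (R\<^sup>2 * sqrt R)) * indicator (cball (0::real^3) (R / 4 ^ k)) z \<partial>lborel)"
    by (intro nn_integral_suminf borel_measurable_times_ennreal borel_measurable_indicator borel_measurable_const) simp
  also have "\<dots> = (\<Sum>k. ennreal (C * (1/2) ^ k))"
  proof (rule suminf_cong)
    fix k
    have "(\<integral>\<^sup>+ z. ennreal (32 ^ Suc k / (R\<^sup>2 * sqrt R)) * indicator (cball (0::real^3) (R / 4 ^ k)) z \<partial>lborel)
      = ennreal (32 ^ Suc k / (R\<^sup>2 * sqrt R)) * ennreal (unit_ball_vol 3 * (R / 4 ^ k) ^ 3)"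
      using R by (subst nn_integral_cmult_indicator) (auto simp: emeasure_cball)
    also have "\<dots> = ennreal (32 ^ Suc k / (R\<^sup>2 * sqrt R) * (unit_ball_vol 3 * (R / 4 ^ k) ^ 3))"
      using R by (intro ennreal_mult[symmetric]) auto
    also have "32 ^ Suc k / (R\<^sup>2 * sqrt R) * (unit_ball_vol 3 * (R / 4 ^ k) ^ 3) = C * (32 ^ k / (4 ^ k) ^ 3)"
      by (simp add: C_def power_divide)
    also have "(32::real) ^ k / (4 ^ k) ^ 3 = (1/2) ^ k"
      by (simp add: power3_eq_cube flip: power_mult_distrib power_divide)
    finally show "(\<integral>\<^sup>+ z. ennreal (32 ^ Suc k / (R\<^sup>2 * sqrt R)) * indicator (cball (0::real^3) (R / 4 ^ k)) z \<partial>lborel)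
      = ennreal (C * (1/2) ^ k)" .
  qed
  also have "\<dots> = ennreal (\<Sum>k. C * (1/2) ^ k)"
    using C by (intro suminf_ennreal2 summable_mult summable_geometric) auto
  also have "\<dots> < \<infinity>" by simp
  finally have fin: "(\<integral>\<^sup>+ z. ennreal (newton_majorant z) * indicator (cball (0::real^3) R) z \<partial>lborel) < \<infinity>" .
  have "set_integrable lborel (cball (0::real^3) R) newton_majorant"
    unfolding set_integrable_def
  proof (rule integrableI_bounded)
    have "(\<integral>\<^sup>+ z. ennreal (norm (indicator (cball (0::real^3) R) z *\<^sub>R newton_majorant z)) \<partial>lborel)
      = (\<integral>\<^sup>+ z. ennreal (newton_majorant z) * indicator (cball (0::real^3) R) z \<partial>lborel)"
      by (intro nn_integral_cong) (auto simp: indicator_def newton_majorant_nonneg)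
    then show "(\<integral>\<^sup>+ z. ennreal (norm (indicator (cball (0::real^3) R) z *\<^sub>R newton_majorant z)) \<partial>lborel) < \<infinity>"
      using fin by simp
    have "indicator (cball (0::real^3) R) \<in> borel_measurable borel"
      by (rule borel_measurable_indicator) simp
    from borel_measurable_times[OF this borel_measurable_newton(2)]
    show "(\<lambda>z. indicat_real (cball (0::real^3) R) z *\<^sub>R newton_majorant z) \<in> borel_measurable lborel"
      by simp
  qed
  then show "set_integrable lborel (cball (0::real^3) R0) newton_majorant"
    by (rule set_integrable_subset) (auto simp: R_def)
qed measurable

lemma norm_newton_le:
  assumes "R > 0" "norm z \<le> R"
  shows "norm (newton z) \<le> (R * sqrt R) * newton_majorant z"
proof (cases "z = 0")
  case False
  have "norm z * sqrt (norm z) \<le> R * sqrt R" using assms by (intro mult_mono) auto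
  then have "1 / norm z * ((norm z * sqrt (norm z)) / (norm z * sqrt (norm z)))
      \<le> 1 / norm z * ((R * sqrt R) / (norm z * sqrt (norm z)))"
    using False by (intro mult_left_mono divide_right_mono) auto
  then show ?thesis using False by (simp add: newton_def newton_majorant_def power2_eq_square mult.assoc)
qed (simp add: newton_def newton_majorant_def)

lemma norm_newton_grad_le:
  assumes "R > 0" "norm z \<le> R"
  shows "norm (newton_grad z) \<le> sqrt R * newton_majorant z"
proof (cases "z = 0")
  case False
  have "sqrt (norm z) \<le> sqrt R" using assms by auto
  then have "1 / (norm z)^2 * (sqrt (norm z) / sqrt (norm z)) \<le> 1 / (norm z)^2 * (sqrt R / sqrt (norm z))"
    using False by (intro mult_left_mono divide_right_mono) auto
  then show ?thesis using False
    by (simp add: newton_grad_def newton_majorant_def power2_eq_square power3_eq_cube mult.assoc)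
qed (simp add: newton_grad_def newton_majorant_def)

lemma locally_integrable_newton: "locally_integrable (newton :: real^3 \<Rightarrow> real)"
  by (rule locally_integrableI_le[OF borel_measurable_newton(1) locally_integrable_newton_majorant norm_newton_le])

lemma locally_integrable_newton_grad: "locally_integrable (newton_grad :: real^3 \<Rightarrow> real^3)"
  by (rule locally_integrableI_le[OF borel_measurable_newton(3) locally_integrable_newton_majorant norm_newton_grad_le])

text \<open>The derivative falls on the kernel, so a bounded measurable density suffices.
  Integrating the Taylor remainder against it leaves an error of order \<open>|h|^(3/2)\<close>,
  which is \<open>o(|h|)\<close>.\<close>

lemma newton_potential_has_derivative:
  fixes \<rho> :: "real^3 \<Rightarrow> real"
  assumes \<rho>: "\<rho> \<in> borel_measurable borel" "\<And>y. \<bar>\<rho> y\<bar> \<le> M" "\<And>y. norm y > R \<Longrightarrow> \<rho> y = 0"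
  shows "(conv \<rho> newton has_derivative (\<lambda>h. conv \<rho> newton_grad x \<bullet> h)) (at x)"
  unfolding has_derivative_at_alt
proof (intro conjI allI impI)
  show "bounded_linear (\<lambda>h. conv \<rho> newton_grad x \<bullet> h)" by (rule bounded_linear_inner_right)
  fix e :: real assume e: "e > 0"
  note [measurable] = \<rho>(1)
  define S where "S = norm x + 1 + R"
  \<comment> \<open>One factor 2 comes from the remainder estimate, the other from its two
    majorants.\<close>
  define Q where "Q = 4 * (M * kernel_mass (newton_majorant :: real^3 \<Rightarrow> real) S)"
  have M: "M \<ge> 0" using \<rho>(2)[of 0] by linarith
  have Q: "Q \<ge> 0" using M by (simp add: Q_def kernel_mass_nonneg)
  \<comment> \<open>The square undoes the root: \<open>norm h < d\<close> gives
    \<open>sqrt (norm h) * Q \<le> e\<close>.\<close>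
  define d where "d = min 1 ((e / (Q + 1))\<^sup>2)"
  have d: "d > 0" using e Q by (simp add: d_def)
  have int: "integrable lborel (\<lambda>y. \<rho> y *\<^sub>R newton (u - y))"
    "integrable lborel (\<lambda>y. \<rho> y *\<^sub>R newton_grad (u - y))" for u
    by (rule conv_alt_integrable[OF locally_integrable_newton \<rho>] conv_alt_integrable[OF locally_integrable_newton_grad \<rho>]; assumption)+
  have abs\<rho>: "(\<lambda>y. \<bar>\<rho> y\<bar>) \<in> borel_measurable borel" "\<And>y. \<bar>\<bar>\<rho> y\<bar>\<bar> \<le> M" "\<And>y. norm y > R \<Longrightarrow> \<bar>\<rho> y\<bar> = 0"
    using \<rho> by auto
  have intq: "integrable lborel (\<lambda>y. \<bar>\<rho> y\<bar> *\<^sub>R newton_majorant (u - y))" for u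
    by (rule conv_alt_integrable[OF locally_integrable_newton_majorant abs\<rho>])
  define K where "K = M * kernel_mass (newton_majorant :: real^3 \<Rightarrow> real) S"
  have K: "conv (\<lambda>y. \<bar>\<rho> y\<bar>) newton_majorant (x + h) \<le> K" if "norm h \<le> 1" for h
  proof -
    have "norm (x + h) + R \<le> S" using that norm_triangle_ineq[of x h] by (simp add: S_def)
    then have "norm (conv (\<lambda>y. \<bar>\<rho> y\<bar>) newton_majorant (x + h)) \<le> K"
      unfolding K_def by (intro conv_bound[OF locally_integrable_newton_majorant abs\<rho>(1,2)] abs\<rho>(3))
    then show ?thesis unfolding real_norm_def by (rule abs_le_D1)
  qed
  have main: "norm (conv \<rho> newton (x + h) - conv \<rho> newton x - conv \<rho> newton_grad x \<bullet> h) \<le> sqrt (norm h) ^ 3 * Q"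
    if h: "norm h \<le> 1" for h
  proof -
    have inth: "integrable lborel (\<lambda>y. (\<rho> y *\<^sub>R newton_grad (x - y)) \<bullet> h)"
      using int(2) by (rule integrable_inner_left)
    have "conv \<rho> newton_grad x \<bullet> h = (LINT y|lborel. (\<rho> y *\<^sub>R newton_grad (x - y)) \<bullet> h)"
      unfolding conv_alt[OF borel_measurable_newton(3) \<rho>(1)]
      using int(2) by (rule integral_inner_left[symmetric])
    then have "conv \<rho> newton (x + h) - conv \<rho> newton x - conv \<rho> newton_grad x \<bullet> h =
      (LINT y|lborel. \<rho> y *\<^sub>R newton (x + h - y) - \<rho> y *\<^sub>R newton (x - y) - (\<rho> y *\<^sub>R newton_grad (x - y)) \<bullet> h)"
      using int(1) inth by (simp add: conv_alt[OF borel_measurable_newton(1) \<rho>(1)])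
    also have "norm \<dots> \<le> (LINT y|lborel. (2 * sqrt (norm h) ^ 3) *
       (\<bar>\<rho> y\<bar> *\<^sub>R newton_majorant (x - y) + \<bar>\<rho> y\<bar> *\<^sub>R newton_majorant (x + h - y)))"
    proof (rule Bochner_Integration.integral_norm_bound_integral)
      fix y
      have "\<rho> y *\<^sub>R newton (x + h - y) - \<rho> y *\<^sub>R newton (x - y) - (\<rho> y *\<^sub>R newton_grad (x - y)) \<bullet> h
        = \<rho> y * (newton ((x - y) + h) - newton (x - y) - newton_grad (x - y) \<bullet> h)"
        by (simp add: algebra_simps)
      also have "norm \<dots> \<le> \<bar>\<rho> y\<bar> * (2 * sqrt (norm h) ^ 3 * (newton_majorant (x - y) + newton_majorant ((x - y) + h)))"
        unfolding real_norm_def abs_mult by (intro mult_left_mono newton_taylor_remainder) auto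
      finally show "norm (\<rho> y *\<^sub>R newton (x + h - y) - \<rho> y *\<^sub>R newton (x - y) - (\<rho> y *\<^sub>R newton_grad (x - y)) \<bullet> h)
        \<le> (2 * sqrt (norm h) ^ 3) *
       (\<bar>\<rho> y\<bar> *\<^sub>R newton_majorant (x - y) + \<bar>\<rho> y\<bar> *\<^sub>R newton_majorant (x + h - y))"
        by (simp add: algebra_simps)
    qed (use int(1) inth intq in auto)
    also have "\<dots> = 2 * sqrt (norm h) ^ 3 * (conv (\<lambda>y. \<bar>\<rho> y\<bar>) newton_majorant x + conv (\<lambda>y. \<bar>\<rho> y\<bar>) newton_majorant (x + h))"
      unfolding conv_alt[OF borel_measurable_newton(2) abs\<rho>(1)]
        Bochner_Integration.integral_add[OF intq[of x] intq[of "x + h"], symmetric]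
      by (rule integral_mult_right_zero)
    also have "\<dots> \<le> 2 * sqrt (norm h) ^ 3 * (K + K)"
      using K[of 0] K[OF h] by (intro mult_left_mono add_mono) auto
    finally show ?thesis by (simp add: Q_def K_def mult_ac)
  qed
  show "\<exists>d>0. \<forall>x'. norm (x' - x) < d \<longrightarrow>
      norm (conv \<rho> newton x' - conv \<rho> newton x - conv \<rho> newton_grad x \<bullet> (x' - x)) \<le> e * norm (x' - x)"
  proof (intro exI[of _ d] conjI allI impI d)
    fix x' assume x': "norm (x' - x) < d"
    define h where "h = x' - x"
    have h: "norm h \<le> 1" "norm h \<le> (e / (Q + 1))\<^sup>2" using x' by (auto simp: d_def h_def)
    have "sqrt (norm h) \<le> e / (Q + 1)"
      using h(2) e Q by (intro real_le_lsqrt) auto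
    then have "sqrt (norm h) * Q \<le> e / (Q + 1) * (Q + 1)" using e Q by (intro mult_mono) auto
    then have le: "sqrt (norm h) * Q \<le> e" using Q by simp
    have "sqrt (norm h) ^ 3 * Q = norm h * (sqrt (norm h) * Q)"
      by (simp add: power3_eq_cube)
    also have "\<dots> \<le> norm h * e" using le by (intro mult_left_mono) auto
    finally show "norm (conv \<rho> newton x' - conv \<rho> newton x - conv \<rho> newton_grad x \<bullet> (x' - x)) \<le> e * norm (x' - x)"
      using main[OF h(1)] by (simp add: h_def mult.commute)
  qed
qed

section \<open>Spherical coordinates\<close>

lemma vector3_axis: "(vector [a, b, c] :: real^3) = a *\<^sub>R axis 1 1 + b *\<^sub>R axis 2 1 + c *\<^sub>R axis 3 1"
  by (simp add: vec_eq_iff forall_3 axis_def)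

text \<open>Both measures give a box the product of its side lengths, and boxes determine a Borel
  measure of this kind. The link is needed because the integral equation is written with iterated
  integrals, while the change of variables takes place in \<open>real^3\<close>.\<close>

lemma lborel_real3:
  "distr (lborel \<Otimes>\<^sub>M (lborel \<Otimes>\<^sub>M lborel)) borel (\<lambda>(a, b, c). vector [a, b, c] :: real^3) = lborel"
proof (rule lborel_eqI[symmetric])
  let ?T = "\<lambda>(a, b, c). vector [a, b, c] :: real^3"
  have T: "?T = (\<lambda>t. fst t *\<^sub>R axis 1 1 + fst (snd t) *\<^sub>R axis 2 1 + snd (snd t) *\<^sub>R axis 3 1)"
    by (simp add: vector3_axis case_prod_unfold)
  have [measurable]: "?T \<in> lborel \<Otimes>\<^sub>M (lborel \<Otimes>\<^sub>M lborel) \<rightarrow>\<^sub>M borel"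
    unfolding T by measurable
  fix l u :: "real^3" assume lu: "\<And>b. b \<in> Basis \<Longrightarrow> l \<bullet> b \<le> u \<bullet> b"
  have le: "l $ i \<le> u $ i" for i
    using lu[of "axis i 1"] by (auto simp: Basis_vec_def inner_axis)
  have "?T -` box l u \<inter> space (lborel \<Otimes>\<^sub>M (lborel \<Otimes>\<^sub>M lborel))
    = {l$1<..<u$1} \<times> {l$2<..<u$2} \<times> {l$3<..<u$3}"
    by (auto simp: mem_box_cart forall_3 space_pair_measure)
  then have "emeasure (distr (lborel \<Otimes>\<^sub>M (lborel \<Otimes>\<^sub>M lborel)) borel ?T) (box l u)
    = emeasure (lborel \<Otimes>\<^sub>M (lborel \<Otimes>\<^sub>M lborel)) ({l$1<..<u$1} \<times> {l$2<..<u$2} \<times> {l$3<..<u$3})"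
    by (subst emeasure_distr) auto
  also have "\<dots> = emeasure lborel {l$1<..<u$1} * (emeasure lborel {l$2<..<u$2} * emeasure lborel {l$3<..<u$3})"
  proof -
    have sets: "{l$2<..<u$2} \<in> sets lborel" "{l$3<..<u$3} \<in> sets lborel" "{l$1<..<u$1} \<in> sets lborel"
      "{l$2<..<u$2} \<times> {l$3<..<u$3} \<in> sets lborel" by (auto intro!: borel_Times)
    have "emeasure (lborel \<Otimes>\<^sub>M lborel) ({l$2<..<u$2} \<times> {l$3<..<u$3}) = emeasure lborel {l$2<..<u$2} * emeasure lborel {l$3<..<u$3}"
      by (rule lborel.emeasure_pair_measure_Times[OF sets(1,2)])
    then have 1: "emeasure lborel ({l$2<..<u$2} \<times> {l$3<..<u$3}) = emeasure lborel {l$2<..<u$2} * emeasure lborel {l$3<..<u$3}"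
      by (simp only: lborel_prod)
    have "emeasure (lborel \<Otimes>\<^sub>M lborel) ({l$1<..<u$1} \<times> {l$2<..<u$2} \<times> {l$3<..<u$3})
      = emeasure lborel {l$1<..<u$1} * emeasure lborel ({l$2<..<u$2} \<times> {l$3<..<u$3})"
      by (rule lborel.emeasure_pair_measure_Times[OF sets(3,4)])
    then show ?thesis
      unfolding 1 lborel_prod[where 'a=real and 'b=real] .
  qed
  also have "\<dots> = ennreal (\<Prod>i\<in>UNIV. (u - l) $ i)"
  proof -
    have "(\<Prod>i\<in>UNIV. (u - l) $ i) = (u$1 - l$1) * ((u$2 - l$2) * (u$3 - l$3))"
      unfolding UNIV_3 by simp
    then show ?thesis
      using le[of 1] le[of 2] le[of 3] by (simp only: emeasure_lborel_Ioo ennreal_mult' diff_ge_0_iff_ge mult_nonneg_nonneg)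
  qed
  also have "(\<Prod>i\<in>UNIV. (u - l) $ i) = (\<Prod>b\<in>Basis. (u - l) \<bullet> b)"
    by (simp add: Basis_vec_def cart_eq_inner_axis axis_eq_axis prod.UNION_disjoint)
  finally show "emeasure (distr (lborel \<Otimes>\<^sub>M (lborel \<Otimes>\<^sub>M lborel)) borel ?T) (box l u) = (\<Prod>b\<in>Basis. (u - l) \<bullet> b)"
    by simp
qed simp

lemma integral_real3_iterated:
  fixes h :: "real^3 \<Rightarrow> real"
  assumes int: "integrable lborel h"
  shows "(LINT v|lborel. h v) = (LINT a|lborel. LINT b|lborel. LINT c|lborel. h (vector [a, b, c]))"
proof -
  let ?T = "\<lambda>(a, b, c). vector [a, b, c] :: real^3"
  let ?L = "lborel :: real measure"
  have T: "?T = (\<lambda>t. fst t *\<^sub>R axis 1 1 + fst (snd t) *\<^sub>R axis 2 1 + snd (snd t) *\<^sub>R axis 3 1)"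
    by (simp add: vector3_axis case_prod_unfold)
  have meas: "?T \<in> ?L \<Otimes>\<^sub>M (?L \<Otimes>\<^sub>M ?L) \<rightarrow>\<^sub>M borel"
    unfolding T by measurable
  have h: "h \<in> borel_measurable borel" using int by auto
  have "integrable (distr (?L \<Otimes>\<^sub>M (?L \<Otimes>\<^sub>M ?L)) borel ?T) h"
    using int by (simp add: lborel_real3)
  then have i3: "integrable (?L \<Otimes>\<^sub>M (?L \<Otimes>\<^sub>M ?L)) (\<lambda>t. h (?T t))"
    using meas h by (subst (asm) integrable_distr_eq)
  then have i3': "integrable (?L \<Otimes>\<^sub>M lborel) (\<lambda>t. h (?T t))"
    by (simp add: lborel_prod)
  have "(LINT v|lborel. h v) = (LINT v|(distr (?L \<Otimes>\<^sub>M (?L \<Otimes>\<^sub>M ?L)) borel ?T). h v)"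
    by (simp add: lborel_real3)
  also have "\<dots> = (LINT t|(?L \<Otimes>\<^sub>M (?L \<Otimes>\<^sub>M ?L)). h (?T t))"
    by (rule integral_distr[OF meas h])
  also have "\<dots> = (LINT t|(?L \<Otimes>\<^sub>M lborel). h (?T t))" by (simp add: lborel_prod)
  also have "\<dots> = (LINT a|lborel. LINT s|lborel. h (?T (a, s)))"
    by (rule lborel_pair.integral_fst'[OF i3', symmetric])
  \<comment> \<open>The second use of Fubini's theorem is justified only for those \<open>a\<close>
    whose section is integrable, hence a comparison of the inner integrals almost
    everywhere.\<close>
  also have "\<dots> = (LINT a|lborel. LINT b|lborel. LINT c|lborel. h (vector [a, b, c]))"
  proof (rule integral_cong_AE)
    show "AE a in lborel. (LINT s|lborel. h (?T (a, s))) = (LINT b|lborel. LINT c|lborel. h (vector [a, b, c]))"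
      using lborel_pair.AE_integrable_fst'[OF i3']
    proof eventually_elim
      fix a assume "integrable lborel (\<lambda>s. h (?T (a, s)))"
      then have "integrable (?L \<Otimes>\<^sub>M ?L) (\<lambda>s. h (?T (a, s)))" by (simp add: lborel_prod)
      from lborel_pair.integral_fst'[OF this]
      show "(LINT s|lborel. h (?T (a, s))) = (LINT b|lborel. LINT c|lborel. h (vector [a, b, c]))"
        by (simp add: lborel_prod)
    qed
    have [measurable]: "(\<lambda>t. h (?T t)) \<in> borel_measurable (?L \<Otimes>\<^sub>M (?L \<Otimes>\<^sub>M ?L))"
      using i3 by auto
    have "(\<lambda>t::(real \<times> real) \<times> real. h (fst (fst t) *\<^sub>R axis 1 1 + snd (fst t) *\<^sub>R axis 2 1 + snd t *\<^sub>R axis 3 1))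
        \<in> borel_measurable ((?L \<Otimes>\<^sub>M ?L) \<Otimes>\<^sub>M ?L)"
      by (rule measurable_compose[OF _ h]) measurable
    then have [measurable]: "(\<lambda>t. h (vector [fst (fst t), snd (fst t), snd t])) \<in> borel_measurable ((?L \<Otimes>\<^sub>M ?L) \<Otimes>\<^sub>M ?L)"
      unfolding vector3_axis .
    show "(\<lambda>a. LINT s|lborel. h (?T (a, s))) \<in> borel_measurable lborel"
      by (rule borel_measurable_integrable[OF lborel_pair.integrable_fst'[OF i3']])
    have "(\<lambda>s. LINT c|?L. h (vector [fst s, snd s, c])) \<in> borel_measurable (?L \<Otimes>\<^sub>M ?L)"
      by measurable
    then show "(\<lambda>a. LINT b|?L. LINT c|?L. h (vector [a, b, c])) \<in> borel_measurable lborel"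
      by measurable
  qed
  finally show ?thesis .
qed

text \<open>
  Spherical coordinates \<open>(\<zeta>, r, \<beta>)\<close> with the azimuth \<open>\<beta>\<close> counted from the horizontal direction \<open>(p, q)\<close>.
\<close>

definition spherical :: "real \<Rightarrow> real \<Rightarrow> real^3 \<Rightarrow> real^3" where
  "spherical p q v = vector
     [v$2 * sqrt (1 - (v$1)\<^sup>2) * (p * cos (v$3) - q * sin (v$3)),
      v$2 * sqrt (1 - (v$1)\<^sup>2) * (q * cos (v$3) + p * sin (v$3)),
      v$2 * v$1]"

text \<open>Here \<open>s\<close> is the sine of the polar angle and \<open>(A, B)\<close> is
  \<open>(p, q)\<close> rotated by the azimuth. The division by \<open>s\<close> restricts the
  formula to points off the poles.\<close>

definition spherical_deriv :: "real \<Rightarrow> real \<Rightarrow> real^3 \<Rightarrow> real^3 \<Rightarrow> real^3" where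
  "spherical_deriv p q v h = (let s = sqrt (1 - (v$1)\<^sup>2); A = p * cos (v$3) - q * sin (v$3); B = q * cos (v$3) + p * sin (v$3) in
     vector
     [h$1 * (v$2 * (- v$1 / s) * A) + h$2 * (s * A) - h$3 * (v$2 * s * B),
      h$1 * (v$2 * (- v$1 / s) * B) + h$2 * (s * B) + h$3 * (v$2 * s * A),
      h$1 * v$2 + h$2 * v$1])"

lemma has_derivative_nth: "((\<lambda>v. v $ i) has_derivative (\<lambda>h. h $ i)) F"
  by (rule bounded_linear_imp_has_derivative) (rule bounded_linear_vec_nth)

lemma spherical_has_derivative:
  assumes "\<bar>v$1\<bar> < 1"
  shows "(spherical p q has_derivative spherical_deriv p q v) (at v)"
proof -
  have pos: "0 < 1 - (v$1)\<^sup>2" using assms by (simp add: abs_square_less_1)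
  define s where "s = sqrt (1 - (v$1)\<^sup>2)"
  have "((\<lambda>t. sqrt (1 - t\<^sup>2)) has_real_derivative - v$1 / s) (at (v$1))"
    using pos by (auto intro!: derivative_eq_intros simp: s_def field_simps)
  from DERIV_compose_FDERIV[OF this has_derivative_nth]
  have ds: "((\<lambda>v. sqrt (1 - (v$1)\<^sup>2)) has_derivative (\<lambda>h. h$1 * (- v$1 / s))) (at v)" .
  have dc: "((\<lambda>v. cos (v$3)) has_derivative (\<lambda>h. h$3 * - sin (v$3))) (at v)"
    by (rule DERIV_compose_FDERIV[OF DERIV_cos has_derivative_nth])
  have dn: "((\<lambda>v. sin (v$3)) has_derivative (\<lambda>h. h$3 * cos (v$3))) (at v)"
    by (rule DERIV_compose_FDERIV[OF DERIV_sin has_derivative_nth])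
  note drs = has_derivative_mult[OF has_derivative_nth[of 2 "at v"] ds]
  note dA = has_derivative_diff[OF has_derivative_mult_right[OF dc, of p] has_derivative_mult_right[OF dn, of q]]
  note dB = has_derivative_add[OF has_derivative_mult_right[OF dc, of q] has_derivative_mult_right[OF dn, of p]]
  note dz = has_derivative_mult[OF has_derivative_nth[of 2 "at v"] has_derivative_nth[of 1 "at v"]]
  show ?thesis
    unfolding spherical_def[abs_def] spherical_deriv_def[abs_def] Let_def vector3_axis s_def[symmetric]
    by (rule has_derivative_eq_rhs[OF has_derivative_add[OF has_derivative_add[OF
            has_derivative_scaleR_left[OF has_derivative_mult[OF drs dA]]
            has_derivative_scaleR_left[OF has_derivative_mult[OF drs dB]]]
            has_derivative_scaleR_left[OF dz]]])
       (simp add: fun_eq_iff vec_eq_iff forall_3 axis_def algebra_simps flip: s_def)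
qed

text \<open>With \<zeta> as coordinate in place of the polar angle, the factors \<open>s\<close> and
  \<open>1 / s\<close> compensate each other, and \<open>(A, B)\<close> is a unit vector. What
  remains is exactly the weight \<open>r'\<^sup>2\<close> of the integral equation.\<close>

lemma det_spherical_deriv:
  assumes "\<bar>v$1\<bar> < 1" "p\<^sup>2 + q\<^sup>2 = 1"
  shows "det (matrix (spherical_deriv p q v)) = (v$2)\<^sup>2"
proof -
  define s A B where "s = sqrt (1 - (v$1)\<^sup>2)" and "A = p * cos (v$3) - q * sin (v$3)" and "B = q * cos (v$3) + p * sin (v$3)"
  have pos: "0 < 1 - (v$1)\<^sup>2" using assms by (simp add: abs_square_less_1)
  then have s: "s > 0" "s^2 = 1 - (v$1)\<^sup>2" by (simp_all add: s_def)
  have AB: "A^2 + B^2 = 1" unfolding A_def B_def using assms(2) sin_cos_squared_add[of "v$3"] by algebra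
  define t where "t = - v$1 / s"
  have t: "t * s = - v$1" using s by (simp add: t_def)
  have "det (matrix (spherical_deriv p q v)) =
     v$2 * (s * A * (v$2 * s * A) + v$2 * s * B * (s * B)) - v$1 * (v$2 * t * A * (v$2 * s * A) + v$2 * s * B * (v$2 * t * B))"
    unfolding det_3 matrix_def spherical_deriv_def Let_def s_def[symmetric] A_def[symmetric] B_def[symmetric] t_def[symmetric]
    by (simp add: axis_def algebra_simps)
  also have "\<dots> = (v$2)\<^sup>2 * (A^2 + B^2) * (s^2 - v$1 * (t * s))" by (simp add: power2_eq_square algebra_simps)
  also have "\<dots> = (v$2)\<^sup>2" unfolding AB t s(2) by (simp add: power2_eq_square)
  finally show ?thesis .
qed

lemma norm_vector3: "norm (x :: real^3) ^ 2 = (x$1)\<^sup>2 + (x$2)\<^sup>2 + (x$3)\<^sup>2"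
  unfolding power2_norm_eq_inner inner_vec_def by (simp add: sum_3 power2_eq_square)

lemma norm_spherical:
  assumes "\<bar>v$1\<bar> \<le> 1" "p\<^sup>2 + q\<^sup>2 = 1"
  shows "norm (spherical p q v) = \<bar>v$2\<bar>"
proof -
  have s: "(sqrt (1 - (v$1)\<^sup>2))\<^sup>2 = 1 - (v$1)\<^sup>2" using assms by (simp add: abs_square_le_1)
  have "norm (spherical p q v) ^ 2 = (v$2)\<^sup>2"
    unfolding norm_vector3 spherical_def vector_3
  proof -
    define A B where "A = p * cos (v$3) - q * sin (v$3)" and "B = q * cos (v$3) + p * sin (v$3)"
    have AB: "A^2 + B^2 = 1" unfolding A_def B_def using assms(2) sin_cos_squared_add[of "v$3"] by algebra
    have "(v$2 * sqrt (1 - (v$1)\<^sup>2) * A)\<^sup>2 + (v$2 * sqrt (1 - (v$1)\<^sup>2) * B)\<^sup>2 + (v$2 * v$1)\<^sup>2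
      = (v$2)\<^sup>2 * (sqrt (1 - (v$1)\<^sup>2))\<^sup>2 * (A^2 + B^2) + (v$2)\<^sup>2 * (v$1)\<^sup>2"
      by (simp add: power_mult_distrib algebra_simps)
    also have "\<dots> = (v$2)\<^sup>2" unfolding AB s by (simp add: algebra_simps)
    finally show "(v$2 * sqrt (1 - (v$1)\<^sup>2) * (p * cos (v$3) - q * sin (v$3)))\<^sup>2 +
      (v$2 * sqrt (1 - (v$1)\<^sup>2) * (q * cos (v$3) + p * sin (v$3)))\<^sup>2 + (v$2 * v$1)\<^sup>2 = (v$2)\<^sup>2"
      unfolding A_def B_def .
  qed
  from arg_cong[OF this, of sqrt] show ?thesis by simp
qed

lemma cos_sin_eq_imp_eq:
  assumes "cos a = cos b" "sin a = sin b" "a \<in> {0<..<2*pi}" "b \<in> {0<..<2*pi}"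
  shows "a = b"
proof -
  obtain n :: int where n: "a = b + 2 * pi * n" using assms(1,2) sin_cos_eq_iff[of a b] by auto
  have "\<bar>2 * pi * real_of_int n\<bar> < 2 * pi" using n assms(3,4) by auto
  then have "\<bar>real_of_int n\<bar> < 1" by (simp add: abs_mult)
  then have "n = 0" by linarith
  then show ?thesis using n by simp
qed

text \<open>The open box avoids the origin, the poles and the half-plane of azimuth 0, where the
  coordinates degenerate. The norm recovers the radius, then the third component recovers \<zeta>,
  and the horizontal components recover the azimuth.\<close>

lemma inj_on_spherical:
  assumes pq: "p\<^sup>2 + q\<^sup>2 = 1"
  shows "inj_on (spherical p q) (box (vector [-1, 0, 0]) (vector [1, R, 2 * pi]))"
proof (rule inj_onI)
  fix v w assume "v \<in> box (vector [-1, 0, 0]) (vector [1, R, 2 * pi])" "w \<in> box (vector [-1, 0, 0]) (vector [1, R, 2 * pi])"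
    and eq: "spherical p q v = spherical p q w"
  then have v: "\<bar>v$1\<bar> < 1" "v$2 > 0" "v$3 \<in> {0<..<2*pi}" and w: "\<bar>w$1\<bar> < 1" "w$2 > 0" "w$3 \<in> {0<..<2*pi}"
    by (auto simp: mem_box_cart forall_3)
  have 2: "v$2 = w$2" using norm_spherical[of v p q] norm_spherical[of w p q] eq v w pq by simp
  have 1: "v$1 = w$1" using arg_cong[OF eq, of "\<lambda>u. u$3"] 2 v by (simp add: spherical_def)
  have s: "v$2 * sqrt (1 - (v$1)\<^sup>2) \<noteq> 0" using v by (auto simp: abs_square_eq_1)
  have A: "p * cos (v$3) - q * sin (v$3) = p * cos (w$3) - q * sin (w$3)"
    using arg_cong[OF eq, of "\<lambda>u. u$1"] 1 2 s by (simp add: spherical_def)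
  have B: "q * cos (v$3) + p * sin (v$3) = q * cos (w$3) + p * sin (w$3)"
    using arg_cong[OF eq, of "\<lambda>u. u$2"] 1 2 s by (simp add: spherical_def)
  have "cos (v$3) = cos (w$3)" "sin (v$3) = sin (w$3)" using A B pq by algebra+
  then have "v$3 = w$3" by (rule cos_sin_eq_imp_eq[OF _ _ v(3) w(3)])
  with 1 2 show "v = w" by (simp add: vec_eq_iff forall_3)
qed

text \<open>Inside the open ball the chart misses only the half-plane of azimuth 0. Removing the
  whole plane that contains it is simpler and still costs only a null set.\<close>

lemma spherical_image_supset:
  assumes pq: "p\<^sup>2 + q\<^sup>2 = 1"
  shows "cball 0 R - sphere 0 R - {y. vector [- q, p, 0] \<bullet> y = 0}
    \<subseteq> spherical p q ` box (vector [-1, 0, 0]) (vector [1, R, 2 * pi])"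
proof
  fix y :: "real^3" assume "y \<in> cball 0 R - sphere 0 R - {y. vector [- q, p, 0] \<bullet> y = 0}"
  then have y: "norm y < R" and ne: "p * y$2 - q * y$1 \<noteq> 0"
    by (simp_all add: inner_vec_def sum_3)
  define r where "r = norm y"
  \<comment> \<open>These are the components of the horizontal part of \<open>y\<close> along
    \<open>(p, q)\<close> and along the perpendicular \<open>(- q, p)\<close>;
    \<open>d \<noteq> 0\<close> says that \<open>y\<close> is off the removed plane.\<close>
  define c d where "c = p * y$1 + q * y$2" and "d = p * y$2 - q * y$1"
  have d: "d \<noteq> 0" using ne by (simp add: d_def)
  have cd: "c^2 + d^2 = (y$1)\<^sup>2 + (y$2)\<^sup>2" unfolding c_def d_def using pq by algebra
  define a where "a = sqrt (c^2 + d^2)"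
  have a: "a > 0" "a^2 = c^2 + d^2" using d by (auto simp: a_def sum_power2_gt_zero_iff)
  have r2: "r^2 = a^2 + (y$3)\<^sup>2" unfolding r_def norm_vector3 a(2) cd by simp
  have apos: "a^2 > 0" using a(1) by simp
  then have "r^2 > 0" using r2 zero_le_power2[of "y$3"] by linarith
  then have r: "r > 0" by (simp add: r_def)
  obtain \<beta> where \<beta>: "0 \<le> \<beta>" "\<beta> < 2 * pi" "c / a = cos \<beta>" "d / a = sin \<beta>"
  proof (rule sincos_total_2pi)
    show "(c / a)\<^sup>2 + (d / a)\<^sup>2 = 1" using a d by (simp add: power_divide sum_power2_eq_zero_iff flip: add_divide_distrib)
  qed
  have \<beta>0: "\<beta> \<noteq> 0" using \<beta>(4) d a by auto
  have "(y$3)\<^sup>2 < r^2" using r2 apos by linarith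
  then have z: "\<bar>y$3\<bar> < r" using r by (metis abs_of_pos power2_less_imp_less power2_abs abs_ge_zero less_imp_le)
  have "r\<^sup>2 * (1 - (y$3 / r)\<^sup>2) = a\<^sup>2" using r r2 by (simp add: power_divide right_diff_distrib)
  then have "sqrt (r\<^sup>2 * (1 - (y$3 / r)\<^sup>2)) = a" using a(1) by simp
  then have s: "r * sqrt (1 - (y$3 / r)\<^sup>2) = a" using r by (simp add: real_sqrt_mult)
  have "spherical p q (vector [y$3 / r, r, \<beta>]) = y"
  proof -
    have "a * (p * cos \<beta> - q * sin \<beta>) = p * c - q * d" "a * (q * cos \<beta> + p * sin \<beta>) = q * c + p * d"
    proof -
      have "a * cos \<beta> = c" "a * sin \<beta> = d" using a(1) by (simp_all flip: \<beta>(3,4))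
      then show "a * (p * cos \<beta> - q * sin \<beta>) = p * c - q * d" "a * (q * cos \<beta> + p * sin \<beta>) = q * c + p * d"
        by (auto simp: algebra_simps)
    qed
    moreover have "p * c - q * d = y$1" "q * c + p * d = y$2" unfolding c_def d_def using pq by algebra+
    ultimately show ?thesis using r by (simp add: spherical_def s vec_eq_iff forall_3)
  qed
  moreover have "(vector [y$3 / r, r, \<beta>] :: real^3) \<in> box (vector [-1, 0, 0]) (vector [1, R, 2 * pi])"
    unfolding mem_box_cart forall_3 vector_3
    using z r y \<beta> \<beta>0 by (auto simp: r_def abs_less_iff field_simps)
  ultimately show "y \<in> spherical p q ` box (vector [-1, 0, 0]) (vector [1, R, 2 * pi])"
    by (metis imageI)
qed

lemma continuous_spherical: "continuous_on UNIV (spherical p q)"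
  unfolding spherical_def[abs_def] vector3_axis by (intro continuous_intros)

lemma borel_measurable_spherical [measurable]: "spherical p q \<in> borel_measurable borel"
  by (rule borel_measurable_continuous_onI[OF continuous_spherical])

section \<open>Change of variables and the azimuthal kernel\<close>

lemma set_lebesgue_integral_open_segment:
  fixes f :: "real \<Rightarrow> real"
  shows "(LINT x:{a..b}|lborel. f x) = (LINT x|lborel. indicator {a<..<b} x * f x)"
  unfolding set_lebesgue_integral_def
  by (rule integral_discrete_difference[of "{a, b}"]) (auto simp: indicator_def)

lemma spherical_integral:
  fixes f :: "real^3 \<Rightarrow> real"
  assumes int: "integrable lborel f" and supp: "\<And>y. norm y > R \<Longrightarrow> f y = 0" and pq: "p\<^sup>2 + q\<^sup>2 = 1"
  shows "(LINT \<zeta>:{-1..1}|lborel. LINT r:{0..R}|lborel. LINT \<beta>:{0..2*pi}|lborel.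
            r\<^sup>2 * f (spherical p q (vector [\<zeta>, r, \<beta>]))) = (LINT y|lborel. f y)"
proof -
  define S :: "(real^3) set" where "S = box (vector [-1, 0, 0]) (vector [1, R, 2 * pi])"
  let ?g = "spherical p q"
  \<comment> \<open>The change of variables is applied to vector-valued functions, hence the detour
    through \<open>real^1\<close>.\<close>
  let ?f = "\<lambda>y. vec (f y) :: real^1"
  define F where "F v = (v$2)\<^sup>2 * f (?g v)" for v :: "real^3"
  have S: "S \<in> sets lebesgue" "S \<in> sets borel" unfolding S_def by auto
  have S1: "\<bar>v$1\<bar> < 1" if "v \<in> S" for v using that by (auto simp: S_def mem_box_cart forall_3)
  have f[measurable]: "f \<in> borel_measurable borel" using int by auto
  have fL: "f absolutely_integrable_on UNIV"
    using int by (simp add: set_integrable_def integrable_completion)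
  \<comment> \<open>The image of the box misses only a null set of the ball, and \<open>f\<close>
    vanishes outside the ball.\<close>
  have neg: "negligible {y \<in> UNIV - ?g ` S. f y \<noteq> 0}"
  proof (rule negligible_subset)
    have "p \<noteq> 0 \<or> q \<noteq> 0" using pq by auto
    then have "vector [- q, p, 0] \<noteq> (0 :: real^3)" by (auto simp: vec_eq_iff forall_3)
    then show "negligible (sphere 0 R \<union> {y :: real^3. vector [- q, p, 0] \<bullet> y = 0})"
      by (intro negligible_Un negligible_sphere negligible_hyperplane) auto
    show "{y \<in> UNIV - ?g ` S. f y \<noteq> 0} \<subseteq> sphere 0 R \<union> {y. vector [- q, p, 0] \<bullet> y = 0}"
      using spherical_image_supset[OF pq, of R] supp unfolding S_def by (force simp: not_less)
  qed
  have fS: "f absolutely_integrable_on ?g ` S"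
    using fL by (subst absolutely_integrable_spike_set_eq[where T=UNIV]) (use neg in auto)
  then have vfS: "?f absolutely_integrable_on ?g ` S" by (simp add: absolutely_integrable_on_1_iff)
  have der: "(?g has_derivative spherical_deriv p q v) (at v within S)" if "v \<in> S" for v
    using spherical_has_derivative[OF S1[OF that]] by (rule has_derivative_at_withinI)
  have inj: "inj_on ?g S" unfolding S_def by (rule inj_on_spherical[OF pq])
  have cv: "(\<lambda>v. \<bar>det (matrix (spherical_deriv p q v))\<bar> *\<^sub>R ?f (?g v)) absolutely_integrable_on S \<and>
      integral S (\<lambda>v. \<bar>det (matrix (spherical_deriv p q v))\<bar> *\<^sub>R ?f (?g v)) = integral (?g ` S) ?f"
    using has_absolute_integral_change_of_variables[OF S(1) der inj, of ?f "integral (?g ` S) ?f"] vfS by blast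
  have eq: "(\<bar>det (matrix (spherical_deriv p q v))\<bar> *\<^sub>R ?f (?g v)) $ 1 = F v" if "v \<in> S" for v
    using det_spherical_deriv[OF S1[OF that] pq] by (simp add: F_def)
  have "(\<lambda>v. (\<bar>det (matrix (spherical_deriv p q v))\<bar> *\<^sub>R ?f (?g v)) $ 1) absolutely_integrable_on S"
    using cv unfolding absolutely_integrable_on_1_iff by blast
  then have FS: "F absolutely_integrable_on S"
  proof (rule absolutely_integrable_spike[where S="{}"])
    show "F v = (\<bar>det (matrix (spherical_deriv p q v))\<bar> *\<^sub>R ?f (?g v)) $ 1" if "v \<in> S - {}" for v
      using eq[of v] that by (simp only: Diff_empty)
  qed simp
  have "integral S F = integral S (\<lambda>v. (\<bar>det (matrix (spherical_deriv p q v))\<bar> *\<^sub>R ?f (?g v)) $ 1)"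
    by (rule integral_cong) (simp only: eq)
  also have "\<dots> = integral (?g ` S) (\<lambda>y. ?f y $ 1)"
    using conjunct2[OF cv] unfolding integral_on_1_eq[of S] integral_on_1_eq[of "?g ` S"] by (simp only: vec_eq_iff) simp
  also have "\<dots> = integral (?g ` S) f" by simp
  also have "\<dots> = integral UNIV f"
    by (rule integral_spike_set) (use neg in auto)
  also have "\<dots> = (LINT y|lborel. f y)" by (rule integral_lborel[OF int])
  finally have I1: "integral S F = (LINT y|lborel. f y)" .
  have [measurable]: "(\<lambda>v::real^3. v $ 2) \<in> borel_measurable borel"
    by (rule borel_measurable_continuous_onI) (intro continuous_intros)
  have Fm[measurable]: "F \<in> borel_measurable borel" unfolding F_def by measurable
  define h where "h v = indicator S v * F v" for v
  have hm[measurable]: "h \<in> borel_measurable borel" unfolding h_def using S(2) by measurable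
  have hL: "integrable lebesgue h" using FS unfolding set_integrable_def h_def by simp
  then have hint: "integrable lborel h" using hm by (simp add: integrable_completion)
  have "integral S F = (LINT v|lebesgue. h v)"
    using set_lebesgue_integral_eq_integral(2)[OF FS] by (simp add: set_lebesgue_integral_def h_def)
  also have "\<dots> = (LINT v|lborel. h v)" using hm by (simp add: integral_completion)
  also have "\<dots> = (LINT \<zeta>|lborel. LINT r|lborel. LINT \<beta>|lborel. h (vector [\<zeta>, r, \<beta>]))"
    by (rule integral_real3_iterated[OF hint])
  also have "\<dots> = (LINT \<zeta>:{-1..1}|lborel. LINT r:{0..R}|lborel. LINT \<beta>:{0..2*pi}|lborel.
            r\<^sup>2 * f (spherical p q (vector [\<zeta>, r, \<beta>])))"
  proof -
    have "h (vector [\<zeta>, r, \<beta>]) = indicator {-1<..<1} \<zeta> * (indicator {0<..<R} r *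
       (indicator {0<..<2*pi} \<beta> * (r\<^sup>2 * f (spherical p q (vector [\<zeta>, r, \<beta>])))))" for \<zeta> r \<beta>
      by (auto simp: h_def F_def S_def mem_box_cart forall_3 indicator_def)
    then show ?thesis by (simp only: set_lebesgue_integral_open_segment integral_mult_right_zero)
  qed
  finally show ?thesis using I1 by simp
qed

lemma spherical_nth3 [simp]: "spherical p q v $ 3 = v$2 * v$1"
  by (simp add: spherical_def)

text \<open>When the azimuth is measured from the horizontal direction of \<open>x\<close>, the law
  of cosines produces the integrand of \<open>kernel_K\<close> exactly, so the azimuthal integral is
  the kernel itself.\<close>

lemma kernel_K_integral:
  fixes P :: "real^3 \<Rightarrow> real"
  assumes P: "P \<in> borel_measurable borel" "\<And>y. \<bar>P y\<bar> \<le> M" "\<And>y. norm y > R \<Longrightarrow> P y = 0"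
    and \<rho>: "\<And>y. y \<noteq> 0 \<Longrightarrow> norm y \<le> R \<Longrightarrow> P y = \<rho> (norm y) (y$3 / norm y)"
  shows "(LINT \<zeta>':{-1..1}|lborel. LINT r':{0..R}|lborel.
      kernel_K (norm x) (x$3 / norm x) r' \<zeta>' * \<rho> r' \<zeta>' * r'\<^sup>2) = conv P newton x"
proof -
  define r \<zeta> a where "r = norm x" and "\<zeta> = x$3 / norm x" and "a = sqrt ((x$1)\<^sup>2 + (x$2)\<^sup>2)"
  have x3: "x$3 = r * \<zeta>" by (cases "x = 0") (simp_all add: r_def \<zeta>_def)
  have a2: "a\<^sup>2 = (x$1)\<^sup>2 + (x$2)\<^sup>2" by (simp add: a_def)
  have r2: "r\<^sup>2 = a\<^sup>2 + (x$3)\<^sup>2" unfolding a2 r_def norm_vector3 by simp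
  have a: "a = r * sqrt (1 - \<zeta>\<^sup>2)"
  proof -
    have "a\<^sup>2 = r\<^sup>2 * (1 - \<zeta>\<^sup>2)" using r2 x3 by (simp add: power_mult_distrib algebra_simps)
    then have "sqrt (a\<^sup>2) = sqrt (r\<^sup>2 * (1 - \<zeta>\<^sup>2))" by simp
    moreover have "a \<ge> 0" "r \<ge> 0" by (simp_all add: a_def r_def)
    ultimately show ?thesis by (simp add: real_sqrt_mult)
  qed
  \<comment> \<open>A point on the axis has no horizontal direction; there \<open>a = 0\<close> and
    any unit vector will do.\<close>
  obtain p q where pq: "p\<^sup>2 + q\<^sup>2 = 1" and x12: "x$1 = a * p" "x$2 = a * q"
  proof (cases "a = 0")
    case True
    then have "(x$1)\<^sup>2 + (x$2)\<^sup>2 = 0" using a2 by simp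
    then have "x$1 = 0" "x$2 = 0" by (simp_all add: sum_power2_eq_zero_iff)
    then show thesis using that[of 1 0] True by simp
  next
    case False
    have "(x$1 / a)\<^sup>2 + (x$2 / a)\<^sup>2 = ((x$1)\<^sup>2 + (x$2)\<^sup>2) / a\<^sup>2"
      by (simp add: power_divide add_divide_distrib)
    also have "\<dots> = 1" unfolding a2[symmetric] using False by simp
    finally have "(x$1 / a)\<^sup>2 + (x$2 / a)\<^sup>2 = 1" .
    then show thesis using that[of "x$1 / a" "x$2 / a"] False by simp
  qed
  define f where "f y = P y *\<^sub>R newton (x - y)" for y
  have int: "integrable lborel f"
    unfolding f_def by (rule conv_alt_integrable[OF locally_integrable_newton P])
  have supp: "f y = 0" if "norm y > R" for y using P(3)[OF that] by (simp add: f_def)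
  have dist: "norm (x - spherical p q (vector [\<zeta>', r', \<beta>]))
      = sqrt (r\<^sup>2 + r'\<^sup>2 - 2 * r * r' * (sqrt (1 - \<zeta>\<^sup>2) * sqrt (1 - \<zeta>'\<^sup>2) * cos \<beta> + \<zeta> * \<zeta>'))"
    if \<zeta>': "\<bar>\<zeta>'\<bar> \<le> 1" for \<zeta>' r' \<beta>
  proof -
    let ?y = "spherical p q (vector [\<zeta>', r', \<beta>])"
    have "x \<bullet> ?y = a * (r' * sqrt (1 - \<zeta>'\<^sup>2) * cos \<beta> * (p\<^sup>2 + q\<^sup>2)) + (r * \<zeta>) * (r' * \<zeta>')"
      unfolding inner_vec_def sum_3 spherical_def vector_3 x12 x3 inner_real_def by (simp add: power2_eq_square algebra_simps)
    then have "x \<bullet> ?y = r * r' * (sqrt (1 - \<zeta>\<^sup>2) * sqrt (1 - \<zeta>'\<^sup>2) * cos \<beta> + \<zeta> * \<zeta>')"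
      unfolding pq a by (simp add: algebra_simps)
    moreover have "(norm (x - ?y))\<^sup>2 = r\<^sup>2 + (norm ?y)\<^sup>2 - 2 * (x \<bullet> ?y)"
      unfolding r_def power2_norm_eq_inner by (simp add: inner_diff inner_commute)
    moreover have "(norm ?y)\<^sup>2 = r'\<^sup>2" using norm_spherical[of "vector [\<zeta>', r', \<beta>]" p q] \<zeta>' pq by simp
    ultimately have "(norm (x - ?y))\<^sup>2 = r\<^sup>2 + r'\<^sup>2 - 2 * r * r' * (sqrt (1 - \<zeta>\<^sup>2) * sqrt (1 - \<zeta>'\<^sup>2) * cos \<beta> + \<zeta> * \<zeta>')"
      by (simp only: mult.assoc)
    from arg_cong[OF this, of sqrt] show ?thesis by simp
  qed
  have inner: "(LINT \<beta>:{0..2*pi}|lborel. r'\<^sup>2 * f (spherical p q (vector [\<zeta>', r', \<beta>])))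
    = kernel_K r \<zeta> r' \<zeta>' * \<rho> r' \<zeta>' * r'\<^sup>2" if "\<zeta>' \<in> {-1..1}" "r' \<in> {0..R}" for \<zeta>' r'
  \<comment> \<open>At \<open>r' = 0\<close> the value of \<open>P\<close> at the origin is not tied
    to \<open>\<rho>\<close>, but both sides carry the factor \<open>r'\<^sup>2\<close>.\<close>
  proof (cases "r' = 0")
    case False
    then have r': "0 < r'" "r' \<le> R" and \<zeta>': "\<bar>\<zeta>'\<bar> \<le> 1" using that by auto
    have "r'\<^sup>2 * f (spherical p q (vector [\<zeta>', r', \<beta>])) = (\<rho> r' \<zeta>' * r'\<^sup>2) * (1 / sqrt (r\<^sup>2 + r'\<^sup>2
       - 2 * r * r' * (sqrt (1 - \<zeta>\<^sup>2) * sqrt (1 - \<zeta>'\<^sup>2) * cos \<beta> + \<zeta> * \<zeta>')))" for \<beta>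
    proof -
      let ?y = "spherical p q (vector [\<zeta>', r', \<beta>])"
      have n: "norm ?y = r'" using norm_spherical[of "vector [\<zeta>', r', \<beta>]" p q] \<zeta>' pq r' by simp
      have "P ?y = \<rho> r' \<zeta>'" using \<rho>[of ?y] n r' by (metis norm_zero less_irrefl spherical_nth3 vector_3(1) vector_3(2) nonzero_mult_div_cancel_left)
      then show ?thesis unfolding f_def newton_def dist[OF \<zeta>'] by simp
    qed
    then have "(LINT \<beta>:{0..2*pi}|lborel. r'\<^sup>2 * f (spherical p q (vector [\<zeta>', r', \<beta>])))
      = (\<rho> r' \<zeta>' * r'\<^sup>2) * kernel_K r \<zeta> r' \<zeta>'"
      unfolding kernel_K_def by (simp only: set_integral_mult_right)
    then show ?thesis by (simp only: mult_ac)
  qed (simp add: set_lebesgue_integral_def)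
  have "(LINT \<zeta>':{-1..1}|lborel. LINT r':{0..R}|lborel. kernel_K r \<zeta> r' \<zeta>' * \<rho> r' \<zeta>' * r'\<^sup>2)
     = (LINT \<zeta>':{-1..1}|lborel. LINT r':{0..R}|lborel. LINT \<beta>:{0..2*pi}|lborel. r'\<^sup>2 * f (spherical p q (vector [\<zeta>', r', \<beta>])))"
    by (intro set_lebesgue_integral_cong allI impI inner[symmetric]) auto
  also have "\<dots> = (LINT y|lborel. f y)"
    by (rule spherical_integral[OF int supp pq])
  also have "\<dots> = conv P newton x"
    unfolding f_def by (rule conv_alt[symmetric]) (use P in simp_all)
  finally show ?thesis unfolding r_def \<zeta>_def .
qed

section \<open>Level sets\<close>

text \<open>The operator \<open>n a\<^sup>T\<close>, packaged as a bounded linear map because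
  \<open>C1_map_on\<close> and the inverse function theorem ask for a derivative that is continuous
  in operator norm.\<close>

definition rank_one :: "'a::euclidean_space \<Rightarrow> 'a \<Rightarrow> 'a \<Rightarrow>\<^sub>L 'a" where
  "rank_one n a = blinfun_scaleR_left n o\<^sub>L blinfun_inner_right a"

lemma rank_one_apply [simp]: "rank_one n a v = (a \<bullet> v) *\<^sub>R n"
  by (simp add: rank_one_def)

lemma continuous_on_rank_one:
  "continuous_on S g \<Longrightarrow> continuous_on S (\<lambda>x. rank_one n (g x))"
  unfolding rank_one_def
  by (intro continuous_intros bounded_linear.continuous_on[OF bounded_linear_blinfun_inner_right])

text \<open>
  Sherman-Morrison: \<open>I + n (a - n)\<^sup>T\<close> has the inverse \<open>I + n (n - a)\<^sup>T / (a \<bullet> n)\<close> for a unit vector \<open>n\<close>.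
\<close>

lemma straightening_deriv_inverse:
  fixes a n :: "'a::euclidean_space"
  assumes n: "norm n = 1" and an: "a \<bullet> n \<noteq> 0"
  shows "(id_blinfun + rank_one n (a - n)) o\<^sub>L (id_blinfun + rank_one n ((1 / (a \<bullet> n)) *\<^sub>R (n - a))) = id_blinfun"
    and "(id_blinfun + rank_one n ((1 / (a \<bullet> n)) *\<^sub>R (n - a))) o\<^sub>L (id_blinfun + rank_one n (a - n)) = id_blinfun"
proof -
  have nn: "n \<bullet> n = 1" using n by (simp add: norm_eq_1)
  show "(id_blinfun + rank_one n (a - n)) o\<^sub>L (id_blinfun + rank_one n ((1 / (a \<bullet> n)) *\<^sub>R (n - a))) = id_blinfun"
  proof (rule blinfun_eqI)
    fix v
    have "(a - n) \<bullet> (v + ((1 / (a \<bullet> n)) *\<^sub>R (n - a) \<bullet> v) *\<^sub>R n) = - ((1 / (a \<bullet> n)) *\<^sub>R (n - a) \<bullet> v)"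
      using an by (simp add: inner_add_right inner_diff_left inner_diff_right nn field_simps)
    then show "((id_blinfun + rank_one n (a - n)) o\<^sub>L (id_blinfun + rank_one n ((1 / (a \<bullet> n)) *\<^sub>R (n - a)))) v = id_blinfun v"
      by (simp add: blinfun.add_left)
  qed
  show "(id_blinfun + rank_one n ((1 / (a \<bullet> n)) *\<^sub>R (n - a))) o\<^sub>L (id_blinfun + rank_one n (a - n)) = id_blinfun"
  proof (rule blinfun_eqI)
    fix v
    have "(1 / (a \<bullet> n)) *\<^sub>R (n - a) \<bullet> (v + ((a - n) \<bullet> v) *\<^sub>R n) = - ((a - n) \<bullet> v)"
      using an by (simp add: inner_add_right inner_diff_left inner_diff_right nn field_simps)
    then show "((id_blinfun + rank_one n ((1 / (a \<bullet> n)) *\<^sub>R (n - a))) o\<^sub>L (id_blinfun + rank_one n (a - n))) v = id_blinfun v"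
      by (simp add: blinfun.add_left)
  qed
qed

text \<open>The map \<open>\<phi>\<close> replaces the component of \<open>x\<close> along
  \<open>n\<close> by \<open>F x\<close>, so it flattens all level sets at once. Its derivative is
  invertible wherever \<open>G x \<bullet> n \<noteq> 0\<close>, and the inverse function theorem
  applies at \<open>p\<close>. The last conclusion, on vectors fixed by \<open>\<psi>'\<close>,
  serves to build curves with prescribed velocity.\<close>

lemma level_set_chart:
  fixes F :: "'a::euclidean_space \<Rightarrow> real" and G :: "'a \<Rightarrow> 'a"
  assumes W: "open W" "p \<in> W"
    and der: "\<And>x. x \<in> W \<Longrightarrow> (F has_derivative (\<lambda>h. G x \<bullet> h)) (at x)"
    and cont: "continuous_on W G" and n: "norm n = 1" "G p \<bullet> n \<noteq> 0"
  obtains U V \<phi> \<psi> \<psi>' where "open U" "p \<in> U" "U \<subseteq> W" "open V" "homeomorphism U V \<phi> \<psi>"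
    "C1_map_on U \<phi>" "C1_map_on V \<psi>" "\<And>x. \<phi> x \<bullet> n = F x"
    "(\<psi> has_derivative \<psi>') (at (\<phi> p))" "\<And>v. n \<bullet> v = 0 \<Longrightarrow> G p \<bullet> v = 0 \<Longrightarrow> \<psi>' v = v"
proof -
  have nn: "n \<bullet> n = 1" using n(1) by (simp add: norm_eq_1)
  define \<phi> where "\<phi> x = x + (F x - x \<bullet> n) *\<^sub>R n" for x
  define \<phi>' where "\<phi>' x = id_blinfun + rank_one n (G x - n)" for x
  define inv' where "inv' a = id_blinfun + rank_one n ((1 / (a \<bullet> n)) *\<^sub>R (n - a))" for a
  have der\<phi>: "(\<phi> has_derivative blinfun_apply (\<phi>' x)) (at x)" if "x \<in> W" for x
    unfolding \<phi>_def[abs_def] \<phi>'_def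
    by (rule has_derivative_eq_rhs, (rule derivative_intros der that)+)
       (auto simp: fun_eq_iff blinfun.add_left inner_diff_left inner_diff_right inner_commute)
  have cont\<phi>': "continuous_on W \<phi>'"
    unfolding \<phi>'_def[abs_def] by (intro continuous_intros continuous_on_rank_one cont)
  have inv: "inv' (G p) o\<^sub>L \<phi>' p = id_blinfun"
    unfolding inv'_def \<phi>'_def by (rule straightening_deriv_inverse(2)[OF n])
  obtain U V \<psi> \<psi>' where UV: "open U" "U \<subseteq> W" "p \<in> U" "open V" "\<phi> p \<in> V" "homeomorphism U V \<phi> \<psi>"
    and der\<psi>: "\<And>y. y \<in> V \<Longrightarrow> (\<psi> has_derivative \<psi>' y) (at y)"
    and \<psi>': "\<And>y. y \<in> V \<Longrightarrow> \<psi>' y = Hilbert_Choice.inv (blinfun_apply (\<phi>' (\<psi> y)))"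
    and bij: "\<And>y. y \<in> V \<Longrightarrow> bij (blinfun_apply (\<phi>' (\<psi> y)))"
    using inverse_function_theorem[OF W(1) der\<phi> cont\<phi>' W(2) inv] by blast
  have \<psi>V: "\<psi> y \<in> U" if "y \<in> V" for y using UV(6) that unfolding homeomorphism_def by blast
  \<comment> \<open>The inverse function theorem makes the derivative bijective at every point
    \<open>\<psi> y\<close>; this forces transversality to \<open>n\<close> there, not only at
    \<open>p\<close>.\<close>
  have ne: "G (\<psi> y) \<bullet> n \<noteq> 0" if y: "y \<in> V" for y
  proof
    assume "G (\<psi> y) \<bullet> n = 0"
    then have "\<phi>' (\<psi> y) n = \<phi>' (\<psi> y) 0"
      by (simp add: \<phi>'_def blinfun.add_left inner_diff_left nn)
    then have "n = 0" by (rule injD[OF bij_is_inj[OF bij[OF y]]])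
    then show False using n(1) by simp
  qed
  have \<psi>'_eq: "\<psi>' y = blinfun_apply (inv' (G (\<psi> y)))" if y: "y \<in> V" for y
  proof -
    have "\<phi>' (\<psi> y) o\<^sub>L inv' (G (\<psi> y)) = id_blinfun" "inv' (G (\<psi> y)) o\<^sub>L \<phi>' (\<psi> y) = id_blinfun"
      unfolding inv'_def \<phi>'_def by (rule straightening_deriv_inverse[OF n(1) ne[OF y]])+
    then have "blinfun_apply (\<phi>' (\<psi> y)) \<circ> blinfun_apply (inv' (G (\<psi> y))) = id"
      "blinfun_apply (inv' (G (\<psi> y))) \<circ> blinfun_apply (\<phi>' (\<psi> y)) = id"
      by (auto simp: fun_eq_iff simp flip: blinfun_apply_blinfun_compose)
    then show ?thesis unfolding \<psi>'[OF y] by (rule inv_unique_comp)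
  qed
  have cont\<psi>: "continuous_on V \<psi>" using UV(6) by (simp add: homeomorphism_def)
  have contG\<psi>: "continuous_on V (\<lambda>y. G (\<psi> y))"
    by (rule continuous_on_compose2[OF cont cont\<psi>]) (use \<psi>V UV(2) in auto)
  have "C1_map_on U \<phi>"
    unfolding C1_map_on_def using der\<phi> cont\<phi>' UV(2) by (meson continuous_on_subset subsetD)
  moreover have "C1_map_on V \<psi>"
    unfolding C1_map_on_def
  proof (intro exI conjI ballI)
    show "(\<psi> has_derivative blinfun_apply (inv' (G (\<psi> y)))) (at y)" if "y \<in> V" for y
      using der\<psi>[OF that] by (simp add: \<psi>'_eq[OF that])
    show "continuous_on V (\<lambda>y. inv' (G (\<psi> y)))"
      unfolding inv'_def by (intro continuous_intros continuous_on_rank_one contG\<psi>) (use ne in auto)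
  qed
  moreover have "\<phi> x \<bullet> n = F x" for x by (simp add: \<phi>_def inner_add_left nn)
  moreover have "\<psi>' (\<phi> p) v = v" if "n \<bullet> v = 0" "G p \<bullet> v = 0" for v
  proof -
    have "\<psi> (\<phi> p) = p" using UV(3,6) by (simp add: homeomorphism_def)
    then show ?thesis using that by (simp add: \<psi>'_eq[OF UV(5)] inv'_def blinfun.add_left inner_diff_left)
  qed
  ultimately show thesis using that[OF UV(1,3,2,4,6) _ _ _ der\<psi>[OF UV(5)]] by blast
qed

text \<open>In the chart whose \<open>n\<close> is the normalized gradient at the given point, the
  level set becomes the hyperplane orthogonal to \<open>n\<close>.\<close>

lemma C1_submanifold_level_set:
  fixes M :: "'a::euclidean_space set"
  assumes W: "open W" "M \<subseteq> W" and M: "M = {x \<in> W. F x = 0}"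
    and der: "\<And>x. x \<in> W \<Longrightarrow> (F has_derivative (\<lambda>h. G x \<bullet> h)) (at x)"
    and cont: "continuous_on W G" and ne: "\<And>x. x \<in> M \<Longrightarrow> G x \<noteq> 0"
  shows "C1_submanifold (DIM('a) - 1) M"
  unfolding C1_submanifold_def
proof
  fix p assume p: "p \<in> M"
  define n where "n = (1 / norm (G p)) *\<^sub>R G p"
  have n: "norm n = 1" "G p \<bullet> n \<noteq> 0" using ne[OF p] by (simp_all add: n_def)
  obtain U V \<phi> \<psi> where UV: "open U" "p \<in> U" "U \<subseteq> W" "open V" "homeomorphism U V \<phi> \<psi>"
    "C1_map_on U \<phi>" "C1_map_on V \<psi>" "\<And>x. \<phi> x \<bullet> n = F x"
    using level_set_chart[OF W(1) _ der cont n] p W(2) by (metis subsetD)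
  have img: "\<phi> ` (U \<inter> M) = V \<inter> {v. n \<bullet> v = 0}"
  proof (intro equalityI subsetI)
    fix y assume "y \<in> \<phi> ` (U \<inter> M)"
    then show "y \<in> V \<inter> {v. n \<bullet> v = 0}"
      using UV(5,8) M by (auto simp: homeomorphism_def inner_commute)
  next
    fix y assume y: "y \<in> V \<inter> {v. n \<bullet> v = 0}"
    then have "\<psi> y \<in> U" "\<phi> (\<psi> y) = y" using UV(5) by (auto simp: homeomorphism_def)
    moreover from this have "\<psi> y \<in> M"
      using y UV(3) UV(8)[of "\<psi> y"] by (auto simp: M inner_commute)
    ultimately show "y \<in> \<phi> ` (U \<inter> M)" by (metis IntI imageI)
  qed
  have "subspace {v. n \<bullet> v = 0}" by (rule subspace_hyperplane)
  moreover have "dim {v. n \<bullet> v = 0} = DIM('a) - 1" using n(1) by (intro dim_hyperplane) auto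
  ultimately show "\<exists>U V L \<phi> \<psi>. open U \<and> p \<in> U \<and> open V \<and> subspace (L :: 'a set) \<and> dim L = DIM('a) - 1 \<and>
        homeomorphism U V \<phi> \<psi> \<and> C1_map_on U \<phi> \<and> C1_map_on V \<psi> \<and> \<phi> ` (U \<inter> M) = V \<inter> L"
    using UV img by blast
qed

text \<open>One direction is the chain rule for \<open>F \<circ> \<gamma>\<close>, which is zero
  near 0. For the other, the straight line through \<open>\<phi> p\<close> in direction
  \<open>v\<close> stays in the flattened level set, and its image under \<open>\<psi>\<close> is a
  curve with velocity \<open>v\<close>.\<close>

lemma level_set_tangent_vector:
  fixes F :: "'a::euclidean_space \<Rightarrow> real"
  assumes W: "open W" "p \<in> W" and M: "M \<inter> W = {x \<in> W. F x = 0}" and p: "p \<in> M"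
    and der: "\<And>x. x \<in> W \<Longrightarrow> (F has_derivative (\<lambda>h. G x \<bullet> h)) (at x)"
    and cont: "continuous_on W G" and ne: "G p \<noteq> 0"
  shows "tangent_vector M p v \<longleftrightarrow> G p \<bullet> v = 0"
proof
  assume "tangent_vector M p v"
  then obtain \<gamma> where \<gamma>: "\<gamma> 0 = p" "\<forall>\<^sub>F t in nhds (0::real). \<gamma> t \<in> M" "(\<gamma> has_vector_derivative v) (at 0)"
    unfolding tangent_vector_def by blast
  have "isCont \<gamma> 0" using \<gamma>(3) by (rule has_vector_derivative_continuous)
  then have "\<forall>\<^sub>F t in nhds 0. \<gamma> t \<in> W"
    using W \<gamma>(1) unfolding isCont_def tendsto_at_iff_tendsto_nhds by (auto intro: topological_tendstoD)
  then have ev: "\<forall>\<^sub>F t in nhds 0. F (\<gamma> t) = 0"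
    using \<gamma>(2) by eventually_elim (use M in blast)
  have "((F \<circ> \<gamma>) has_derivative ((\<lambda>h. G p \<bullet> h) \<circ> (\<lambda>t. t *\<^sub>R v))) (at 0)"
    using \<gamma>(3) der[OF W(2)] \<gamma>(1)
    by (intro diff_chain_at) (auto simp: has_vector_derivative_def)
  moreover have "((F \<circ> \<gamma>) has_derivative (\<lambda>t. 0)) (at 0)"
    by (rule has_derivative_transform_eventually[where f="\<lambda>_. 0"])
       (use ev in \<open>auto simp: eventually_nhds_conv_at elim: eventually_mono\<close>)
  ultimately have "(\<lambda>h. G p \<bullet> h) \<circ> (\<lambda>t. t *\<^sub>R v) = (\<lambda>t. 0)" by (rule has_derivative_unique)
  from fun_cong[OF this, of 1] show "G p \<bullet> v = 0" by simp
next
  assume v: "G p \<bullet> v = 0"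
  define n where "n = (1 / norm (G p)) *\<^sub>R G p"
  have n: "norm n = 1" "G p \<bullet> n \<noteq> 0" using ne by (simp_all add: n_def)
  have nv: "n \<bullet> v = 0" using v by (simp add: n_def)
  obtain U V \<phi> \<psi> \<psi>' where UV: "open U" "p \<in> U" "U \<subseteq> W" "open V" "homeomorphism U V \<phi> \<psi>"
    "\<And>x. \<phi> x \<bullet> n = F x"
    "(\<psi> has_derivative \<psi>') (at (\<phi> p))" "\<And>v. n \<bullet> v = 0 \<Longrightarrow> G p \<bullet> v = 0 \<Longrightarrow> \<psi>' v = v"
    using level_set_chart[OF W der cont n] by metis
  define \<gamma> where "\<gamma> t = \<psi> (\<phi> p + t *\<^sub>R v)" for t
  have \<phi>p: "\<phi> p \<in> V" "\<psi> (\<phi> p) = p" using UV(2,5) by (auto simp: homeomorphism_def)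
  have F0: "F p = 0" using p W M by blast
  have "((\<lambda>t. \<phi> p + t *\<^sub>R v) \<longlongrightarrow> \<phi> p + 0 *\<^sub>R v) (nhds 0)"
    by (intro tendsto_intros) (simp add: filterlim_ident)
  then have "\<forall>\<^sub>F t in nhds 0. \<phi> p + t *\<^sub>R v \<in> V"
    using UV(4) \<phi>p by (auto intro: topological_tendstoD)
  then have "\<forall>\<^sub>F t in nhds 0. \<gamma> t \<in> M"
  proof eventually_elim
    case (elim t)
    then have "\<gamma> t \<in> U" "\<phi> (\<gamma> t) = \<phi> p + t *\<^sub>R v"
      using UV(5) by (auto simp: homeomorphism_def \<gamma>_def)
    moreover from this have "F (\<gamma> t) = 0"
      using UV(6)[of "\<gamma> t"] UV(6)[of p] F0 nv by (simp add: inner_add_left inner_add_right inner_commute)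
    ultimately show ?case using UV(3) M by blast
  qed
  moreover have "(\<gamma> has_vector_derivative v) (at 0)"
  proof -
    have 1: "((\<lambda>t. \<phi> p + t *\<^sub>R v) has_derivative (\<lambda>t. t *\<^sub>R v)) (at 0)"
      by (auto intro!: derivative_eq_intros)
    have "((\<psi> \<circ> (\<lambda>t. \<phi> p + t *\<^sub>R v)) has_derivative (\<psi>' \<circ> (\<lambda>t. t *\<^sub>R v))) (at 0)"
      by (rule diff_chain_at[OF 1]) (use UV(7) in simp)
    moreover have "\<psi>' \<circ> (\<lambda>t. t *\<^sub>R v) = (\<lambda>t. t *\<^sub>R v)"
      using v nv by (auto simp: fun_eq_iff intro!: UV(8))
    ultimately show ?thesis by (simp add: has_vector_derivative_def \<gamma>_def[abs_def] o_def)
  qed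
  ultimately show "tangent_vector M p v"
    unfolding tangent_vector_def using \<phi>p(2) by (intro exI[of _ \<gamma>]) (simp add: \<gamma>_def)
qed

lemma has_real_derivative_along_line:
  fixes F :: "'a::real_inner \<Rightarrow> real"
  assumes "(F has_derivative (\<lambda>h. g \<bullet> h)) (at p)"
  shows "((\<lambda>t. F (p + t *\<^sub>R u)) has_real_derivative g \<bullet> u) (at 0)"
proof -
  have 1: "((\<lambda>t. p + t *\<^sub>R u) has_derivative (\<lambda>t. t *\<^sub>R u)) (at 0)"
    by (auto intro!: derivative_eq_intros)
  have "((F \<circ> (\<lambda>t. p + t *\<^sub>R u)) has_derivative ((\<lambda>h. g \<bullet> h) \<circ> (\<lambda>t. t *\<^sub>R u))) (at 0)"
    by (rule diff_chain_at[OF 1]) (use assms in simp)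
  then show ?thesis unfolding has_field_derivative_def o_def
    by (rule has_derivative_eq_rhs) (simp add: fun_eq_iff)
qed

text \<open>The tangency condition leaves only the two unit multiples of the gradient, and the
  one-sided condition selects the one along which \<open>F\<close> decreases.\<close>

lemma unit_outer_normal_superlevel:
  fixes F :: "'a::euclidean_space \<Rightarrow> real"
  assumes W: "open W" "p \<in> W" and M: "frontier D \<inter> W = {x \<in> W. F x = 0}" and p: "p \<in> frontier D"
    and D: "{x \<in> W. F x > 0} \<subseteq> interior D" "closure D \<inter> W \<subseteq> {x. F x \<ge> 0}"
    and der: "\<And>x. x \<in> W \<Longrightarrow> (F has_derivative (\<lambda>h. G x \<bullet> h)) (at x)"
    and cont: "continuous_on W G" and ne: "G p \<noteq> 0"
  shows "unit_outer_normal D p N \<longleftrightarrow> N = - (1 / norm (G p)) *\<^sub>R G p"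
proof -
  have tan: "tangent_vector (frontier D) p v \<longleftrightarrow> G p \<bullet> v = 0" for v
    by (rule level_set_tangent_vector[OF W M p der cont ne])
  define n where "n = - (1 / norm (G p)) *\<^sub>R G p"
  have n: "norm n = 1" "G p \<bullet> n = - norm (G p)"
    using ne by (simp_all add: n_def power2_eq_square flip: power2_norm_eq_inner)
  have F0: "F p = 0" using p W M by blast
  have lim: "((\<lambda>t. p + t *\<^sub>R u) \<longlongrightarrow> p + 0 *\<^sub>R u) (at_right 0)" for u :: 'a
    by (intro tendsto_intros)
  have inW: "\<forall>\<^sub>F t in at_right 0. p + t *\<^sub>R u \<in> W" for u
    using topological_tendstoD[OF lim W(1)] W(2) by simp
  have dd: "((\<lambda>t. F (p + t *\<^sub>R u)) has_real_derivative G p \<bullet> u) (at 0)" for u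
    by (rule has_real_derivative_along_line[OF der[OF W(2)]])
  have neg: "\<forall>\<^sub>F t in at_right 0. F (p + t *\<^sub>R u) < 0" if u: "G p \<bullet> u < 0" for u
  proof -
    obtain d where "d > 0" "\<And>h. 0 < h \<Longrightarrow> h < d \<Longrightarrow> F (p + (0 + h) *\<^sub>R u) < F (p + 0 *\<^sub>R u)"
      using DERIV_neg_dec_right[OF dd u] by blast
    then show ?thesis using F0 by (auto simp: eventually_at_right intro!: exI[of _ d])
  qed
  have pos: "\<forall>\<^sub>F t in at_right 0. F (p + t *\<^sub>R u) > 0" if u: "G p \<bullet> u > 0" for u
  proof -
    obtain d where "d > 0" "\<And>h. 0 < h \<Longrightarrow> h < d \<Longrightarrow> F (p + (0 + h) *\<^sub>R u) > F (p + 0 *\<^sub>R u)"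
      using DERIV_pos_inc_right[OF dd u] by blast
    then show ?thesis using F0 by (auto simp: eventually_at_right intro!: exI[of _ d])
  qed
  have un: "unit_outer_normal D p n"
    unfolding unit_outer_normal_def
  proof (intro conjI allI impI n)
    show "n \<bullet> v = 0" if "tangent_vector (frontier D) p v" for v
      using that tan by (simp add: n_def)
    have "G p \<bullet> n < 0" "G p \<bullet> (- n) > 0" using n ne by auto
    from neg[OF this(1)] pos[OF this(2)] inW[of n] inW[of "- n"]
    show "\<forall>\<^sub>F t in at_right 0. p + t *\<^sub>R n \<notin> closure D \<and> p - t *\<^sub>R n \<in> interior D"
    proof eventually_elim
      case (elim t) then show ?case using D by force
    qed
  qed
  show ?thesis unfolding n_def[symmetric]
  proof
    assume N: "unit_outer_normal D p N"
    \<comment> \<open>The part of \<open>N\<close> orthogonal to \<open>n\<close> is itself a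
      tangent vector, so \<open>N\<close> is orthogonal to it; hence it is orthogonal to
      itself.\<close>
    define w where "w = N - (N \<bullet> n) *\<^sub>R n"
    have "n \<bullet> w = 0" using n(1) by (simp add: w_def inner_diff_right norm_eq_1 inner_commute)
    then have "G p \<bullet> w = 0" using ne by (simp add: n_def)
    then have "N \<bullet> w = 0" using N tan unfolding unit_outer_normal_def by blast
    moreover have "N \<bullet> w = w \<bullet> w + (N \<bullet> n) * (n \<bullet> w)" using n(1) by (simp add: w_def inner_diff_left inner_diff_right inner_commute norm_eq_1)
    ultimately have "w = 0" using \<open>n \<bullet> w = 0\<close> by simp
    then have Nn: "N = (N \<bullet> n) *\<^sub>R n" by (simp add: w_def)
    have "norm N = 1" using N by (simp add: unit_outer_normal_def)
    then have "\<bar>N \<bullet> n\<bar> = 1" using Nn n(1) by (metis mult.right_neutral norm_scaleR)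
    then consider "N \<bullet> n = 1" | "N \<bullet> n = -1" by linarith
    then show "N = n"
    proof cases
      case 1 then show ?thesis using Nn by simp
    next
      case 2
      then have "N = - n" using Nn by simp
      \<comment> \<open>With the opposite sign the same points would lie outside the closure and in
        the interior.\<close>
      have "\<forall>\<^sub>F t in at_right 0. p + t *\<^sub>R N \<notin> closure D" "\<forall>\<^sub>F t in at_right 0. p - t *\<^sub>R n \<in> interior D"
        using N un unfolding unit_outer_normal_def by (auto elim: eventually_mono)
      then have "\<forall>\<^sub>F t in at_right (0::real). False"
      proof eventually_elim
        case (elim t)
        then show ?case using \<open>N = - n\<close> interior_subset[of D] closure_subset[of D] by auto
      qed
      then show ?thesis by simp
    qed
  qed (use un in simp)
qed

text \<open>An implicit function theorem in one variable. Strict monotonicity in the radius traps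
  \<open>X\<close> between radii at which \<open>F\<close> has opposite signs, which gives
  continuity; the mean value theorem in the radius then gives the derivative
  \<open>- fz / fr\<close>.\<close>

lemma implicit_radius_C1:
  fixes F :: "'a::euclidean_space \<Rightarrow> real" and G :: "'a \<Rightarrow> 'a" and e e' :: "real \<Rightarrow> 'a"
  assumes W: "open W" and der: "\<And>x. x \<in> W \<Longrightarrow> (F has_derivative (\<lambda>h. G x \<bullet> h)) (at x)"
    and cont: "continuous_on W G"
    and e: "open Z" "\<And>\<zeta>. \<zeta> \<in> Z \<Longrightarrow> (e has_vector_derivative e' \<zeta>) (at \<zeta>)" "continuous_on Z e'"
    and sub: "\<And>r \<zeta>. r \<in> {a..b} \<Longrightarrow> \<zeta> \<in> Z \<Longrightarrow> r *\<^sub>R e \<zeta> \<in> W"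
    and neg: "\<And>r \<zeta>. r \<in> {a..b} \<Longrightarrow> \<zeta> \<in> Z \<Longrightarrow> G (r *\<^sub>R e \<zeta>) \<bullet> e \<zeta> < 0"
    and X: "\<And>\<zeta>. \<zeta> \<in> Z \<Longrightarrow> X \<zeta> \<in> {a<..<b}" "\<And>\<zeta>. \<zeta> \<in> Z \<Longrightarrow> F (X \<zeta> *\<^sub>R e \<zeta>) = 0"
  shows "X C1_differentiable_on Z"
proof -
  define f where "f r \<zeta> = F (r *\<^sub>R e \<zeta>)" for r \<zeta>
  define fr where "fr r \<zeta> = G (r *\<^sub>R e \<zeta>) \<bullet> e \<zeta>" for r \<zeta>
  define fz where "fz r \<zeta> = G (r *\<^sub>R e \<zeta>) \<bullet> (r *\<^sub>R e' \<zeta>)" for r \<zeta>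
  have conte: "continuous_on Z e"
    using e(1,2) by (meson continuous_at_imp_continuous_on has_vector_derivative_continuous)
  have contS: "continuous_on ({a..b} \<times> Z) (\<lambda>s. e (snd s))" "continuous_on ({a..b} \<times> Z) (\<lambda>s. fst s *\<^sub>R e (snd s))"
    by (auto intro!: continuous_intros continuous_on_compose2[OF conte])
  have contfr: "continuous_on ({a..b} \<times> Z) (\<lambda>s. fr (fst s) (snd s))"
    unfolding fr_def
    by (intro continuous_intros contS continuous_on_compose2[OF cont contS(2)]) (use sub in auto)
  have fr: "((\<lambda>r. f r \<zeta>) has_real_derivative fr r \<zeta>) (at r)" if "r \<in> {a..b}" "\<zeta> \<in> Z" for r \<zeta>
  proof -
    have 1: "((\<lambda>r. r *\<^sub>R e \<zeta>) has_derivative (\<lambda>t. t *\<^sub>R e \<zeta>)) (at r)"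
      by (auto intro!: derivative_eq_intros)
    have "((F \<circ> (\<lambda>r. r *\<^sub>R e \<zeta>)) has_derivative ((\<lambda>h. G (r *\<^sub>R e \<zeta>) \<bullet> h) \<circ> (\<lambda>t. t *\<^sub>R e \<zeta>))) (at r)"
      by (rule diff_chain_at[OF 1]) (rule der[OF sub[OF that]])
    then show ?thesis unfolding has_field_derivative_def o_def f_def
      by (rule has_derivative_eq_rhs) (simp add: fun_eq_iff fr_def)
  qed
  have fz: "((\<lambda>\<zeta>. f r \<zeta>) has_real_derivative fz r \<zeta>) (at \<zeta>)" if "r \<in> {a..b}" "\<zeta> \<in> Z" for r \<zeta>
  proof -
    have 1: "((\<lambda>\<zeta>. r *\<^sub>R e \<zeta>) has_derivative (\<lambda>t. r *\<^sub>R (t *\<^sub>R e' \<zeta>))) (at \<zeta>)"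
      using e(2)[OF that(2)] unfolding has_vector_derivative_def by (rule has_derivative_scaleR_right)
    have "((F \<circ> (\<lambda>\<zeta>. r *\<^sub>R e \<zeta>)) has_derivative ((\<lambda>h. G (r *\<^sub>R e \<zeta>) \<bullet> h) \<circ> (\<lambda>t. r *\<^sub>R (t *\<^sub>R e' \<zeta>)))) (at \<zeta>)"
      by (rule diff_chain_at[OF 1]) (rule der[OF sub[OF that]])
    then show ?thesis unfolding has_field_derivative_def o_def f_def
      by (rule has_derivative_eq_rhs) (simp add: fun_eq_iff fz_def)
  qed
  have dec: "f s \<zeta> < f r \<zeta>" if "r \<in> {a..b}" "s \<in> {a..b}" "r < s" "\<zeta> \<in> Z" for r s \<zeta>
    using that(3)
  proof (rule DERIV_neg_imp_decreasing)
    fix t assume "r \<le> t" "t \<le> s"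
    then have "t \<in> {a..b}" using that by auto
    then show "\<exists>y. ((\<lambda>r. f r \<zeta>) has_real_derivative y) (at t) \<and> y < 0"
      using fr[OF _ that(4)] neg[OF _ that(4)] unfolding fr_def by blast
  qed
  have contX: "isCont X \<zeta>0" if \<zeta>0: "\<zeta>0 \<in> Z" for \<zeta>0
    unfolding isCont_def
  proof (rule order_tendstoI)
    have fcont: "(f r \<longlongrightarrow> f r \<zeta>0) (at \<zeta>0)" if "r \<in> {a..b}" for r
      using DERIV_isCont[OF fz[OF that \<zeta>0]] by (simp add: isCont_def)
    have evZ: "\<forall>\<^sub>F \<zeta> in at \<zeta>0. \<zeta> \<in> Z" using e(1) \<zeta>0 by (rule eventually_at_in_open')
    fix y assume y: "y < X \<zeta>0"
    \<comment> \<open>A radius strictly between \<open>y\<close> and \<open>X \<zeta>0\<close>; the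
      maximum keeps it in \<open>{a..b}\<close> when \<open>y\<close> lies far below
      \<open>a\<close>.\<close>
    define r where "r = max a ((y + X \<zeta>0) / 2)"
    have r: "r \<in> {a..b}" "r < X \<zeta>0" "y < r" using X(1)[OF \<zeta>0] y by (auto simp: r_def max_def)
    have "f (X \<zeta>0) \<zeta>0 < f r \<zeta>0" using X(1)[OF \<zeta>0] r \<zeta>0 by (intro dec) auto
    then have "0 < f r \<zeta>0" using X(2)[OF \<zeta>0] by (simp add: f_def)
    then have "\<forall>\<^sub>F \<zeta> in at \<zeta>0. 0 < f r \<zeta>" using fcont[OF r(1)] by (rule order_tendstoD(1)[rotated])
    then show "\<forall>\<^sub>F \<zeta> in at \<zeta>0. y < X \<zeta>"
      using evZ
    proof eventually_elim
      case (elim \<zeta>)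
      have "\<not> X \<zeta> \<le> r"
      proof
        assume "X \<zeta> \<le> r"
        then have "f r \<zeta> \<le> f (X \<zeta>) \<zeta>" using dec[of "X \<zeta>" r \<zeta>] X(1)[OF elim(2)] r(1) elim(2) by (cases "X \<zeta> = r") auto
        then show False using elim X(2)[OF elim(2)] by (simp add: f_def)
      qed
      then show ?case using r by simp
    qed
  next
    have fcont: "(f r \<longlongrightarrow> f r \<zeta>0) (at \<zeta>0)" if "r \<in> {a..b}" for r
      using DERIV_isCont[OF fz[OF that \<zeta>0]] by (simp add: isCont_def)
    have evZ: "\<forall>\<^sub>F \<zeta> in at \<zeta>0. \<zeta> \<in> Z" using e(1) \<zeta>0 by (rule eventually_at_in_open')
    fix y assume y: "X \<zeta>0 < y"
    define r where "r = min b ((y + X \<zeta>0) / 2)"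
    have r: "r \<in> {a..b}" "r > X \<zeta>0" "y > r" using X(1)[OF \<zeta>0] y by (auto simp: r_def min_def)
    have "f r \<zeta>0 < f (X \<zeta>0) \<zeta>0" using X(1)[OF \<zeta>0] r \<zeta>0 by (intro dec) auto
    then have "f r \<zeta>0 < 0" using X(2)[OF \<zeta>0] by (simp add: f_def)
    then have "\<forall>\<^sub>F \<zeta> in at \<zeta>0. f r \<zeta> < 0" using fcont[OF r(1)] by (rule order_tendstoD(2)[rotated])
    then show "\<forall>\<^sub>F \<zeta> in at \<zeta>0. X \<zeta> < y"
      using evZ
    proof eventually_elim
      case (elim \<zeta>)
      have "\<not> r \<le> X \<zeta>"
      proof
        assume "r \<le> X \<zeta>"
        then have "f (X \<zeta>) \<zeta> \<le> f r \<zeta>" using dec[of r "X \<zeta>" \<zeta>] X(1)[OF elim(2)] r(1) elim(2) by (cases "X \<zeta> = r") auto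
        then show False using elim X(2)[OF elim(2)] by (simp add: f_def)
      qed
      then show ?case using r by simp
    qed
  qed
  define D where "D \<zeta> = - fz (X \<zeta>) \<zeta> / fr (X \<zeta>) \<zeta>" for \<zeta>
  have Xin: "X \<zeta> \<in> {a..b}" if "\<zeta> \<in> Z" for \<zeta> using X(1)[OF that] by auto
  have derX: "(X has_real_derivative D \<zeta>0) (at \<zeta>0)" if \<zeta>0: "\<zeta>0 \<in> Z" for \<zeta>0
  proof -
    have evZ: "\<forall>\<^sub>F \<zeta> in at \<zeta>0. \<zeta> \<in> Z" using e(1) \<zeta>0 by (rule eventually_at_in_open')
    \<comment> \<open>The intermediate radius lies between \<open>X \<zeta>\<close> and
      \<open>X \<zeta>0\<close>, so it tends to \<open>X \<zeta>0\<close> by the continuity of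
      \<open>X\<close> just proved, and the joint continuity of \<open>fr\<close> gives the limit of
      the slopes.\<close>
    have "\<exists>t\<in>{a..b}. \<bar>t - X \<zeta>0\<bar> \<le> \<bar>X \<zeta> - X \<zeta>0\<bar> \<and> f (X \<zeta>) \<zeta> - f (X \<zeta>0) \<zeta> = (X \<zeta> - X \<zeta>0) * fr t \<zeta>"
      if \<zeta>: "\<zeta> \<in> Z" for \<zeta>
    proof (cases "X \<zeta>" "X \<zeta>0" rule: linorder_cases)
      case less
      have "\<exists>t>X \<zeta>. t < X \<zeta>0 \<and> f (X \<zeta>0) \<zeta> - f (X \<zeta>) \<zeta> = (X \<zeta>0 - X \<zeta>) * fr t \<zeta>"
        by (rule MVT2[OF less]) (use Xin[OF \<zeta>] Xin[OF \<zeta>0] \<zeta> in \<open>auto intro!: fr\<close>)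
      then obtain t where t: "X \<zeta> < t" "t < X \<zeta>0" "f (X \<zeta>0) \<zeta> - f (X \<zeta>) \<zeta> = (X \<zeta>0 - X \<zeta>) * fr t \<zeta>" by blast
      then show ?thesis using Xin[OF \<zeta>] Xin[OF \<zeta>0] by (intro bexI[of _ t]) (auto simp: algebra_simps)
    next
      case equal then show ?thesis using Xin[OF \<zeta>] by (intro bexI[of _ "X \<zeta>"]) auto
    next
      case greater
      have "\<exists>t>X \<zeta>0. t < X \<zeta> \<and> f (X \<zeta>) \<zeta> - f (X \<zeta>0) \<zeta> = (X \<zeta> - X \<zeta>0) * fr t \<zeta>"
        by (rule MVT2[OF greater]) (use Xin[OF \<zeta>] Xin[OF \<zeta>0] \<zeta> in \<open>auto intro!: fr\<close>)
      then obtain t where t: "X \<zeta>0 < t" "t < X \<zeta>" "f (X \<zeta>) \<zeta> - f (X \<zeta>0) \<zeta> = (X \<zeta> - X \<zeta>0) * fr t \<zeta>" by blast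
      then show ?thesis using Xin[OF \<zeta>] Xin[OF \<zeta>0] by (intro bexI[of _ t]) auto
    qed
    then obtain t where t: "\<And>\<zeta>. \<zeta> \<in> Z \<Longrightarrow> t \<zeta> \<in> {a..b}" "\<And>\<zeta>. \<zeta> \<in> Z \<Longrightarrow> \<bar>t \<zeta> - X \<zeta>0\<bar> \<le> \<bar>X \<zeta> - X \<zeta>0\<bar>"
      "\<And>\<zeta>. \<zeta> \<in> Z \<Longrightarrow> f (X \<zeta>) \<zeta> - f (X \<zeta>0) \<zeta> = (X \<zeta> - X \<zeta>0) * fr (t \<zeta>) \<zeta>"
      by metis
    have "((\<lambda>\<zeta>. \<bar>X \<zeta> - X \<zeta>0\<bar>) \<longlongrightarrow> \<bar>X \<zeta>0 - X \<zeta>0\<bar>) (at \<zeta>0)"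
      using contX[OF \<zeta>0] unfolding isCont_def by (intro tendsto_intros)
    then have "((\<lambda>\<zeta>. t \<zeta> - X \<zeta>0) \<longlongrightarrow> 0) (at \<zeta>0)"
      unfolding diff_self abs_zero
    proof (rule Lim_null_comparison[rotated])
      show "\<forall>\<^sub>F \<zeta> in at \<zeta>0. norm (t \<zeta> - X \<zeta>0) \<le> \<bar>X \<zeta> - X \<zeta>0\<bar>"
        using evZ by (rule eventually_mono) (use t(2) in simp)
    qed
    then have tlim: "(t \<longlongrightarrow> X \<zeta>0) (at \<zeta>0)" by (simp add: LIM_zero_iff)
    have "((\<lambda>\<zeta>. (t \<zeta>, \<zeta>)) \<longlongrightarrow> (X \<zeta>0, \<zeta>0)) (at \<zeta>0)"
      by (intro tendsto_intros tlim)
    moreover have "(X \<zeta>0, \<zeta>0) \<in> {a..b} \<times> Z" using \<zeta>0 Xin[OF \<zeta>0] by blast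
    moreover have "\<forall>\<^sub>F \<zeta> in at \<zeta>0. (t \<zeta>, \<zeta>) \<in> {a..b} \<times> Z"
      using evZ by (rule eventually_mono) (use t(1) in blast)
    ultimately have "((\<lambda>\<zeta>. fr (fst (t \<zeta>, \<zeta>)) (snd (t \<zeta>, \<zeta>))) \<longlongrightarrow> fr (fst (X \<zeta>0, \<zeta>0)) (snd (X \<zeta>0, \<zeta>0))) (at \<zeta>0)"
      by (rule continuous_on_tendsto_compose[OF contfr])
    then have frlim: "((\<lambda>\<zeta>. fr (t \<zeta>) \<zeta>) \<longlongrightarrow> fr (X \<zeta>0) \<zeta>0) (at \<zeta>0)" by simp
    have fzlim: "((\<lambda>\<zeta>. (f (X \<zeta>0) \<zeta> - f (X \<zeta>0) \<zeta>0) / (\<zeta> - \<zeta>0)) \<longlongrightarrow> fz (X \<zeta>0) \<zeta>0) (at \<zeta>0)"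
      using fz[OF Xin[OF \<zeta>0] \<zeta>0] by (simp add: has_field_derivative_iff)
    have ne: "fr (X \<zeta>0) \<zeta>0 \<noteq> 0" using neg[OF Xin[OF \<zeta>0] \<zeta>0] by (simp add: fr_def)
    have "((\<lambda>\<zeta>. - ((f (X \<zeta>0) \<zeta> - f (X \<zeta>0) \<zeta>0) / (\<zeta> - \<zeta>0)) / fr (t \<zeta>) \<zeta>) \<longlongrightarrow> D \<zeta>0) (at \<zeta>0)"
      unfolding D_def by (intro tendsto_intros fzlim frlim ne)
    \<comment> \<open>Since \<open>F\<close> vanishes at both surface points, the increment of the
      radius times \<open>fr\<close> balances the increment of \<open>f\<close> in \<zeta> at the
      fixed radius \<open>X \<zeta>0\<close>.\<close>
    moreover have "\<forall>\<^sub>F \<zeta> in at \<zeta>0. - ((f (X \<zeta>0) \<zeta> - f (X \<zeta>0) \<zeta>0) / (\<zeta> - \<zeta>0)) / fr (t \<zeta>) \<zeta> = (X \<zeta> - X \<zeta>0) / (\<zeta> - \<zeta>0)"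
      using evZ
    proof eventually_elim
      case (elim \<zeta>)
      have "fr (t \<zeta>) \<zeta> \<noteq> 0" using neg[OF t(1)[OF elim] elim] by (simp add: fr_def)
      moreover have "f (X \<zeta>0) \<zeta> - f (X \<zeta>0) \<zeta>0 = - ((X \<zeta> - X \<zeta>0) * fr (t \<zeta>) \<zeta>)"
        using t(3)[OF elim] X(2)[OF elim] X(2)[OF \<zeta>0] by (simp add: f_def)
      ultimately show ?case by simp
    qed
    ultimately show ?thesis
      unfolding has_field_derivative_iff by (rule Lim_transform_eventually)
  qed
  have contX': "continuous_on Z X" using contX by (simp add: continuous_at_imp_continuous_on)
  have contGX: "continuous_on Z (\<lambda>\<zeta>. G (X \<zeta> *\<^sub>R e \<zeta>))"
    by (rule continuous_on_compose2[OF cont]) (use sub Xin in \<open>auto intro!: continuous_intros contX' conte\<close>)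
  have "continuous_on Z D"
    unfolding D_def[abs_def] fr_def fz_def
    by (intro continuous_intros contGX contX' conte e(3)) (use neg Xin in force)
  then show ?thesis
    unfolding C1_differentiable_on_def using derX
    by (auto simp: has_real_derivative_iff_has_vector_derivative)
qed

section \<open>The gradient, and truncated powers\<close>

lemma partial_deriv_eq:
  "(f has_derivative f') (at x) \<Longrightarrow> partial_deriv i f x = f' (axis i 1)"
  unfolding partial_deriv_def using frechet_derivative_at by metis

lemma grad_eq:
  "(f has_derivative (\<lambda>h. g \<bullet> h)) (at x) \<Longrightarrow> grad f x = g"
  by (simp add: grad_def partial_deriv_eq vec_eq_iff inner_axis)

lemma continuous_on_pos_part_powr:
  fixes p :: real
  assumes "p > 0" "continuous_on S f"
  shows "continuous_on S (\<lambda>x. max 0 (f x) powr p)"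
  using assms by (intro continuous_on_powr' continuous_intros) auto

text \<open>By the mean value theorem; \<open>p \<ge> 1\<close> makes the derivative
  \<open>p * z powr (p - 1)\<close> nondecreasing, so its value at \<open>K\<close> bounds it. The
  lemma is used with \<open>p = \<nu>\<close> for the density and with \<open>p = \<nu> - 1\<close>
  for its gradient.\<close>

lemma pos_part_powr_lipschitz:
  fixes p s t K :: real
  assumes p: "p \<ge> 1" and K: "s \<le> K" "t \<le> K" "0 \<le> K"
  shows "\<bar>max 0 s powr p - max 0 t powr p\<bar> \<le> p * K powr (p - 1) * \<bar>s - t\<bar>"
  using K(1,2)
proof (induction s t rule: linorder_wlog)
  case (le s t)
  define a b where "a = max 0 s" and "b = max 0 t"
  have ab: "0 \<le> a" "a \<le> b" "b \<le> K" using le K by (auto simp: a_def b_def)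
  have "\<bar>a powr p - b powr p\<bar> \<le> p * K powr (p - 1) * (b - a)"
  proof (cases "a = b")
    case False
    then have "a < b" using ab by simp
    have "\<exists>l z. a < z \<and> z < b \<and> DERIV (\<lambda>x. x powr p) z :> l \<and> b powr p - a powr p = (b - a) * l"
    proof (rule MVT[OF \<open>a < b\<close>])
      show "continuous_on {a..b} (\<lambda>x. x powr p)"
        using ab p by (intro continuous_on_powr' continuous_intros) auto
      show "(\<lambda>x. x powr p) differentiable (at x)" if "a < x" "x < b" for x
        using has_real_derivative_powr[of x p] ab that by (auto simp: real_differentiable_def)
    qed
    then obtain l z where z: "a < z" "z < b" "DERIV (\<lambda>x. x powr p) z :> l" "b powr p - a powr p = (b - a) * l" by blast
    have l: "l = p * z powr (p - 1)"
      using DERIV_unique[OF z(3) has_real_derivative_powr] z ab by simp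
    have "l \<ge> 0" using l p by simp
    have "l \<le> p * K powr (p - 1)"
      unfolding l using z ab p by (intro mult_left_mono powr_mono2) auto
    then have "(b - a) * l \<le> (b - a) * (p * K powr (p - 1))" using ab by (intro mult_left_mono) auto
    moreover have "\<bar>a powr p - b powr p\<bar> = (b - a) * l"
    proof -
      have "0 \<le> (b - a) * l" using ab \<open>l \<ge> 0\<close> by simp
      then show ?thesis using z(4) by linarith
    qed
    ultimately show ?thesis by (simp only: mult.commute[of "b - a"])
  qed simp
  also have "\<dots> \<le> p * K powr (p - 1) * \<bar>s - t\<bar>"
    using p le by (intro mult_left_mono) (auto simp: a_def b_def)
  finally show ?case by (simp add: a_def b_def)
next
  case (sym s t)
  then show ?case by (simp add: abs_minus_commute)
qed

text \<open>Only \<open>t = 0\<close> is delicate: there \<open>h powr p \<le> h * h\<close> for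
  \<open>0 < h < 1\<close>, so the difference quotient is at most \<open>|h|\<close>.\<close>

lemma pos_part_powr_has_derivative:
  fixes p t :: real
  assumes p: "p \<ge> 2"
  shows "((\<lambda>t. max 0 t powr p) has_real_derivative p * max 0 t powr (p - 1)) (at t)"
proof -
  consider "t > 0" | "t < 0" | "t = 0" by linarith
  then show ?thesis
  proof cases
    case 1
    have "((\<lambda>t. t powr p) has_real_derivative p * t powr (p - 1)) (at t)"
      using 1 by (rule has_real_derivative_powr)
    then have "((\<lambda>t. max 0 t powr p) has_real_derivative p * t powr (p - 1)) (at t)"
      by (rule has_field_derivative_transform_within_open[of _ _ _ "{0<..}"]) (use 1 in auto)
    then show ?thesis using 1 by simp
  next
    case 2
    have "((\<lambda>t. 0) has_real_derivative 0) (at t)" by simp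
    then have "((\<lambda>t. max 0 t powr p) has_real_derivative 0) (at t)"
      by (rule has_field_derivative_transform_within_open[of _ _ _ "{..<0}"]) (use 2 in auto)
    then show ?thesis using 2 by simp
  next
    case 3
    have "((\<lambda>h. max 0 h powr p / h) \<longlongrightarrow> 0) (at 0)"
    proof (rule Lim_null_comparison)
      have "norm (max 0 h powr p / h) \<le> \<bar>h\<bar>" if "\<bar>h\<bar> < 1" "h \<noteq> 0" for h
      proof (cases "h > 0")
        case True
        then have "h powr p \<le> h powr 2" using that p by (intro powr_mono') auto
        then have "h powr p \<le> h * h" using True by (simp add: power2_eq_square)
        then show ?thesis using True by (simp add: field_simps)
      qed (use that in auto)
      then show "\<forall>\<^sub>F h in at 0. norm (max 0 h powr p / h) \<le> \<bar>h\<bar>"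
        unfolding eventually_at by (intro exI[of _ 1]) auto
      show "((\<lambda>h. \<bar>h\<bar>) \<longlongrightarrow> (0::real)) (at 0)" by (rule tendsto_rabs_zero) (rule tendsto_ident_at)
    qed
    then show ?thesis unfolding 3 has_field_derivative_iff by simp
  qed
qed

section \<open>Surfaces close to a sphere\<close>

text \<open>By axial symmetry one half-plane of constant longitude carries all values of a profile.
  The square root is not differentiable at the poles, so derivatives in \<zeta> are available on the
  open interval.\<close>

definition meridian :: "real \<Rightarrow> real^3" where
  "meridian \<zeta> = vector [sqrt (1 - \<zeta>\<^sup>2), 0, \<zeta>]"

lemma norm_meridian: "\<bar>\<zeta>\<bar> \<le> 1 \<Longrightarrow> norm (meridian \<zeta>) = 1"
proof -
  assume "\<bar>\<zeta>\<bar> \<le> 1"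
  then have "norm (meridian \<zeta>) ^ 2 = 1"
    unfolding norm_vector3 meridian_def vector_3 by (simp add: abs_square_le_1)
  from arg_cong[OF this, of sqrt] show ?thesis by simp
qed

lemma meridian_nth3 [simp]: "meridian \<zeta> $ 3 = \<zeta>"
  by (simp add: meridian_def)

lemma meridian_has_vector_derivative:
  assumes "\<bar>\<zeta>\<bar> < 1"
  shows "(meridian has_vector_derivative (- \<zeta> / sqrt (1 - \<zeta>\<^sup>2)) *\<^sub>R axis 1 1 + axis 3 1) (at \<zeta>)"
proof -
  have pos: "0 < 1 - \<zeta>\<^sup>2" using assms by (simp add: abs_square_less_1)
  have "((\<lambda>t. sqrt (1 - t\<^sup>2)) has_real_derivative - \<zeta> / sqrt (1 - \<zeta>\<^sup>2)) (at \<zeta>)"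
    using pos by (auto intro!: derivative_eq_intros simp: field_simps)
  from has_vector_derivative_add[OF has_vector_derivative_scaleR[OF this has_vector_derivative_const]
      has_vector_derivative_scaleR[OF DERIV_ident has_vector_derivative_const]]
  have "((\<lambda>t. sqrt (1 - t\<^sup>2) *\<^sub>R axis 1 1 + t *\<^sub>R axis 3 1 :: real^3) has_vector_derivative
      (- \<zeta> / sqrt (1 - \<zeta>\<^sup>2)) *\<^sub>R axis 1 1 + axis 3 1) (at \<zeta>)"
    by (rule has_vector_derivative_eq_rhs) simp
  moreover have "meridian = (\<lambda>t. sqrt (1 - t\<^sup>2) *\<^sub>R axis 1 1 + t *\<^sub>R axis 3 1)"
    by (simp add: fun_eq_iff meridian_def vector3_axis)
  ultimately show ?thesis by simp
qed

text \<open>What the statements about the surface require of the potential: its sign off a thin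
  shell, and a negative radial derivative in the shell. The bound
  \<open>2 * \<delta> < \<xi>\<close> keeps the shell away from the origin and inside radius
  \<open>2 * \<xi>\<close>.\<close>

locale nearly_spherical =
  fixes R \<xi> \<delta> :: real and F :: "real^3 \<Rightarrow> real" and G :: "real^3 \<Rightarrow> real^3" and u :: "real \<Rightarrow> real \<Rightarrow> real"
  assumes R: "2 * \<xi> \<le> R" and \<delta>: "0 < \<delta>" "2 * \<delta> < \<xi>"
    and der: "\<And>x. (F has_derivative (\<lambda>h. G x \<bullet> h)) (at x)"
    and cont: "continuous_on UNIV G"
    and inside: "\<And>x. norm x \<le> \<xi> - \<delta> \<Longrightarrow> F x > 0"
    and outside: "\<And>x. \<xi> + \<delta> \<le> norm x \<Longrightarrow> norm x \<le> R \<Longrightarrow> F x < 0"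
    and shell: "\<And>x. \<xi> - \<delta> \<le> norm x \<Longrightarrow> norm x \<le> \<xi> + \<delta> \<Longrightarrow> G x \<bullet> x < 0"
    and u: "\<And>r \<zeta>. r \<in> {0..R} \<Longrightarrow> \<zeta> \<in> {-1..1} \<Longrightarrow> u r \<zeta> = F (r *\<^sub>R meridian \<zeta>)"
begin

section \<open>The zero on each ray\<close>

lemma contF: "continuous_on UNIV F"
  by (rule has_derivative_continuous_on) (rule has_derivative_at_withinI[OF der])

lemma ray_derivative:
  assumes "\<zeta> \<in> {-1..1}"
  shows "((\<lambda>r. F (r *\<^sub>R meridian \<zeta>)) has_real_derivative G (r *\<^sub>R meridian \<zeta>) \<bullet> meridian \<zeta>) (at r)"
proof -
  have 1: "((\<lambda>r. r *\<^sub>R meridian \<zeta>) has_derivative (\<lambda>t. t *\<^sub>R meridian \<zeta>)) (at r)"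
    by (auto intro!: derivative_eq_intros)
  have "((F \<circ> (\<lambda>r. r *\<^sub>R meridian \<zeta>)) has_derivative ((\<lambda>h. G (r *\<^sub>R meridian \<zeta>) \<bullet> h) \<circ> (\<lambda>t. t *\<^sub>R meridian \<zeta>))) (at r)"
    by (rule diff_chain_at[OF 1 der])
  then show ?thesis unfolding has_field_derivative_def o_def
    by (rule has_derivative_eq_rhs) (simp add: fun_eq_iff)
qed

lemma ray_shell:
  assumes "\<zeta> \<in> {-1..1}" "r \<in> {\<xi> - \<delta>..\<xi> + \<delta>}"
  shows "G (r *\<^sub>R meridian \<zeta>) \<bullet> meridian \<zeta> < 0"
proof -
  have r: "r > 0" using assms \<delta> by auto
  have "norm (meridian \<zeta>) = 1" using assms(1) by (intro norm_meridian) auto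
  then have "norm (r *\<^sub>R meridian \<zeta>) = r" using r by simp
  then have "r * (G (r *\<^sub>R meridian \<zeta>) \<bullet> meridian \<zeta>) < 0" using shell[of "r *\<^sub>R meridian \<zeta>"] assms(2) by simp
  then show ?thesis using r by (simp add: mult_less_0_iff)
qed

lemma u_decreasing:
  assumes \<zeta>: "\<zeta> \<in> {-1..1}" and "\<xi> - \<delta> \<le> r" "r < s" "s \<le> \<xi> + \<delta>"
  shows "u s \<zeta> < u r \<zeta>"
proof -
  have "F (s *\<^sub>R meridian \<zeta>) < F (r *\<^sub>R meridian \<zeta>)"
    using assms(3)
  proof (rule DERIV_neg_imp_decreasing)
    fix t assume "r \<le> t" "t \<le> s"
    then show "\<exists>y. ((\<lambda>r. F (r *\<^sub>R meridian \<zeta>)) has_real_derivative y) (at t) \<and> y < 0"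
      using ray_derivative[OF \<zeta>, of t] ray_shell[OF \<zeta>, of t] assms by auto
  qed
  then show ?thesis using assms \<delta> R by (simp add: u)
qed

lemma u_inside:
  assumes "\<zeta> \<in> {-1..1}" "0 \<le> r" "r \<le> \<xi> - \<delta>"
  shows "u r \<zeta> > 0"
proof -
  have "norm (meridian \<zeta>) = 1" using assms(1) by (intro norm_meridian) auto
  then show ?thesis using assms \<delta> R by (auto simp: u intro!: inside)
qed

lemma u_outside:
  assumes "\<zeta> \<in> {-1..1}" "\<xi> + \<delta> \<le> r" "r \<le> R"
  shows "u r \<zeta> < 0"
proof -
  have "norm (meridian \<zeta>) = 1" using assms(1) by (intro norm_meridian) auto
  then show ?thesis using assms \<delta> R by (auto simp: u intro!: outside)
qed

lemma surface_radius_exists: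
  assumes \<zeta>: "\<zeta> \<in> {-1..1}"
  obtains X where "surface_radius u \<xi> \<zeta> X" "\<xi> - \<delta> < X" "X < \<xi> + \<delta>"
proof -
  have "\<exists>X. \<xi> - \<delta> \<le> X \<and> X \<le> \<xi> + \<delta> \<and> F (X *\<^sub>R meridian \<zeta>) = 0"
  proof (rule IVT2')
    show "F ((\<xi> + \<delta>) *\<^sub>R meridian \<zeta>) \<le> 0" "0 \<le> F ((\<xi> - \<delta>) *\<^sub>R meridian \<zeta>)"
      using u_outside[OF \<zeta>, of "\<xi> + \<delta>"] u_inside[OF \<zeta>, of "\<xi> - \<delta>"] \<delta> R u[OF _ \<zeta>, of "\<xi> + \<delta>"] u[OF _ \<zeta>, of "\<xi> - \<delta>"]
      by auto
    show "continuous_on {\<xi> - \<delta>..\<xi> + \<delta>} (\<lambda>X. F (X *\<^sub>R meridian \<zeta>))"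
      by (rule continuous_on_compose2[OF contF]) (auto intro!: continuous_intros)
  qed (use \<delta> in auto)
  then obtain X where X: "\<xi> - \<delta> \<le> X" "X \<le> \<xi> + \<delta>" "F (X *\<^sub>R meridian \<zeta>) = 0" by blast
  have uX: "u X \<zeta> = 0" using X \<delta> R \<zeta> by (simp add: u)
  have X': "\<xi> - \<delta> < X" "X < \<xi> + \<delta>"
    using X u_inside[OF \<zeta>, of X] u_outside[OF \<zeta>, of X] uX \<delta> R by (cases "X = \<xi> - \<delta>"; cases "X = \<xi> + \<delta>"; auto)+
  have "surface_radius u \<xi> \<zeta> X"
    unfolding surface_radius_def
  proof (intro conjI allI impI uX)
    fix r assume "0 \<le> r \<and> r < X"
    then show "u r \<zeta> > 0"
      using u_inside[OF \<zeta>, of r] u_decreasing[OF \<zeta>, of r X] uX X by (cases "r \<le> \<xi> - \<delta>") auto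
  next
    fix r assume "X < r \<and> r \<le> 2 * \<xi>"
    then show "u r \<zeta> < 0"
      using u_outside[OF \<zeta>, of r] u_decreasing[OF \<zeta>, of X r] uX X R by (cases "r \<ge> \<xi> + \<delta>") auto
  qed (use X \<delta> in auto)
  then show thesis using that X' by blast
qed

text \<open>At the smaller of two such radii the profile would be both zero and positive.\<close>

lemma surface_radius_unique:
  assumes "surface_radius u \<xi> \<zeta> X" "surface_radius u \<xi> \<zeta> Y"
  shows "X = Y"
proof (rule ccontr)
  assume "X \<noteq> Y"
  then consider "X < Y" | "Y < X" by linarith
  then show False using assms unfolding surface_radius_def by cases force+
qed

lemma surface_radius_ex1: "\<zeta> \<in> {-1..1} \<Longrightarrow> \<exists>!X. surface_radius u \<xi> \<zeta> X"
  using surface_radius_exists surface_radius_unique by metis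

lemma surface_radius_C1:
  "(\<lambda>\<zeta>. THE X. surface_radius u \<xi> \<zeta> X) C1_differentiable_on {-1<..<1}"
proof -
  define X where "X \<zeta> = (THE X. surface_radius u \<xi> \<zeta> X)" for \<zeta>
  have X: "surface_radius u \<xi> \<zeta> (X \<zeta>)" "X \<zeta> \<in> {\<xi> - \<delta><..<\<xi> + \<delta>}" if "\<zeta> \<in> {-1<..<1}" for \<zeta>
  proof -
    have \<zeta>: "\<zeta> \<in> {-1..1}" using that by auto
    show 1: "surface_radius u \<xi> \<zeta> (X \<zeta>)" unfolding X_def by (rule theI'[OF surface_radius_ex1[OF \<zeta>]])
    obtain Y where "surface_radius u \<xi> \<zeta> Y" "\<xi> - \<delta> < Y" "Y < \<xi> + \<delta>" using surface_radius_exists[OF \<zeta>] .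
    then show "X \<zeta> \<in> {\<xi> - \<delta><..<\<xi> + \<delta>}" using surface_radius_unique[OF 1] by auto
  qed
  have "X C1_differentiable_on {-1<..<1}"
  proof (rule implicit_radius_C1[where W=UNIV and F=F and G=G and e=meridian
        and e'="\<lambda>\<zeta>. (- \<zeta> / sqrt (1 - \<zeta>\<^sup>2)) *\<^sub>R axis 1 1 + axis 3 1" and a="\<xi> - \<delta>" and b="\<xi> + \<delta>"])
    show "continuous_on {-1<..<1} (\<lambda>\<zeta>::real. (- \<zeta> / sqrt (1 - \<zeta>\<^sup>2)) *\<^sub>R axis 1 1 + axis 3 1 :: real^3)"
    proof (intro continuous_intros ballI)
      fix \<zeta> :: real assume "\<zeta> \<in> {-1<..<1}"
      then have "\<zeta>\<^sup>2 < 1" by (auto simp: abs_square_less_1)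
      then show "sqrt (1 - \<zeta>\<^sup>2) \<noteq> 0" by simp
    qed
    show "F (X \<zeta> *\<^sub>R meridian \<zeta>) = 0" if "\<zeta> \<in> {-1<..<1}" for \<zeta>
    proof -
      have "X \<zeta> \<in> {0..R}" using X(2)[OF that] \<delta> R by auto
      then show ?thesis using X(1)[OF that] that u[of "X \<zeta>" \<zeta>] by (auto simp: surface_radius_def)
    qed
  qed (use der cont X ray_shell meridian_has_vector_derivative in auto)
  then show ?thesis unfolding X_def[abs_def] .
qed

lemma zero_in_shell:
  assumes "norm x \<le> R" "F x = 0"
  shows "\<xi> - \<delta> < norm x" "norm x < \<xi> + \<delta>"
  using inside[of x] outside[of x] assms by (auto intro: ccontr simp: not_less not_le)

lemma G_neg_on_zero: "norm x \<le> R \<Longrightarrow> F x = 0 \<Longrightarrow> G x \<bullet> x < 0"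
  using zero_in_shell[of x] by (intro shell) auto

section \<open>The domain of positivity and its boundary\<close>

abbreviation "D \<equiv> {x \<in> cball 0 R. F x > 0}"

text \<open>\<open>F\<close> is negative on the sphere of radius \<open>R\<close>, so the closed
  ball may be replaced by the open one; this is what makes the domain open.\<close>

lemma D_eq: "D = {x \<in> ball 0 R. F x > 0}"
  using outside \<delta> R by (force simp: less_le)

lemma open_D: "open D"
proof -
  have "open (ball 0 R \<inter> F -` {0<..})"
    by (intro open_Int open_ball open_vimage contF) auto
  moreover have "D = ball 0 R \<inter> F -` {0<..}" unfolding D_eq by auto
  ultimately show ?thesis by simp
qed

lemma closure_D: "closure D \<subseteq> {x \<in> cball 0 R. F x \<ge> 0}"
proof (rule closure_minimal)
  have "closed (cball 0 R \<inter> F -` {0..})"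
    by (intro closed_Int closed_cball closed_vimage contF) auto
  moreover have "{x \<in> cball 0 R. F x \<ge> 0} = cball 0 R \<inter> F -` {0..}" by auto
  ultimately show "closed {x \<in> cball 0 R. F x \<ge> 0}" by simp
qed auto

text \<open>A zero is a limit of points of the domain because \<open>F\<close> increases when one
  moves from it towards the origin.\<close>

lemma frontier_D: "frontier D = {x \<in> cball 0 R. F x = 0}"
proof (intro equalityI subsetI)
  fix x assume "x \<in> frontier D"
  then have "x \<in> closure D" "x \<notin> D" using open_D by (auto simp: frontier_def interior_open)
  then show "x \<in> {x \<in> cball 0 R. F x = 0}" using closure_D by force
next
  fix x assume "x \<in> {x \<in> cball 0 R. F x = 0}"
  then have x: "norm x \<le> R" "F x = 0" by auto
  have "G x \<bullet> (- x) > 0" using G_neg_on_zero[OF x] by simp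
  from DERIV_pos_inc_right[OF has_real_derivative_along_line[OF der] this]
  obtain d where d: "d > 0" "\<And>h. 0 < h \<Longrightarrow> h < d \<Longrightarrow> F (x + 0 *\<^sub>R - x) < F (x + (0 + h) *\<^sub>R - x)" by blast
  have "x \<in> closure D"
  proof (rule Lim_in_closed_set)
    show "((\<lambda>t::real. x + t *\<^sub>R - x) \<longlongrightarrow> x) (at_right 0)"
    proof -
      have "((\<lambda>t::real. x + t *\<^sub>R - x) \<longlongrightarrow> x + 0 *\<^sub>R - x) (at_right 0)" by (intro tendsto_intros)
      then show ?thesis by simp
    qed
    have "x + t *\<^sub>R - x \<in> D" if t: "0 < t" "t < min d 1" for t
    proof -
      have "x + t *\<^sub>R - x = (1 - t) *\<^sub>R x" by (simp add: algebra_simps)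
      then have "norm (x + t *\<^sub>R - x) = (1 - t) * norm x" using t by simp
      also have "\<dots> \<le> 1 * norm x" using t by (intro mult_right_mono) auto
      finally show ?thesis using d(2)[of t] x t by simp
    qed
    then have "\<forall>\<^sub>F t in at_right 0. x + t *\<^sub>R - x \<in> D"
      unfolding eventually_at_right_field using d(1) by (intro exI[of _ "min d 1"]) (simp only: min_less_iff_conj, simp)
    then show "\<forall>\<^sub>F t in at_right 0. x + t *\<^sub>R - x \<in> closure D"
      by (rule eventually_mono) (rule subsetD[OF closure_subset])
  qed auto
  moreover have "x \<notin> interior D" using x interior_subset[of D] by auto
  ultimately show "x \<in> frontier D" by (simp add: frontier_def)
qed

lemma frontier_D_ball: "frontier D = {x \<in> ball 0 R. F x = 0}"
  unfolding frontier_D using zero_in_shell \<delta> R by force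

lemma submanifold: "C1_submanifold 2 (frontier D)"
proof -
  have "C1_submanifold (DIM(real^3) - 1) (frontier D)"
  proof (rule C1_submanifold_level_set[where W="ball 0 R" and F=F and G=G])
    show "frontier D = {x \<in> ball 0 R. F x = 0}" by (rule frontier_D_ball)
    show "G x \<noteq> 0" if "x \<in> frontier D" for x
      using that[unfolded frontier_D] G_neg_on_zero[of x] by auto
  qed (use der continuous_on_subset[OF cont] frontier_D_ball in auto)
  then show ?thesis by simp
qed

lemma outer_normal:
  assumes p: "p \<in> frontier D"
  shows "\<exists>!N. unit_outer_normal D p N"
    and "unit_outer_normal D p N \<Longrightarrow> ((\<lambda>t. F (p + t *\<^sub>R N)) has_real_derivative grad F p \<bullet> N) (at 0)"
    and "unit_outer_normal D p N \<Longrightarrow> grad F p \<bullet> N < 0"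
proof -
  have ne: "G p \<noteq> 0" using p[unfolded frontier_D] G_neg_on_zero[of p] by auto
  have N: "unit_outer_normal D p N \<longleftrightarrow> N = - (1 / norm (G p)) *\<^sub>R G p" for N
  proof (rule unit_outer_normal_superlevel[where W="ball 0 R" and F=F])
    show "p \<in> ball 0 R" using p unfolding frontier_D_ball by auto
    show "frontier D \<inter> ball 0 R = {x \<in> ball 0 R. F x = 0}" unfolding frontier_D_ball by auto
    show "{x \<in> ball 0 R. 0 < F x} \<subseteq> interior D" unfolding interior_open[OF open_D] by auto
    show "closure D \<inter> ball 0 R \<subseteq> {x. 0 \<le> F x}" using closure_D by auto
  qed (use der continuous_on_subset[OF cont] ne p in auto)
  then show "\<exists>!N. unit_outer_normal D p N" by auto
  have g: "grad F p = G p" by (rule grad_eq[OF der])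
  show "((\<lambda>t. F (p + t *\<^sub>R N)) has_real_derivative grad F p \<bullet> N) (at 0)"
    unfolding g by (rule has_real_derivative_along_line[OF der])
  show "grad F p \<bullet> N < 0" if "unit_outer_normal D p N"
    using that ne unfolding N g by (simp add: power2_eq_square flip: power2_norm_eq_inner)
qed

end

section \<open>Regularity of the rotating potential\<close>

text \<open>The gradient of half the squared distance from the axis; times
  \<open>\<epsilon> / 2\<close> it is the gradient of the centrifugal term.\<close>

definition horizontal :: "real^3 \<Rightarrow> real^3" where
  "horizontal x = x - (x$3) *\<^sub>R axis 3 1"

lemma bounded_linear_horizontal: "bounded_linear horizontal"
  unfolding horizontal_def[abs_def]
  by (intro bounded_linear_sub bounded_linear_ident bounded_linear_scaleR_const bounded_linear_vec_nth)

lemma norm_horizontal_le: "norm (horizontal x) \<le> norm x"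
proof (rule power2_le_imp_le)
  show "(norm (horizontal x))\<^sup>2 \<le> (norm x)\<^sup>2"
    unfolding norm_vector3 by (simp add: horizontal_def axis_def)
qed simp

lemma horizontal_inner: "horizontal x \<bullet> h = x$1 * h$1 + x$2 * h$2"
  by (simp add: horizontal_def inner_vec_def sum_3 axis_def)

definition rotating_grad :: "real \<Rightarrow> (real^3 \<Rightarrow> real) \<Rightarrow> real^3 \<Rightarrow> real^3" where
  "rotating_grad \<epsilon> P x = (\<epsilon> / 2) *\<^sub>R horizontal x + (1 / (4 * pi)) *\<^sub>R conv P newton_grad x"

lemma rotating_potential_has_derivative:
  assumes P: "P \<in> borel_measurable borel" "\<And>y. \<bar>P y\<bar> \<le> M" "\<And>y. norm y > R \<Longrightarrow> P y = 0"
  shows "((\<lambda>x. c + \<epsilon> / 4 * ((x$1)\<^sup>2 + (x$2)\<^sup>2) + 1 / (4 * pi) * conv P newton x) has_derivative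
    (\<lambda>h. rotating_grad \<epsilon> P x \<bullet> h)) (at x)"
proof -
  have sq: "((\<lambda>x::real^3. (x$i)\<^sup>2) has_derivative (\<lambda>h. h$i * (2 * x$i))) (at x)" for i
  proof -
    have "((\<lambda>t::real. t\<^sup>2) has_real_derivative 2 * x$i) (at (x$i))"
      by (auto intro!: derivative_eq_intros)
    from DERIV_compose_FDERIV[OF this has_derivative_nth] show ?thesis .
  qed
  show ?thesis
    by (rule has_derivative_eq_rhs[OF has_derivative_add[OF has_derivative_add[OF has_derivative_const
            has_derivative_mult_right[OF has_derivative_add[OF sq sq]]]
            has_derivative_mult_right[OF newton_potential_has_derivative[OF P]]]])
       (auto simp: fun_eq_iff rotating_grad_def inner_add_left horizontal_inner algebra_simps)
qed

lemma continuous_rotating_grad: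
  assumes "continuous_on UNIV P" "\<And>y. norm y > R \<Longrightarrow> P y = 0"
  shows "continuous_on UNIV (rotating_grad \<epsilon> P)"
  unfolding rotating_grad_def[abs_def]
  by (intro continuous_intros bounded_linear.continuous_on[OF bounded_linear_horizontal]
      conv_continuous[OF locally_integrable_newton_grad assms]) auto

lemma continuous_cut_off:
  fixes g :: "'a::real_normed_vector \<Rightarrow> 'b::real_normed_vector"
  assumes "continuous_on (cball 0 R) g" "\<And>y. norm y = R \<Longrightarrow> g y = 0"
  shows "continuous_on UNIV (\<lambda>y. if norm y \<le> R then g y else 0)"
proof -
  have "continuous_on (cball 0 R \<union> {y :: 'a. R \<le> norm y}) (\<lambda>y. if norm y \<le> R then g y else 0)"
    by (rule continuous_on_cases) (use assms in \<open>auto intro!: closed_Collect_le continuous_intros\<close>)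
  moreover have "cball 0 R \<union> {y :: 'a. R \<le> norm y} = UNIV" by auto
  ultimately show ?thesis by simp
qed

text \<open>\<open>P\<close> is a function of \<open>F\<close>, and \<open>F\<close> is a potential
  of \<open>P\<close>; regularity is gained by going round this circle. The negative values of
  \<open>F\<close> between the radii \<open>a\<close> and \<open>R\<close> separate the support of
  the density from the sphere where it is cut off.\<close>

locale rotating_star =
  fixes \<nu> R a c \<epsilon> M :: real and F P :: "real^3 \<Rightarrow> real"
  assumes \<nu>: "\<nu> \<ge> 2" and a: "0 < a" "a < R"
    and P: "\<And>y. P y = (if norm y \<le> R then max 0 (F y) powr \<nu> else 0)"
    and P_meas: "P \<in> borel_measurable borel" and P_le: "\<And>y. \<bar>P y\<bar> \<le> M"
    and neg: "\<And>y. a \<le> norm y \<Longrightarrow> norm y \<le> R \<Longrightarrow> F y < 0"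
    and F: "\<And>x. F x = c + \<epsilon> / 4 * ((x$1)\<^sup>2 + (x$2)\<^sup>2) + 1 / (4 * pi) * conv P newton x"
begin

abbreviation "G \<equiv> rotating_grad \<epsilon> P"

lemma P_supp: "norm y > R \<Longrightarrow> P y = 0"
  by (simp add: P)

text \<open>The first turn of the circle, which uses only that the density is bounded, measurable
  and compactly supported.\<close>

lemma F_der: "(F has_derivative (\<lambda>h. G x \<bullet> h)) (at x)"
  unfolding F[abs_def] by (rule rotating_potential_has_derivative[OF P_meas P_le P_supp])

lemma contF: "continuous_on UNIV F"
  by (rule has_derivative_continuous_on) (rule has_derivative_at_withinI[OF F_der])

lemma contP: "continuous_on UNIV P"
  unfolding P[abs_def] using \<nu> neg a
  by (intro continuous_cut_off continuous_on_pos_part_powr continuous_on_subset[OF contF]) auto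

lemma contG: "continuous_on UNIV G"
  by (rule continuous_rotating_grad[OF contP P_supp])

text \<open>The gradient of \<open>P\<close> according to the chain rule, cut off at
  \<open>R\<close> like \<open>P\<close> itself.\<close>

definition r :: "real^3 \<Rightarrow> real^3" where
  "r y = (if norm y \<le> R then (\<nu> * max 0 (F y) powr (\<nu> - 1)) *\<^sub>R G y else 0)"

lemma P_zero: "a \<le> norm y \<Longrightarrow> P y = 0"
  using neg[of y] \<nu> by (auto simp: P max_def)

lemma r_zero: "a \<le> norm y \<Longrightarrow> r y = 0"
  using neg[of y] by (auto simp: r_def max_def)

lemma r_supp: "norm y > R \<Longrightarrow> r y = 0"
  by (simp add: r_def)

lemma contr: "continuous_on UNIV r"
  unfolding r_def[abs_def] using \<nu> neg a
  by (intro continuous_cut_off continuous_intros continuous_on_pos_part_powr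
      continuous_on_subset[OF contF] continuous_on_subset[OF contG]) auto

text \<open>The chain rule applies in the open ball of radius \<open>R\<close>, and beyond radius
  \<open>a\<close> the density is locally zero. Since \<open>a < R\<close>, these two open sets
  cover the space.\<close>

lemma P_der: "(P has_derivative (\<lambda>h. r y \<bullet> h)) (at y)"
proof (cases "norm y < R")
  case True
  have "((\<lambda>y. max 0 (F y) powr \<nu>) has_derivative (\<lambda>h. (G y \<bullet> h) * (\<nu> * max 0 (F y) powr (\<nu> - 1)))) (at y)"
    by (rule DERIV_compose_FDERIV[OF pos_part_powr_has_derivative[OF \<nu>] F_der])
  then have "(P has_derivative (\<lambda>h. (G y \<bullet> h) * (\<nu> * max 0 (F y) powr (\<nu> - 1)))) (at y)"
    by (rule has_derivative_transform_within_open[of _ _ _ _ "ball 0 R"]) (use True in \<open>auto simp: P\<close>)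
  then show ?thesis using True by (simp add: r_def mult.commute)
next
  case False
  have "((\<lambda>y. 0) has_derivative (\<lambda>h. 0)) (at y)" by simp
  then have "(P has_derivative (\<lambda>h. 0)) (at y)"
    by (rule has_derivative_transform_within_open[of _ _ _ _ "- cball 0 a"])
       (use False a in \<open>auto simp: P_zero\<close>)
  then show ?thesis using False a by (simp add: r_zero)
qed

text \<open>The second derivative of \<open>F\<close> as a linear map: the kernel is still
  \<open>newton_grad\<close>, and the new derivative sits on the density.\<close>

definition G' :: "real^3 \<Rightarrow> real^3 \<Rightarrow> real^3" where
  "G' x h = (\<epsilon> / 2) *\<^sub>R horizontal h + (1 / (4 * pi)) *\<^sub>R conv (\<lambda>y. r y \<bullet> h) newton_grad x"

lemma G_der: "(G has_derivative G' x) (at x)"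
  unfolding rotating_grad_def[abs_def] G'_def[abs_def]
  by (intro has_derivative_add has_derivative_scaleR_right bounded_linear_imp_has_derivative
      bounded_linear_horizontal conv_has_derivative[OF locally_integrable_newton_grad P_der contr P_supp r_supp])

lemma lipschitz_on_ball:
  fixes f :: "real^3 \<Rightarrow> 'b::real_normed_vector"
  assumes "\<And>x. (f has_derivative f' x) (at x)" "\<And>x h. x \<in> cball 0 R \<Longrightarrow> norm (f' x h) \<le> K * norm h"
    and "x \<in> cball 0 R" "y \<in> cball 0 R"
  shows "norm (f x - f y) \<le> K * norm (x - y)"
proof (rule differentiable_bound[of "cball 0 R"])
  show "onorm (f' x) \<le> K" if "x \<in> cball 0 R" for x
    by (rule onorm_le) (rule assms(2)[OF that])
qed (use assms(3,4) has_derivative_at_withinI[OF assms(1)] in auto)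

text \<open>On the ball \<open>r\<close> is a product of Lipschitz functions: the power because
  \<open>\<nu> - 1 \<ge> 1\<close>, and \<open>G\<close> because \<open>G'\<close> is bounded there.
  Outside the ball it is zero, and a gap of width \<open>R - a\<close> separates the exterior from
  the support.\<close>

lemma r_lipschitz: "\<exists>L. \<forall>x y. norm (r x - r y) \<le> L * norm (x - y)"
proof -
  obtain N where N: "N \<ge> 0" "\<And>y. norm (r y) \<le> N" using compact_support_bounded[OF contr r_supp] by blast
  have "bounded (G ` cball 0 R)" "bounded (F ` cball 0 R)"
    by (intro compact_imp_bounded compact_continuous_image continuous_on_subset[OF contG]
        continuous_on_subset[OF contF] compact_cball subset_UNIV)+
  then obtain KG KF where KG: "\<And>x. x \<in> cball 0 R \<Longrightarrow> norm (G x) \<le> KG"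
    and KF: "\<And>x. x \<in> cball 0 R \<Longrightarrow> \<bar>F x\<bar> \<le> KF"
    unfolding bounded_iff by (metis imageI real_norm_def)
  have 0: "(0::real^3) \<in> cball 0 R" using a by simp
  have K0: "KG \<ge> 0" "KF \<ge> 0" using KG[OF 0] KF[OF 0] norm_ge_zero[of "G 0"] by linarith+
  have bdr: "\<bar>r y \<bullet> h\<bar> \<le> N * norm h" for y h
    by (rule order_trans[OF Cauchy_Schwarz_ineq2 mult_right_mono[OF N(2)]]) simp
  have F_lip: "\<bar>F x - F y\<bar> \<le> KG * norm (x - y)" if "x \<in> cball 0 R" "y \<in> cball 0 R" for x y
    using lipschitz_on_ball[OF F_der _ that, of KG] Cauchy_Schwarz_ineq2[of "G z" h for z h] KG
    by (metis mult_right_mono norm_ge_zero order_trans real_norm_def)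
  \<comment> \<open>A bound for the operator norm of \<open>G'\<close> on the ball. For
    \<open>x\<close> in the ball the translated density is supported in radius
    \<open>R + R\<close>.\<close>
  define H where "H = \<bar>\<epsilon>\<bar> / 2 + 1 / (4 * pi) * (N * kernel_mass (newton_grad :: real^3 \<Rightarrow> _) (R + R))"
  have H: "H \<ge> 0" using N(1) by (simp add: H_def kernel_mass_nonneg)
  have G'_le: "norm (G' x h) \<le> H * norm h" if x: "x \<in> cball 0 R" for x h
  proof -
    have "(\<lambda>y. r y \<bullet> h) \<in> borel_measurable borel"
      by (intro borel_measurable_continuous_onI continuous_intros contr)
    then have "norm (conv (\<lambda>y. r y \<bullet> h) newton_grad x) \<le> N * norm h * kernel_mass (newton_grad :: real^3 \<Rightarrow> _) (R + R)"
      by (rule conv_bound[OF locally_integrable_newton_grad _ bdr, where R=R]) (use x in \<open>auto simp: r_supp\<close>)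
    then have 1: "norm ((1 / (4 * pi)) *\<^sub>R conv (\<lambda>y. r y \<bullet> h) newton_grad x)
        \<le> 1 / (4 * pi) * (N * norm h * kernel_mass (newton_grad :: real^3 \<Rightarrow> _) (R + R))"
      unfolding norm_scaleR by (intro mult_mono) auto
    have 2: "norm ((\<epsilon> / 2) *\<^sub>R horizontal h) \<le> \<bar>\<epsilon>\<bar> / 2 * norm h"
      unfolding norm_scaleR using norm_horizontal_le[of h] by (intro mult_mono) auto
    have "norm (G' x h) \<le> \<bar>\<epsilon>\<bar> / 2 * norm h + 1 / (4 * pi) * (N * norm h * kernel_mass (newton_grad :: real^3 \<Rightarrow> _) (R + R))"
      unfolding G'_def by (rule order_trans[OF norm_triangle_ineq add_mono[OF 2 1]])
    also have "\<dots> = H * norm h" unfolding H_def by (simp add: algebra_simps)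
    finally show ?thesis .
  qed
  have G_lip: "norm (G x - G y) \<le> H * norm (x - y)" if "x \<in> cball 0 R" "y \<in> cball 0 R" for x y
    using lipschitz_on_ball[OF G_der G'_le that] .
  \<comment> \<open>\<open>S\<close> is the Lipschitz constant of the power on values up to
    \<open>KF\<close>, \<open>L1\<close> comes from the product rule, and \<open>N / (R - a)\<close>
    handles a point inside radius \<open>a\<close> against a point beyond \<open>R\<close>.\<close>
  define S where "S = (\<nu> - 1) * KF powr (\<nu> - 1 - 1)"
  define L1 where "L1 = \<nu> * (S * KG * KG + KF powr (\<nu> - 1) * H)"
  define L where "L = L1 + N / (R - a)"
  have S: "S \<ge> 0" using \<nu> by (simp add: S_def)
  have L1: "L1 \<ge> 0" using \<nu> S K0 H by (simp add: L1_def)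
  have L: "L1 \<le> L" "N / (R - a) \<le> L" using L1 N(1) a by (simp_all add: L_def)
  have in_ball: "norm (r x - r y) \<le> L1 * norm (x - y)" if "x \<in> cball 0 R" "y \<in> cball 0 R" for x y
  proof -
    let ?s = "\<lambda>x. max 0 (F x) powr (\<nu> - 1)"
    have "\<bar>?s x - ?s y\<bar> \<le> S * \<bar>F x - F y\<bar>"
      unfolding S_def using KF[OF that(1)] KF[OF that(2)] \<nu> K0 by (intro pos_part_powr_lipschitz) auto
    also have "\<dots> \<le> S * (KG * norm (x - y))" using F_lip[OF that] S by (rule mult_left_mono)
    finally have 1: "\<bar>?s x - ?s y\<bar> \<le> S * KG * norm (x - y)" by (simp add: mult.assoc)
    have 2: "?s y \<le> KF powr (\<nu> - 1)" using KF[OF that(2)] \<nu> K0 by (intro powr_mono2) auto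
    have "r x - r y = \<nu> *\<^sub>R ((?s x - ?s y) *\<^sub>R G x + ?s y *\<^sub>R (G x - G y))"
      using that by (simp add: r_def algebra_simps)
    also have "norm \<dots> = \<nu> * norm ((?s x - ?s y) *\<^sub>R G x + ?s y *\<^sub>R (G x - G y))" using \<nu> by simp
    also have "\<dots> \<le> \<nu> * (\<bar>?s x - ?s y\<bar> * norm (G x) + ?s y * norm (G x - G y))"
      using \<nu> by (intro mult_left_mono order_trans[OF norm_triangle_ineq]) auto
    also have "\<dots> \<le> \<nu> * (S * KG * norm (x - y) * KG + KF powr (\<nu> - 1) * (H * norm (x - y)))"
      using 1 2 KG[OF that(1)] G_lip[OF that] \<nu> S K0
      by (intro mult_left_mono add_mono mult_mono) auto
    also have "\<dots> = L1 * norm (x - y)" by (simp add: L1_def algebra_simps)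
    finally show ?thesis .
  qed
  have mixed: "norm (r x - r y) \<le> L * norm (x - y)" if "norm y > R" for x y
  proof (cases "a \<le> norm x")
    case True
    then show ?thesis using r_zero[of x] r_supp[OF that] L L1 by simp
  next
    case False
    have "R - a \<le> norm (x - y)" using False that norm_triangle_ineq2[of y x] by (simp add: norm_minus_commute)
    then have "N * (R - a) \<le> N * norm (x - y)" using N(1) by (rule mult_left_mono)
    then have "N \<le> N / (R - a) * norm (x - y)" using a by (simp add: field_simps)
    also have "\<dots> \<le> L * norm (x - y)" using L by (intro mult_right_mono) auto
    finally show ?thesis using N(2)[of x] r_supp[OF that] by simp
  qed
  have "norm (r x - r y) \<le> L * norm (x - y)" for x y
  proof (cases "norm x \<le> R \<and> norm y \<le> R")
    case True
    then have "norm (r x - r y) \<le> L1 * norm (x - y)" by (intro in_ball) auto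
    also have "\<dots> \<le> L * norm (x - y)" using L by (intro mult_right_mono) auto
    finally show ?thesis .
  next
    case False
    then show ?thesis using mixed[of y x] mixed[of x y] by (auto simp: norm_minus_commute)
  qed
  then show ?thesis by blast
qed

text \<open>The centrifugal part of \<open>G'\<close> does not depend on the point and cancels; the
  rest inherits the Lipschitz constant of the density gradient.\<close>

lemma G'_lipschitz:
  "\<exists>K. \<forall>x\<in>cball 0 R. \<forall>x'\<in>cball 0 R. norm (G' x h - G' x' h) \<le> K * norm (x - x')"
proof -
  obtain L where L: "\<And>x y. norm (r x - r y) \<le> L * norm (x - y)" using r_lipschitz by blast
  have lip: "\<bar>r y \<bullet> h - r z \<bullet> h\<bar> \<le> (L * norm h) * norm (y - z)" for y z
  proof -
    have "\<bar>(r y - r z) \<bullet> h\<bar> \<le> (L * norm (y - z)) * norm h"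
      by (rule order_trans[OF Cauchy_Schwarz_ineq2 mult_right_mono[OF L]]) simp
    then show ?thesis by (simp add: inner_diff_left mult_ac)
  qed
  have cont: "continuous_on UNIV (\<lambda>y. r y \<bullet> h)" by (intro continuous_intros contr)
  have supp: "r y \<bullet> h = 0" if "norm y > R" for y using r_supp[OF that] by simp
  define K where "K = 1 / (4 * pi) * (L * norm h * kernel_mass (newton_grad :: real^3 \<Rightarrow> _) (R + R))"
  have "norm (G' x h - G' x' h) \<le> K * norm (x - x')" if "x \<in> cball 0 R" "x' \<in> cball 0 R" for x x'
  proof -
    have "G' x h - G' x' h = (1 / (4 * pi)) *\<^sub>R (conv (\<lambda>y. r y \<bullet> h) newton_grad x - conv (\<lambda>y. r y \<bullet> h) newton_grad x')"
      by (simp add: G'_def scaleR_diff_right)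
    then have "norm (G' x h - G' x' h) = 1 / (4 * pi) * norm (conv (\<lambda>y. r y \<bullet> h) newton_grad x - conv (\<lambda>y. r y \<bullet> h) newton_grad x')"
      by simp
    also have "\<dots> \<le> 1 / (4 * pi) * (L * norm h * norm (x - x') * kernel_mass (newton_grad :: real^3 \<Rightarrow> _) (R + R))"
      by (intro mult_left_mono conv_lipschitz[OF locally_integrable_newton_grad cont supp lip]) (use that in auto)
    also have "\<dots> = K * norm (x - x')" by (simp add: K_def)
    finally show ?thesis .
  qed
  then show ?thesis by blast
qed

lemma grad_F: "grad F = G"
  by (rule ext) (rule grad_eq[OF F_der])

lemma partial_deriv_F: "partial_deriv i F = (\<lambda>x. G x $ i)"
  by (rule ext) (simp add: partial_deriv_eq[OF F_der] inner_axis)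

lemma partial_deriv2_F: "partial_deriv j (partial_deriv i F) = (\<lambda>x. G' x (axis j 1) $ i)"
proof
  fix x
  have "((\<lambda>x. G x $ i) has_derivative (\<lambda>h. G' x h $ i)) (at x)"
    by (rule bounded_linear.has_derivative[OF bounded_linear_vec_nth G_der])
  then show "partial_deriv j (partial_deriv i F) x = G' x (axis j 1) $ i"
    unfolding partial_deriv_F by (rule partial_deriv_eq)
qed

lemma holder_second_derivatives: "holder_continuous_on (cball 0 R) (partial_deriv j (partial_deriv i F))"
proof -
  obtain K where K: "\<And>x x'. x \<in> cball 0 R \<Longrightarrow> x' \<in> cball 0 R \<Longrightarrow>
      norm (G' x (axis j 1) - G' x' (axis j 1)) \<le> K * norm (x - x')"
    using G'_lipschitz[of "axis j 1"] by blast
  have "dist (G' x (axis j 1) $ i) (G' x' (axis j 1) $ i) \<le> K * dist x x' powr 1"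
    if "x \<in> cball 0 R" "x' \<in> cball 0 R" for x x'
    using order_trans[OF component_le_norm_cart[of "G' x (axis j 1) - G' x' (axis j 1)" i] K[OF that]]
    by (simp add: dist_norm)
  then show ?thesis
    unfolding holder_continuous_on_def partial_deriv2_F by (intro exI[of _ 1] exI[of _ K]) auto
qed

end

section \<open>The density in Cartesian coordinates\<close>

lemma newton_has_derivative:
  fixes x :: "'a::euclidean_space"
  assumes "x \<noteq> 0"
  shows "(newton has_derivative (\<lambda>h. newton_grad x \<bullet> h)) (at x)"
proof -
  have pos: "x \<bullet> x > 0" using assms by simp
  have "((\<lambda>t. 1 / sqrt t) has_real_derivative - (1 / (2 * (t * sqrt t)))) (at t)" if "t > 0" for t :: real
    using that by (auto intro!: derivative_eq_intros simp: field_simps)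
  from this[OF pos] have 1: "((\<lambda>t. 1 / sqrt t) has_real_derivative - (1 / (2 * norm x ^ 3))) (at (x \<bullet> x))"
    by (simp add: power3_eq_cube power2_eq_square flip: norm_eq_sqrt_inner power2_norm_eq_inner)
  have 2: "((\<lambda>x. x \<bullet> x) has_derivative (\<lambda>h. x \<bullet> h + h \<bullet> x)) (at x)"
    by (rule has_derivative_inner) (rule has_derivative_ident)+
  have "((\<lambda>x. 1 / sqrt (x \<bullet> x)) has_derivative (\<lambda>h. (x \<bullet> h + h \<bullet> x) * - (1 / (2 * norm x ^ 3)))) (at x)"
    by (rule DERIV_compose_FDERIV[OF 1 2])
  moreover have "newton = (\<lambda>x::'a. 1 / sqrt (x \<bullet> x))" by (simp add: fun_eq_iff newton_def norm_eq_sqrt_inner)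
  ultimately show ?thesis
    by (simp add: newton_grad_def inner_commute)
qed

lemma cos_polar_in: "\<bar>x$3 / norm x\<bar> \<le> 1" for x :: "real^3"
  using component_le_norm_cart[of x 3] by (cases "x = 0") (auto simp: field_simps)

lemma cos_polar_in': "x$3 / norm x \<in> {-1..1}" for x :: "real^3"
  using cos_polar_in[of x] unfolding abs_le_iff atLeastAtMost_iff by linarith

text \<open>Away from the origin this is a composition of continuous maps. At the origin the polar
  cosine has no limit; there uniform continuity on the rectangle is combined with the independence
  of \<zeta> at \<open>r = 0\<close>.\<close>

lemma continuous_on_cartesian:
  assumes u: "u \<in> space_E R" and R: "R > 0"
  shows "continuous_on (cball 0 R) (cartesian u)"
proof -
  define f where "f = (\<lambda>(r, \<zeta>). u r \<zeta>)"
  have cf: "continuous_on ({0..R} \<times> {-1..1}) f" and u0: "\<And>\<zeta>. \<zeta> \<in> {-1..1} \<Longrightarrow> u 0 \<zeta> = u 0 0"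
    using u unfolding space_E_def f_def by blast+
  show ?thesis
    unfolding continuous_on_eq_continuous_within
  proof
    fix x :: "real^3" assume x: "x \<in> cball 0 R"
    show "continuous (at x within cball 0 R) (cartesian u)"
    proof (cases "x = 0")
      case False
      have "continuous_on (cball 0 R - {0}) (\<lambda>x::real^3. f (norm x, x$3 / norm x))"
        by (rule continuous_on_compose2[OF cf]) (use cos_polar_in' in \<open>auto intro!: continuous_intros\<close>)
      then have "continuous_on (cball 0 R - {0}) (cartesian u)"
        by (simp add: cartesian_def[abs_def] f_def)
      then have "continuous (at x within cball 0 R - {0}) (cartesian u)"
        using x False by (simp add: continuous_on_eq_continuous_within)
      moreover have "at x within cball 0 R - {0} = at x within cball 0 R"
        by (rule at_within_nhd[of _ "- {0}"]) (use False in auto)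
      ultimately show ?thesis by simp
    next
      case True
      show ?thesis unfolding True continuous_within_eps_delta
      proof (intro allI impI)
        fix e :: real assume "e > 0"
        have "uniformly_continuous_on ({0..R} \<times> {-1..1}) f"
          by (intro compact_uniformly_continuous cf compact_Times) auto
        then obtain d where d: "d > 0" "\<And>s s'. s \<in> {0..R} \<times> {-1..1} \<Longrightarrow> s' \<in> {0..R} \<times> {-1..1} \<Longrightarrow> dist s' s < d \<Longrightarrow> dist (f s') (f s) < e"
          unfolding uniformly_continuous_on_def using \<open>e > 0\<close> by metis
        have "dist (cartesian u y) (cartesian u 0) < e" if y: "y \<in> cball 0 R" "dist y 0 < d" for y
        proof -
          let ?\<zeta> = "y$3 / norm y"
          have "dist (f (norm y, ?\<zeta>)) (f (0, ?\<zeta>)) < e"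
            by (rule d(2)) (use y R cos_polar_in'[of y] in \<open>auto simp: dist_Pair_Pair\<close>)
          then show ?thesis using u0[OF cos_polar_in'[of y]] by (simp add: f_def cartesian_def)
        qed
        then show "\<exists>d>0. \<forall>y\<in>cball 0 R. dist y 0 < d \<longrightarrow> dist (cartesian u y) (cartesian u 0) < e"
          using d(1) by blast
      qed
    qed
  qed
qed

definition density :: "real \<Rightarrow> real \<Rightarrow> (real \<Rightarrow> real \<Rightarrow> real) \<Rightarrow> real^3 \<Rightarrow> real" where
  "density \<nu> R u y = (if norm y \<le> R then max 0 (cartesian u y) powr \<nu> else 0)"

lemma density_supp: "norm y > R \<Longrightarrow> density \<nu> R u y = 0"
  by (simp add: density_def)

lemma cartesian_bounded:
  assumes "u \<in> space_E R" "R > 0"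
  obtains M where "M \<ge> 0" "\<And>y. norm y \<le> R \<Longrightarrow> \<bar>cartesian u y\<bar> \<le> M"
proof -
  have "bounded (cartesian u ` cball 0 R)"
    by (intro compact_imp_bounded compact_continuous_image continuous_on_cartesian[OF assms]) auto
  then obtain M where M: "\<And>y. y \<in> cball 0 R \<Longrightarrow> \<bar>cartesian u y\<bar> \<le> M"
    unfolding bounded_iff by (metis imageI real_norm_def)
  show thesis
  proof (rule that)
    show "\<bar>M\<bar> \<ge> 0" by simp
    show "\<bar>cartesian u y\<bar> \<le> \<bar>M\<bar>" if "norm y \<le> R" for y using M[of y] that by auto
  qed
qed

lemma density_bounded:
  assumes "u \<in> space_E R" "R > 0" "\<nu> > 0"
  obtains M where "\<And>y. \<bar>density \<nu> R u y\<bar> \<le> M"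
proof -
  obtain M where M: "M \<ge> 0" "\<And>y. norm y \<le> R \<Longrightarrow> \<bar>cartesian u y\<bar> \<le> M"
    using cartesian_bounded[OF assms(1,2)] by blast
  show thesis
  proof (rule that)
    fix y show "\<bar>density \<nu> R u y\<bar> \<le> M powr \<nu>"
    proof (cases "norm y \<le> R")
      case True
      have "max 0 (cartesian u y) powr \<nu> \<le> M powr \<nu>"
        using M(1) M(2)[OF True] assms(3) by (intro powr_mono2) auto
      then show ?thesis using True by (simp add: density_def)
    qed (simp add: density_def)
  qed
qed

lemma density_measurable:
  assumes "u \<in> space_E R" "R > 0" "\<nu> > 0"
  shows "density \<nu> R u \<in> borel_measurable borel"
proof -
  have "(\<lambda>y. indicator (cball 0 R) y *\<^sub>R (max 0 (cartesian u y) powr \<nu>)) \<in> borel_measurable borel"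
    using assms by (intro borel_measurable_continuous_on_indicator continuous_on_pos_part_powr continuous_on_cartesian) auto
  moreover have "density \<nu> R u = (\<lambda>y. indicator (cball 0 R) y *\<^sub>R (max 0 (cartesian u y) powr \<nu>))"
    by (auto simp: density_def fun_eq_iff)
  ultimately show ?thesis by simp
qed

lemma density_continuous:
  assumes "u \<in> space_E R" "R > 0" "\<nu> > 0" and 0: "\<And>y. norm y = R \<Longrightarrow> cartesian u y \<le> 0"
  shows "continuous_on UNIV (density \<nu> R u)"
  unfolding density_def[abs_def] using assms
  by (intro continuous_cut_off continuous_on_pos_part_powr continuous_on_cartesian) auto

text \<open>For \<open>r = 0\<close> the kernel is \<open>2 * pi / r'\<close>, so the subtracted
  integral is the value of the potential term at the origin, and \<open>operator_G\<close> equals 1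
  there. In the potential formula it enters as a constant in \<open>x\<close>.\<close>

definition gauge_constant :: "real \<Rightarrow> real \<Rightarrow> (real \<Rightarrow> real \<Rightarrow> real) \<Rightarrow> real" where
  "gauge_constant \<nu> R u = 1 - 1/2 * (LINT \<zeta>':{-1..1}|lborel. LINT r':{0..R}|lborel. (max 0 (u r' \<zeta>')) powr \<nu> * r')"

lemma operator_G_conv:
  assumes "u \<in> space_E R" "R > 0" "\<nu> > 0"
  shows "operator_G \<nu> R u (norm x) (x$3 / norm x) = gauge_constant \<nu> R u + 1 / (4 * pi) * conv (density \<nu> R u) newton x"
proof -
  obtain M where M: "\<And>y. \<bar>density \<nu> R u y\<bar> \<le> M" using density_bounded[OF assms] by blast
  have "(LINT \<zeta>':{-1..1}|lborel. LINT r':{0..R}|lborel.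
      kernel_K (norm x) (x$3 / norm x) r' \<zeta>' * (max 0 (u r' \<zeta>')) powr \<nu> * r'\<^sup>2) = conv (density \<nu> R u) newton x"
    by (rule kernel_K_integral[OF density_measurable[OF assms] M density_supp]) (simp_all add: density_def cartesian_def)
  then show ?thesis by (simp add: operator_G_def gauge_constant_def)
qed

lemma centrifugal_g_cartesian:
  "centrifugal_g (norm x) (x$3 / norm x) = 1/4 * ((x$1)\<^sup>2 + (x$2)\<^sup>2)" for x :: "real^3"
proof (cases "x = 0")
  case False
  then have "(1 - (x$3 / norm x)\<^sup>2) * (norm x)\<^sup>2 = (norm x)\<^sup>2 - (x$3)\<^sup>2"
    by (simp add: power_divide left_diff_distrib)
  then show ?thesis unfolding centrifugal_g_def norm_vector3 by (simp add: mult.assoc)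
qed (simp add: centrifugal_g_def)

section \<open>Comparison with the Lane-Emden function\<close>

locale distorted_lane_emden =
  fixes \<nu> R0 \<xi>1 \<epsilon>1 C1 :: real and \<theta> :: "real \<Rightarrow> real" and \<Theta> :: "real \<Rightarrow> real \<Rightarrow> real \<Rightarrow> real"
  assumes \<nu>: "2 \<le> \<nu>" and le: "lane_emden \<nu> \<xi>1 \<theta>" and R0: "R0 \<ge> 2 * \<xi>1"
    and fam: "distorted_lane_emden_family \<nu> R0 \<theta> \<epsilon>1 C1 \<Theta>"
begin

section \<open>Sign and continuity of the continued Lane-Emden function\<close>

lemma \<xi>1_pos: "0 < \<xi>1" and \<theta>_zero: "\<theta> \<xi>1 = 0"
  and \<theta>_cont_inner: "continuous_on {0..\<xi>1} \<theta>" and \<theta>_pos: "\<And>r. 0 \<le> r \<Longrightarrow> r < \<xi>1 \<Longrightarrow> \<theta> r > 0"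
  using le unfolding lane_emden_def by (auto simp: less_le)

lemma R0_pos: "R0 > 0" and \<xi>1_less_R0: "\<xi>1 < R0"
  using \<xi>1_pos R0 by auto

abbreviation "m \<equiv> lane_emden_mass \<nu> \<xi>1 \<theta>"

lemma \<theta>_outer: "r \<ge> \<xi>1 \<Longrightarrow> \<theta> r = - m * (1 / \<xi>1 - 1 / r)"
  using le \<theta>_zero unfolding lane_emden_def by (cases "r = \<xi>1") auto

lemma m_pos: "m > 0"
proof -
  define f where "f r = \<theta> r powr \<nu> * r\<^sup>2" for r
  have nonneg: "\<theta> r \<ge> 0" if "r \<in> {0..\<xi>1}" for r
    using that \<theta>_pos[of r] \<theta>_zero by (cases "r = \<xi>1") auto
  have cont: "continuous_on {0..\<xi>1} f"
    unfolding f_def[abs_def] using \<nu> nonneg by (intro continuous_intros continuous_on_powr' \<theta>_cont_inner) auto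
  have f0: "f r \<ge> 0" for r by (simp add: f_def)
  have "integral {0..\<xi>1} f \<noteq> 0"
  proof
    assume "integral {0..\<xi>1} f = 0"
    then have "\<forall>x\<in>{0..\<xi>1}. f x = 0" using integral_eq_0_iff[OF cont \<xi>1_pos] f0 by simp
    then have "f (\<xi>1 / 2) = 0" using \<xi>1_pos by simp
    then show False using \<theta>_pos[of "\<xi>1 / 2"] \<xi>1_pos by (simp add: f_def)
  qed
  moreover have "m = integral {0..\<xi>1} f"
    unfolding lane_emden_mass_def f_def[symmetric]
    by (rule set_borel_integral_eq_integral(2)) (rule borel_integrable_atLeastAtMost', rule cont)
  moreover have "integral {0..\<xi>1} f \<ge> 0" by (rule integral_nonneg[OF integrable_continuous_real[OF cont]]) (rule f0)
  ultimately show ?thesis by linarith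
qed

lemma \<theta>_neg: "r > \<xi>1 \<Longrightarrow> \<theta> r < 0"
  using \<theta>_outer[of r] m_pos \<xi>1_pos by (simp add: mult_pos_pos frac_less2)

lemma \<theta>_cont: "continuous_on {0..R0} \<theta>"
proof -
  have "continuous_on {\<xi>1..R0} (\<lambda>r. - m * (1 / \<xi>1 - 1 / r))"
    using \<xi>1_pos by (intro continuous_intros) auto
  then have "continuous_on {\<xi>1..R0} \<theta>"
    by (rule continuous_on_eq) (use \<theta>_outer in auto)
  moreover have "{0..R0} = {0..\<xi>1} \<union> {\<xi>1..R0}" using \<xi>1_pos \<xi>1_less_R0 by auto
  ultimately show ?thesis using \<theta>_cont_inner by (simp add: continuous_on_closed_Un)
qed

lemma \<theta>_space_E: "(\<lambda>r \<zeta>. \<theta> r) \<in> space_E R0"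
  unfolding space_E_def by (auto simp: case_prod_unfold intro!: continuous_on_compose2[OF \<theta>_cont] continuous_intros)

lemma cartesian_\<theta>: "cartesian (\<lambda>r \<zeta>. \<theta> r) x = \<theta> (norm x)"
  by (simp add: cartesian_def)

abbreviation "P0 \<equiv> density \<nu> R0 (\<lambda>r \<zeta>. \<theta> r)"
abbreviation "P \<epsilon> \<equiv> density \<nu> R0 (\<Theta> \<epsilon>)"
abbreviation "F \<epsilon> \<equiv> cartesian (extension \<nu> R0 \<epsilon> (\<Theta> \<epsilon>))"

lemma \<epsilon>1_pos: "\<epsilon>1 > 0" and C1_pos: "C1 > 0"
  using fam by (auto simp: distorted_lane_emden_family_def)

lemma \<Theta>_space_E: "0 < \<epsilon> \<Longrightarrow> \<epsilon> \<le> \<epsilon>1 \<Longrightarrow> \<Theta> \<epsilon> \<in> space_E R0"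
  using fam by (auto simp: distorted_lane_emden_family_def)

lemma \<nu>_pos: "\<nu> > 0" using \<nu> by simp

text \<open>In the ball this is the integral equation, outside it the definition of the extension. A
  single formula thus holds on all of space, and the sphere of radius \<open>R0\<close> is no
  exception for derivatives.\<close>

lemma F_potential:
  assumes "0 < \<epsilon>" "\<epsilon> \<le> \<epsilon>1"
  shows "F \<epsilon> x = gauge_constant \<nu> R0 (\<Theta> \<epsilon>) + \<epsilon> / 4 * ((x$1)\<^sup>2 + (x$2)\<^sup>2) + 1 / (4 * pi) * conv (P \<epsilon>) newton x"
proof -
  have "F \<epsilon> x = \<epsilon> * centrifugal_g (norm x) (x$3 / norm x) + operator_G \<nu> R0 (\<Theta> \<epsilon>) (norm x) (x$3 / norm x)"
    using fam assms cos_polar_in'[of x] unfolding distorted_lane_emden_family_def cartesian_def extension_def by simp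
  then show ?thesis
    unfolding operator_G_conv[OF \<Theta>_space_E[OF assms] R0_pos \<nu>_pos] centrifugal_g_cartesian by simp
qed

lemma F_inside: "norm x \<le> R0 \<Longrightarrow> F \<epsilon> x = cartesian (\<Theta> \<epsilon>) x"
  by (simp add: cartesian_def extension_def)

lemma \<Theta>_close:
  assumes "0 < \<epsilon>" "\<epsilon> \<le> \<epsilon>1" "norm x \<le> R0"
  shows "\<bar>F \<epsilon> x - \<theta> (norm x)\<bar> \<le> C1 * \<epsilon>"
proof -
  have cont: "continuous_on ({0..R0} \<times> {-1..1}) (\<lambda>(r, \<zeta>). \<bar>\<Theta> \<epsilon> r \<zeta> - \<theta> r\<bar>)"
  proof -
    have 1: "continuous_on ({0..R0} \<times> {-1..1}) (\<lambda>s. \<Theta> \<epsilon> (fst s) (snd s))"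
      using \<Theta>_space_E[OF assms(1,2)] unfolding space_E_def case_prod_unfold by blast
    have 2: "continuous_on ({0..R0} \<times> {-1..1}) (\<lambda>s :: real \<times> real. \<theta> (fst s))"
      by (rule continuous_on_compose2[OF \<theta>_cont]) (auto intro!: continuous_intros)
    show ?thesis unfolding case_prod_unfold by (intro continuous_intros 1 2)
  qed
  have "\<bar>\<Theta> \<epsilon> (norm x) (x$3 / norm x) - \<theta> (norm x)\<bar> \<le> norm_E R0 (\<lambda>r \<zeta>. \<Theta> \<epsilon> r \<zeta> - \<theta> r)"
  proof -
    have "bdd_above ((\<lambda>(r, \<zeta>). \<bar>\<Theta> \<epsilon> r \<zeta> - \<theta> r\<bar>) ` ({0..R0} \<times> {-1..1}))"
      by (intro bounded_imp_bdd_above compact_imp_bounded compact_continuous_image cont compact_Times) auto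
    moreover have "(norm x, x$3 / norm x) \<in> {0..R0} \<times> {-1..1}" using assms(3) cos_polar_in'[of x] by simp
    ultimately show ?thesis unfolding norm_E_def
      using cSUP_upper[of "(norm x, x$3 / norm x)" "{0..R0} \<times> {-1..1}" "\<lambda>(r, \<zeta>). \<bar>\<Theta> \<epsilon> r \<zeta> - \<theta> r\<bar>"] by simp
  qed
  also have "\<dots> \<le> C1 * \<epsilon>" using fam assms by (simp add: distorted_lane_emden_family_def)
  finally show ?thesis unfolding F_inside[OF assms(3)] by (simp add: cartesian_def)
qed

lemma density_close: "\<exists>L\<ge>0. \<forall>\<epsilon> y. 0 < \<epsilon> \<longrightarrow> \<epsilon> \<le> \<epsilon>1 \<longrightarrow> \<bar>P \<epsilon> y - P0 y\<bar> \<le> L * \<epsilon>"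
proof -
  obtain M where M: "M \<ge> 0" "\<And>y :: real^3. norm y \<le> R0 \<Longrightarrow> \<bar>\<theta> (norm y)\<bar> \<le> M"
    using cartesian_bounded[OF \<theta>_space_E R0_pos] unfolding cartesian_\<theta> by blast
  \<comment> \<open>A common upper bound for \<theta> and all \<open>F \<epsilon>\<close> on the
    ball, so that the Lipschitz constant of the power does not depend on \<epsilon>.\<close>
  define K where "K = M + C1 * \<epsilon>1"
  define L where "L = \<nu> * K powr (\<nu> - 1) * C1"
  have K: "K \<ge> 0" using M(1) C1_pos \<epsilon>1_pos by (simp add: K_def)
  have L: "L \<ge> 0" using \<nu> C1_pos by (simp add: L_def)
  have "\<bar>P \<epsilon> y - P0 y\<bar> \<le> L * \<epsilon>" if \<epsilon>: "0 < \<epsilon>" "\<epsilon> \<le> \<epsilon>1" for \<epsilon> y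
  proof (cases "norm y \<le> R0")
    case True
    have close: "\<bar>F \<epsilon> y - \<theta> (norm y)\<bar> \<le> C1 * \<epsilon>" by (rule \<Theta>_close[OF \<epsilon> True])
    have "C1 * \<epsilon> \<le> C1 * \<epsilon>1" using C1_pos \<epsilon> by simp
    then have "F \<epsilon> y \<le> K" "\<theta> (norm y) \<le> K" using M(2)[OF True] close \<epsilon>1_pos C1_pos \<epsilon> unfolding K_def by (smt (verit) mult_pos_pos)+
    then have "\<bar>max 0 (F \<epsilon> y) powr \<nu> - max 0 (\<theta> (norm y)) powr \<nu>\<bar> \<le> \<nu> * K powr (\<nu> - 1) * \<bar>F \<epsilon> y - \<theta> (norm y)\<bar>"
      using \<nu> K by (intro pos_part_powr_lipschitz) auto
    also have "\<dots> \<le> \<nu> * K powr (\<nu> - 1) * (C1 * \<epsilon>)" using close \<nu> by (intro mult_left_mono) auto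
    finally show ?thesis using True by (simp add: density_def cartesian_\<theta> F_inside L_def mult.assoc)
  next
    case False
    then show ?thesis using L \<epsilon> by (simp add: density_def)
  qed
  then show ?thesis using L by blast
qed

lemmas P0_meas = density_measurable[OF \<theta>_space_E R0_pos \<nu>_pos]
lemmas P_meas = density_measurable[OF \<Theta>_space_E R0_pos \<nu>_pos]

text \<open>The kernel is left arbitrary: \<open>newton\<close> will carry the integral equation to
  the limit, and \<open>newton_grad\<close> will compare the gradients. Points and supports both lie
  within radius \<open>R0\<close>, hence the mass on radius \<open>R0 + R0\<close>.\<close>

lemma conv_density_close:
  fixes k :: "real^3 \<Rightarrow> 'b::{banach, second_countable_topology}"
  assumes k: "locally_integrable k"
  shows "\<exists>K\<ge>0. \<forall>\<epsilon> x. 0 < \<epsilon> \<longrightarrow> \<epsilon> \<le> \<epsilon>1 \<longrightarrow> norm x \<le> R0 \<longrightarrow> norm (conv (P \<epsilon>) k x - conv P0 k x) \<le> K * \<epsilon>"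
proof -
  obtain L where L: "L \<ge> 0" "\<And>\<epsilon> y. 0 < \<epsilon> \<Longrightarrow> \<epsilon> \<le> \<epsilon>1 \<Longrightarrow> \<bar>P \<epsilon> y - P0 y\<bar> \<le> L * \<epsilon>"
    using density_close by blast
  obtain M0 where M0: "\<And>y. \<bar>P0 y\<bar> \<le> M0" using density_bounded[OF \<theta>_space_E R0_pos \<nu>_pos] by blast
  have "norm (conv (P \<epsilon>) k x - conv P0 k x) \<le> (L * kernel_mass k (R0 + R0)) * \<epsilon>"
    if \<epsilon>: "0 < \<epsilon>" "\<epsilon> \<le> \<epsilon>1" and x: "norm x \<le> R0" for \<epsilon> x
  proof -
    obtain M where M: "\<And>y. \<bar>P \<epsilon> y\<bar> \<le> M" using density_bounded[OF \<Theta>_space_E[OF \<epsilon>] R0_pos \<nu>_pos] by blast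
    have "conv (P \<epsilon>) k x - conv P0 k x = conv (\<lambda>y. P \<epsilon> y - P0 y) k x"
      by (rule conv_diff_density[OF k P_meas[OF \<epsilon>] M density_supp P0_meas M0 density_supp, symmetric])
    also have "norm \<dots> \<le> L * \<epsilon> * kernel_mass k (R0 + R0)"
      by (rule conv_bound[OF k _ L(2)[OF \<epsilon>], where R=R0])
         (use P_meas[OF \<epsilon>] P0_meas x in \<open>auto simp: density_supp\<close>)
    finally show ?thesis by (simp add: mult_ac)
  qed
  then show ?thesis using L(1) kernel_mass_nonneg[of k "R0 + R0"] by (intro exI[of _ "L * kernel_mass k (R0 + R0)"]) auto
qed

text \<open>Letting \<open>\<epsilon>\<close> tend to \<open>0\<close> in the integral equation gives the integral equation of \<open>\<theta>\<close> without any use of the differential equation.\<close>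

lemma \<theta>_potential:
  "\<exists>c. \<forall>x. norm x \<le> R0 \<longrightarrow> \<theta> (norm x) = c + 1 / (4 * pi) * conv P0 newton x"
proof -
  obtain K where K: "K \<ge> 0" "\<And>\<epsilon> x. 0 < \<epsilon> \<Longrightarrow> \<epsilon> \<le> \<epsilon>1 \<Longrightarrow> norm x \<le> R0 \<Longrightarrow>
      norm (conv (P \<epsilon>) newton x - conv P0 newton x) \<le> K * \<epsilon>"
    using conv_density_close[OF locally_integrable_newton] by blast
  define H where "H = C1 + R0\<^sup>2 / 4 + 1 / (4 * pi) * K"
  have H: "H > 0" using C1_pos K(1) by (simp add: H_def add_pos_nonneg)
  define d where "d x = \<theta> (norm x) - 1 / (4 * pi) * conv P0 newton x" for x :: "real^3"
  \<comment> \<open>The gauge constant depends on \<epsilon> alone and \<open>d x\<close> on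
    \<open>x\<close> alone. Being within \<open>H * \<epsilon>\<close> of each other for all small
    \<epsilon>, they force \<open>d\<close> to be constant on the ball.\<close>
  have close: "\<bar>gauge_constant \<nu> R0 (\<Theta> \<epsilon>) - d x\<bar> \<le> H * \<epsilon>" if \<epsilon>: "0 < \<epsilon>" "\<epsilon> \<le> \<epsilon>1" and x: "norm x \<le> R0" for \<epsilon> x
  proof -
    have "(x$1)\<^sup>2 + (x$2)\<^sup>2 \<le> (norm x)\<^sup>2" unfolding norm_vector3 by simp
    also have "\<dots> \<le> R0\<^sup>2" using x by (intro power_mono) auto
    finally have "\<epsilon> / 4 * ((x$1)\<^sup>2 + (x$2)\<^sup>2) \<le> \<epsilon> / 4 * R0\<^sup>2" using \<epsilon> by (intro mult_left_mono) auto
    moreover have "0 \<le> \<epsilon> / 4 * ((x$1)\<^sup>2 + (x$2)\<^sup>2)" using \<epsilon> by simp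
    moreover have "\<bar>1 / (4 * pi) * conv (P \<epsilon>) newton x - 1 / (4 * pi) * conv P0 newton x\<bar> \<le> 1 / (4 * pi) * (K * \<epsilon>)"
    proof -
      have "\<bar>1 / (4 * pi) * conv (P \<epsilon>) newton x - 1 / (4 * pi) * conv P0 newton x\<bar>
        = 1 / (4 * pi) * norm (conv (P \<epsilon>) newton x - conv P0 newton x)"
        by (simp add: abs_mult flip: right_diff_distrib diff_divide_distrib)
      also have "\<dots> \<le> 1 / (4 * pi) * (K * \<epsilon>)" using K(2)[OF \<epsilon> x] by (intro mult_left_mono) auto
      finally show ?thesis .
    qed
    moreover note \<Theta>_close[OF \<epsilon> x] F_potential[OF \<epsilon>, of x]
    moreover have "H * \<epsilon> = C1 * \<epsilon> + \<epsilon> / 4 * R0\<^sup>2 + 1 / (4 * pi) * (K * \<epsilon>)" by (simp add: H_def algebra_simps)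
    ultimately show ?thesis unfolding d_def by linarith
  qed
  have "d x = d 0" if x: "norm x \<le> R0" for x
  proof (rule ccontr)
    assume "d x \<noteq> d 0"
    define t where "t = \<bar>d x - d 0\<bar>"
    have t: "t > 0" using \<open>d x \<noteq> d 0\<close> by (simp add: t_def)
    \<comment> \<open>With this choice two values of \<open>d\<close> differ by at most
      \<open>2 * (H * \<epsilon>) \<le> t / 2\<close>.\<close>
    define \<epsilon> where "\<epsilon> = min \<epsilon>1 (t / (4 * H))"
    have \<epsilon>: "0 < \<epsilon>" "\<epsilon> \<le> \<epsilon>1" "\<epsilon> \<le> t / (4 * H)" using \<epsilon>1_pos t H by (simp_all add: \<epsilon>_def)
    have "t \<le> 2 * (H * \<epsilon>)"
      using close[OF \<epsilon>(1,2) x] close[OF \<epsilon>(1,2), of 0] R0_pos unfolding t_def by simp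
    also have "\<dots> \<le> 2 * (H * (t / (4 * H)))" using \<epsilon>(3) H by (intro mult_left_mono) auto
    also have "\<dots> = t / 2" using H by simp
    finally show False using t by simp
  qed
  then show ?thesis unfolding d_def by (intro exI[of _ "d 0"]) (force simp: d_def)
qed

text \<open>To be identified as the gradient of \<open>\<theta> (norm x)\<close>. As a convolution
  with a continuous density it is continuous everywhere, also across the sphere of radius
  \<xi>1.\<close>

definition E0 :: "real^3 \<Rightarrow> real^3" where
  "E0 x = (1 / (4 * pi)) *\<^sub>R conv P0 newton_grad x"

lemma contP0: "continuous_on UNIV P0"
  using \<theta>_neg[of R0] \<xi>1_less_R0 by (intro density_continuous \<theta>_space_E R0_pos \<nu>_pos) (simp add: cartesian_\<theta>)

lemma contE0: "continuous_on UNIV E0"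
  unfolding E0_def[abs_def]
  by (intro continuous_intros conv_continuous[OF locally_integrable_newton_grad contP0 density_supp])

text \<open>The potential formula holds in a neighbourhood of each such point, including the origin
  and the points of the sphere of radius \<xi>1, where no derivative of \<theta> is assumed.\<close>

lemma T_interior:
  assumes "norm x < R0"
  shows "(cartesian (\<lambda>r \<zeta>. \<theta> r) has_derivative (\<lambda>h. E0 x \<bullet> h)) (at x)"
proof -
  obtain c where c: "\<And>x :: real^3. norm x \<le> R0 \<Longrightarrow> \<theta> (norm x) = c + 1 / (4 * pi) * conv P0 newton x"
    using \<theta>_potential by blast
  obtain M0 where M0: "\<And>y. \<bar>P0 y\<bar> \<le> M0" using density_bounded[OF \<theta>_space_E R0_pos \<nu>_pos] by blast
  have "((\<lambda>x. c + 1 / (4 * pi) * conv P0 newton x) has_derivative (\<lambda>h. E0 x \<bullet> h)) (at x)"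
    by (rule has_derivative_eq_rhs[OF has_derivative_add[OF has_derivative_const has_derivative_mult_right[OF
            newton_potential_has_derivative[OF P0_meas M0 density_supp]]]])
       (auto simp: fun_eq_iff E0_def)
  then show ?thesis
    by (rule has_derivative_transform_within_open[of _ _ _ _ "ball 0 R0"]) (use assms c in \<open>auto simp: cartesian_\<theta>\<close>)
qed

lemma T_exterior:
  assumes "norm x > \<xi>1"
  shows "(cartesian (\<lambda>r \<zeta>. \<theta> r) has_derivative (\<lambda>h. (m *\<^sub>R newton_grad x) \<bullet> h)) (at x)"
proof -
  have "x \<noteq> 0" using assms \<xi>1_pos by auto
  then have "((\<lambda>x. - m / \<xi>1 + m * newton x) has_derivative (\<lambda>h. (m *\<^sub>R newton_grad x) \<bullet> h)) (at x)"
    by (intro has_derivative_eq_rhs[OF has_derivative_add[OF has_derivative_const has_derivative_mult_right[OF newton_has_derivative]]])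
       (auto simp: fun_eq_iff)
  then show ?thesis
  proof (rule has_derivative_transform_within_open[of _ _ _ _ "- cball 0 \<xi>1"])
    show "- m / \<xi>1 + m * newton y = cartesian (\<lambda>r \<zeta>. \<theta> r) y" if "y \<in> - cball 0 \<xi>1" for y
      using that \<theta>_outer[of "norm y"] by (simp add: cartesian_\<theta> newton_def algebra_simps)
  qed (use assms in auto)
qed

text \<open>In the open shell both sides are gradients of the same function. Continuity carries the
  identity to the two boundary spheres: radius \<xi>1 gives the slope at the surface, radius
  \<open>R0\<close> the derivative at the edge of the ball.\<close>

lemma E0_exterior:
  assumes "\<xi>1 \<le> norm x" "norm x \<le> R0"
  shows "E0 x = m *\<^sub>R newton_grad x"
proof -
  define e where "e = (1 / norm x) *\<^sub>R x"
  have x: "x \<noteq> 0" using assms \<xi>1_pos by auto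
  have e: "norm e = 1" and xe: "norm x *\<^sub>R e = x" using x by (simp_all add: e_def)
  define g where "g t = E0 (t *\<^sub>R e) - m *\<^sub>R newton_grad (t *\<^sub>R e)" for t
  have cl: "closure {\<xi>1<..<R0} = {\<xi>1..R0}" using \<xi>1_less_R0 by simp
  have "g (norm x) = 0"
  proof (rule continuous_constant_on_closure[of "{\<xi>1<..<R0}"])
    show "continuous_on (closure {\<xi>1<..<R0}) g"
      unfolding cl g_def[abs_def] newton_grad_def[abs_def] using \<xi>1_pos x
      by (intro continuous_intros continuous_on_compose2[OF contE0]) (auto simp: e_def)
    show "g t = 0" if "t \<in> {\<xi>1<..<R0}" for t
    proof -
      have n: "norm (t *\<^sub>R e) = t" using that \<xi>1_pos e by simp
      have "(\<lambda>h. E0 (t *\<^sub>R e) \<bullet> h) = (\<lambda>h. (m *\<^sub>R newton_grad (t *\<^sub>R e)) \<bullet> h)"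
        by (rule has_derivative_unique[OF T_interior T_exterior]) (use that n in auto)
      then have "E0 (t *\<^sub>R e) \<bullet> g t = (m *\<^sub>R newton_grad (t *\<^sub>R e)) \<bullet> g t" by (rule fun_cong)
      then have "g t \<bullet> g t = 0" unfolding g_def by (simp add: inner_diff_left)
      then show ?thesis by simp
    qed
    show "norm x \<in> closure {\<xi>1<..<R0}" using assms cl by simp
  qed
  then show ?thesis by (simp add: g_def xe)
qed

lemma T_has_derivative:
  assumes "norm x \<le> R0"
  shows "(cartesian (\<lambda>r \<zeta>. \<theta> r) has_derivative (\<lambda>h. E0 x \<bullet> h)) (at x)"
proof (cases "norm x < R0")
  case True then show ?thesis by (rule T_interior)
next
  \<comment> \<open>On the sphere of radius \<open>R0\<close> the potential formula for \<theta> is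
    known from one side only, while the exterior formula holds on both.\<close>
  case False
  then have "norm x = R0" using assms by simp
  then show ?thesis using T_exterior[of x] E0_exterior[of x] \<xi>1_less_R0 by simp
qed

section \<open>Quantitative estimates for small \<epsilon>\<close>

lemma gradient_close:
  "\<exists>K\<ge>0. \<forall>\<epsilon> x. 0 < \<epsilon> \<longrightarrow> \<epsilon> \<le> \<epsilon>1 \<longrightarrow> norm x \<le> R0 \<longrightarrow> norm (rotating_grad \<epsilon> (P \<epsilon>) x - E0 x) \<le> K * \<epsilon>"
proof -
  obtain K where K: "K \<ge> 0" "\<And>\<epsilon> x. 0 < \<epsilon> \<Longrightarrow> \<epsilon> \<le> \<epsilon>1 \<Longrightarrow> norm x \<le> R0 \<Longrightarrow>
      norm (conv (P \<epsilon>) newton_grad x - conv P0 newton_grad x) \<le> K * \<epsilon>"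
    using conv_density_close[OF locally_integrable_newton_grad] by blast
  define H where "H = R0 / 2 + 1 / (4 * pi) * K"
  have "norm (rotating_grad \<epsilon> (P \<epsilon>) x - E0 x) \<le> H * \<epsilon>" if \<epsilon>: "0 < \<epsilon>" "\<epsilon> \<le> \<epsilon>1" and x: "norm x \<le> R0" for \<epsilon> x
  proof -
    have eq: "rotating_grad \<epsilon> (P \<epsilon>) x - E0 x = (\<epsilon> / 2) *\<^sub>R horizontal x + (1 / (4 * pi)) *\<^sub>R (conv (P \<epsilon>) newton_grad x - conv P0 newton_grad x)"
      by (simp add: rotating_grad_def E0_def scaleR_diff_right)
    have 1: "norm ((\<epsilon> / 2) *\<^sub>R horizontal x) \<le> \<epsilon> / 2 * R0"
      unfolding norm_scaleR using \<epsilon> x norm_horizontal_le[of x] by (intro mult_mono) auto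
    have 2: "norm ((1 / (4 * pi)) *\<^sub>R (conv (P \<epsilon>) newton_grad x - conv P0 newton_grad x)) \<le> 1 / (4 * pi) * (K * \<epsilon>)"
      unfolding norm_scaleR using K(2)[OF \<epsilon> x] by (intro mult_mono) auto
    have "norm (rotating_grad \<epsilon> (P \<epsilon>) x - E0 x) \<le> \<epsilon> / 2 * R0 + 1 / (4 * pi) * (K * \<epsilon>)"
      unfolding eq by (rule order_trans[OF norm_triangle_ineq add_mono[OF 1 2]])
    also have "\<dots> = H * \<epsilon>" by (simp add: H_def algebra_simps)
    finally show ?thesis .
  qed
  moreover have "H \<ge> 0" using K(1) R0_pos by (simp add: H_def)
  ultimately show ?thesis by blast
qed

text \<open>On the sphere of radius \<xi>1 the inner product equals \<open>- m / \<xi>1\<close>;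
  uniform continuity preserves more than half of it in a thin shell.\<close>

lemma E0_shell:
  "\<exists>\<delta>>0. 2 * \<delta> < \<xi>1 \<and> (\<forall>x. \<xi>1 - \<delta> \<le> norm x \<longrightarrow> norm x \<le> \<xi>1 + \<delta> \<longrightarrow> E0 x \<bullet> x < - (m / (2 * \<xi>1)))"
proof -
  have "uniformly_continuous_on (cball 0 R0) (\<lambda>x. E0 x \<bullet> x)"
    by (intro compact_uniformly_continuous continuous_intros continuous_on_subset[OF contE0]) auto
  moreover have pos: "m / (2 * \<xi>1) > 0" using m_pos \<xi>1_pos by simp
  ultimately obtain d where d: "d > 0" "\<And>x y. x \<in> cball 0 R0 \<Longrightarrow> y \<in> cball 0 R0 \<Longrightarrow> dist y x < d \<Longrightarrow>
      dist (E0 y \<bullet> y) (E0 x \<bullet> x) < m / (2 * \<xi>1)"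
    unfolding uniformly_continuous_on_def by metis
  \<comment> \<open>\<open>d / 2\<close> makes \<delta> strictly smaller than \<open>d\<close>, and
    \<open>\<xi>1 / 3\<close> gives \<open>2 * \<delta> < \<xi>1\<close>.\<close>
  define \<delta> where "\<delta> = min (d / 2) (\<xi>1 / 3)"
  have \<delta>: "\<delta> > 0" "2 * \<delta> < \<xi>1" "\<delta> < d" using d(1) \<xi>1_pos by (auto simp: \<delta>_def min_def)
  have "E0 x \<bullet> x < - (m / (2 * \<xi>1))" if x: "\<xi>1 - \<delta> \<le> norm x" "norm x \<le> \<xi>1 + \<delta>" for x
  proof -
    have nx: "norm x > 0" using x \<delta> by linarith
    \<comment> \<open>The comparison point is the radial projection of \<open>x\<close> to the
      sphere of radius \<xi>1; its distance from \<open>x\<close> is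
      \<open>|\<xi>1 - norm x|\<close>.\<close>
    define y where "y = (\<xi>1 / norm x) *\<^sub>R x"
    have ny: "norm y = \<xi>1" using nx \<xi>1_pos by (simp add: y_def)
    have "y - x = (\<xi>1 / norm x - 1) *\<^sub>R x" by (simp add: y_def algebra_simps)
    then have "norm (y - x) = \<bar>\<xi>1 / norm x - 1\<bar> * norm x" by simp
    also have "\<dots> = \<bar>(\<xi>1 / norm x - 1) * norm x\<bar>" by (simp add: abs_mult)
    also have "(\<xi>1 / norm x - 1) * norm x = \<xi>1 - norm x" using nx by (simp add: left_diff_distrib)
    also have "\<bar>\<xi>1 - norm x\<bar> < d" using x \<delta> by linarith
    finally have "dist (E0 x \<bullet> x) (E0 y \<bullet> y) < m / (2 * \<xi>1)"
      using x \<delta> R0 ny \<xi>1_less_R0 by (intro d(2)) (auto simp: dist_norm norm_minus_commute)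
    moreover have "E0 y \<bullet> y = - (m / \<xi>1)"
      using E0_exterior[of y] ny \<xi>1_less_R0 \<xi>1_pos
      by (simp add: newton_grad_def power3_eq_cube power2_eq_square flip: power2_norm_eq_inner)
    moreover have "m / \<xi>1 = 2 * (m / (2 * \<xi>1))" by simp
    ultimately show ?thesis unfolding dist_real_def by linarith
  qed
  then show ?thesis using \<delta> by blast
qed

text \<open>Inside, a positive continuous function attains its minimum on a compact interval;
  outside, the explicit formula is decreasing, so its largest value is taken at
  \<open>\<xi>1 + \<delta>\<close>.\<close>

lemma \<theta>_away_from_zero:
  assumes \<delta>: "0 < \<delta>" "\<delta> < \<xi>1"
  shows "\<exists>\<eta>>0. (\<forall>r. 0 \<le> r \<longrightarrow> r \<le> \<xi>1 - \<delta> \<longrightarrow> \<eta> \<le> \<theta> r) \<and> (\<forall>r. \<xi>1 + \<delta> \<le> r \<longrightarrow> \<theta> r \<le> - \<eta>)"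
proof -
  have "\<exists>x\<in>{0..\<xi>1 - \<delta>}. \<forall>y\<in>{0..\<xi>1 - \<delta>}. \<theta> x \<le> \<theta> y"
    by (rule continuous_attains_inf) (use \<delta> in \<open>auto intro!: continuous_on_subset[OF \<theta>_cont_inner]\<close>)
  then obtain s where s: "s \<in> {0..\<xi>1 - \<delta>}" "\<And>y. y \<in> {0..\<xi>1 - \<delta>} \<Longrightarrow> \<theta> s \<le> \<theta> y" by blast
  define \<eta> where "\<eta> = min (\<theta> s) (- \<theta> (\<xi>1 + \<delta>))"
  have "\<eta> > 0" using \<theta>_pos[of s] s(1) \<delta> \<theta>_neg[of "\<xi>1 + \<delta>"] by (simp add: \<eta>_def)
  moreover have "\<theta> r \<le> - \<eta>" if "\<xi>1 + \<delta> \<le> r" for r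
  proof -
    have "1 / r \<le> 1 / (\<xi>1 + \<delta>)" using that \<delta> \<xi>1_pos by (simp add: frac_le)
    then have "m * (1 / \<xi>1 - 1 / (\<xi>1 + \<delta>)) \<le> m * (1 / \<xi>1 - 1 / r)" using m_pos by (intro mult_left_mono) auto
    then have "\<theta> r \<le> \<theta> (\<xi>1 + \<delta>)" using \<theta>_outer[of r] \<theta>_outer[of "\<xi>1 + \<delta>"] that \<delta> by simp
    then show ?thesis by (simp add: \<eta>_def)
  qed
  ultimately show ?thesis using s(2) by (intro exI[of _ \<eta>]) (auto simp: \<eta>_def intro: min.coboundedI1)
qed

lemma ray_value:
  assumes \<epsilon>: "0 < \<epsilon>" "\<epsilon> \<le> \<epsilon>1" and r: "r \<in> {0..R0}" "\<zeta> \<in> {-1..1}"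
  shows "\<Theta> \<epsilon> r \<zeta> = F \<epsilon> (r *\<^sub>R meridian \<zeta>)"
proof -
  have "norm (meridian \<zeta>) = 1" using r(2) by (intro norm_meridian) auto
  then have n: "norm (r *\<^sub>R meridian \<zeta>) = r" using r(1) by simp
  then have "F \<epsilon> (r *\<^sub>R meridian \<zeta>) = cartesian (\<Theta> \<epsilon>) (r *\<^sub>R meridian \<zeta>)"
    using r(1) by (intro F_inside) (simp only: n atLeastAtMost_iff)
  then have *: "F \<epsilon> (r *\<^sub>R meridian \<zeta>) = \<Theta> \<epsilon> r (r * \<zeta> / r)" unfolding cartesian_def n by simp
  show ?thesis
  proof (cases "r = 0")
    \<comment> \<open>At the origin the polar cosine evaluates to 0 whatever \<zeta> is, hence the
      appeal to the independence of \<zeta> at \<open>r = 0\<close>.\<close>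
    case True
    have "\<Theta> \<epsilon> 0 \<zeta> = \<Theta> \<epsilon> 0 0" using \<Theta>_space_E[OF \<epsilon>] r(2) unfolding space_E_def by blast
    then show ?thesis using * True by simp
  qed (use * in simp)
qed

end

theorem theorem2:
  fixes \<nu> R0 \<xi>1 \<epsilon>1 C1 :: real
    and \<theta> :: "real \<Rightarrow> real"
    and \<Theta> :: "real \<Rightarrow> real \<Rightarrow> real \<Rightarrow> real"
  assumes "2 \<le> \<nu>" and "\<nu> < 5"
    and "lane_emden \<nu> \<xi>1 \<theta>"
    and "R0 \<ge> 2 * \<xi>1"
    and "distorted_lane_emden_family \<nu> R0 \<theta> \<epsilon>1 C1 \<Theta>"
  shows "\<exists>\<epsilon>0 C. 0 < \<epsilon>0 \<and> \<epsilon>0 \<le> \<epsilon>1 \<and> C > 0 \<and>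
    (\<forall>\<epsilon>. 0 < \<epsilon> \<and> \<epsilon> \<le> \<epsilon>0 \<longrightarrow>
      (let F = cartesian (extension \<nu> R0 \<epsilon> (\<Theta> \<epsilon>));
           T = cartesian (\<lambda>r \<zeta>. \<theta> r);
           B = cball (0 :: real^3) R0;
           D = {x \<in> B. F x > 0}
       in
        ((\<exists>U. open U \<and> B \<subseteq> U \<and> (\<forall>x\<in>U. F differentiable (at x))) \<and>
         continuous_on B (grad F) \<and>
         (\<forall>x\<in>B. T differentiable (at x) \<and> norm (grad F x - grad T x) \<le> C * \<epsilon>) \<and>
         (\<forall>x\<in>B. grad F differentiable (at x)) \<and>
         (\<forall>i j. holder_continuous_on B (partial_deriv j (partial_deriv i F)))) \<and>
        ((\<forall>\<zeta>\<in>{-1..1}. \<exists>!X. surface_radius (\<Theta> \<epsilon>) \<xi>1 \<zeta> X) \<and>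
         (\<lambda>\<zeta>. THE X. surface_radius (\<Theta> \<epsilon>) \<xi>1 \<zeta> X) C1_differentiable_on {-1<..<1}) \<and>
        (\<forall>p\<in>frontier D.
           (\<exists>!N. unit_outer_normal D p N) \<and>
           (\<forall>N. unit_outer_normal D p N \<longrightarrow>
              ((\<lambda>t. F (p + t *\<^sub>R N)) has_real_derivative grad F p \<bullet> N) (at 0) \<and>
              grad F p \<bullet> N < 0)) \<and>
        (frontier D = {x \<in> B. F x = 0} \<and>
         C1_submanifold 2 (frontier D))))"
proof -
  interpret distorted_lane_emden \<nu> R0 \<xi>1 \<epsilon>1 C1 \<theta> \<Theta>
    by unfold_locales (use assms in auto)
  obtain K where K: "K \<ge> 0" and grad_close: "\<And>\<epsilon> x. 0 < \<epsilon> \<Longrightarrow> \<epsilon> \<le> \<epsilon>1 \<Longrightarrow> norm x \<le> R0 \<Longrightarrow>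
      norm (rotating_grad \<epsilon> (P \<epsilon>) x - E0 x) \<le> K * \<epsilon>"
    using gradient_close by blast
  obtain \<delta> where \<delta>: "0 < \<delta>" "2 * \<delta> < \<xi>1"
    and shell: "\<And>x. \<xi>1 - \<delta> \<le> norm x \<Longrightarrow> norm x \<le> \<xi>1 + \<delta> \<Longrightarrow> E0 x \<bullet> x < - (m / (2 * \<xi>1))"
    using E0_shell by blast
  obtain \<eta> where \<eta>: "\<eta> > 0" "\<And>r. 0 \<le> r \<Longrightarrow> r \<le> \<xi>1 - \<delta> \<Longrightarrow> \<eta> \<le> \<theta> r" "\<And>r. \<xi>1 + \<delta> \<le> r \<Longrightarrow> \<theta> r \<le> - \<eta>"
    using \<theta>_away_from_zero[of \<delta>] \<delta> by auto
  define \<kappa> where "\<kappa> = m / (2 * \<xi>1)"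
  have \<kappa>: "\<kappa> > 0" using m_pos \<xi>1_pos by (simp add: \<kappa>_def)
  \<comment> \<open>The summand 1 ensures that the constant is positive.\<close>
  define C where "C = K + 1"
  have C: "C > 0" using K by (simp add: C_def)
  \<comment> \<open>The first quotient gives \<open>C1 * \<epsilon> < \<eta>\<close>, so
    \<open>F \<epsilon>\<close> has the sign of \<theta> off the shell. The second gives
    \<open>C * \<epsilon> * R0 \<le> \<kappa>\<close>, so the change of the gradient cannot
    compensate \<open>E0 x \<bullet> x\<close>, which is below \<open>- \<kappa>\<close> in the
    shell.\<close>
  define \<epsilon>0 where "\<epsilon>0 = min \<epsilon>1 (min (\<eta> / (2 * C1)) (\<kappa> / (C * R0)))"
  have \<epsilon>0: "0 < \<epsilon>0" "\<epsilon>0 \<le> \<epsilon>1" "\<epsilon>0 \<le> \<eta> / (2 * C1)" "\<epsilon>0 \<le> \<kappa> / (C * R0)"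
    using \<epsilon>1_pos \<eta>(1) C1_pos \<kappa> C R0_pos by (auto simp: \<epsilon>0_def)
  show ?thesis
    unfolding Let_def
  proof (rule exI[of _ \<epsilon>0], rule exI[of _ C], intro conjI allI impI ballI)
    fix \<epsilon> assume "0 < \<epsilon> \<and> \<epsilon> \<le> \<epsilon>0"
    then have \<epsilon>: "0 < \<epsilon>" "\<epsilon> \<le> \<epsilon>1" "C1 * \<epsilon> < \<eta>" "C * \<epsilon> * R0 \<le> \<kappa>"
    proof -
      assume *: "0 < \<epsilon> \<and> \<epsilon> \<le> \<epsilon>0"
      have "C1 * \<epsilon> \<le> C1 * (\<eta> / (2 * C1))" using * \<epsilon>0(3) C1_pos by (intro mult_left_mono) auto
      also have "\<dots> < \<eta>" using C1_pos \<eta>(1) by simp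
      finally show "C1 * \<epsilon> < \<eta>" .
      have "C * R0 * \<epsilon> \<le> C * R0 * (\<kappa> / (C * R0))" using * \<epsilon>0(4) C R0_pos by (intro mult_left_mono) auto
      then show "C * \<epsilon> * R0 \<le> \<kappa>" using C R0_pos by (simp add: mult_ac)
    qed (use \<epsilon>0(2) in auto)
    let ?G = "rotating_grad \<epsilon> (P \<epsilon>)"
    have close: "norm (?G x - E0 x) \<le> C * \<epsilon>" if "norm x \<le> R0" for x
      using grad_close[OF \<epsilon>(1,2) that] \<epsilon>(1) by (simp add: C_def distrib_right)
    have outside: "F \<epsilon> x < 0" if "\<xi>1 + \<delta> \<le> norm x" "norm x \<le> R0" for x
      using \<Theta>_close[OF \<epsilon>(1,2) that(2)] \<eta>(3)[OF that(1)] \<epsilon>(3) by linarith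
    obtain M where M: "\<And>y. \<bar>P \<epsilon> y\<bar> \<le> M" using density_bounded[OF \<Theta>_space_E[OF \<epsilon>(1,2)] R0_pos \<nu>_pos] by blast
    interpret star: rotating_star \<nu> R0 "\<xi>1 + \<delta>" "gauge_constant \<nu> R0 (\<Theta> \<epsilon>)" \<epsilon> M "F \<epsilon>" "P \<epsilon>"
    proof
      show "P \<epsilon> y = (if norm y \<le> R0 then max 0 (F \<epsilon> y) powr \<nu> else 0)" for y
        by (simp add: density_def F_inside)
    qed (use \<nu> \<xi>1_pos \<delta> R0 M outside F_potential[OF \<epsilon>(1,2)] P_meas[OF \<epsilon>(1,2)] in auto)
    interpret surface: nearly_spherical R0 \<xi>1 \<delta> "F \<epsilon>" ?G "\<Theta> \<epsilon>"
    proof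
      show "F \<epsilon> x > 0" if "norm x \<le> \<xi>1 - \<delta>" for x
      proof -
        have "norm x \<le> R0" using that \<delta> \<xi>1_less_R0 by linarith
        from \<Theta>_close[OF \<epsilon>(1,2) this] show ?thesis using \<eta>(2)[OF _ that] \<epsilon>(3) by (simp add: abs_le_iff)
      qed
      show "?G x \<bullet> x < 0" if x: "\<xi>1 - \<delta> \<le> norm x" "norm x \<le> \<xi>1 + \<delta>" for x
      proof -
        have nx: "norm x \<le> R0" using x \<delta> R0 by linarith
        have "\<bar>(?G x - E0 x) \<bullet> x\<bar> \<le> (C * \<epsilon>) * R0"
          using close[OF nx] nx C \<epsilon>(1)
          by (intro order_trans[OF Cauchy_Schwarz_ineq2] mult_mono) auto
        then show ?thesis using shell[OF x] \<epsilon>(4) unfolding \<kappa>_def inner_diff_left by linarith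
      qed
    qed (use R0 \<delta> star.F_der star.contG outside ray_value[OF \<epsilon>(1,2)] in auto)
    have T: "grad (cartesian (\<lambda>r \<zeta>. \<theta> r)) x = E0 x" if "x \<in> cball 0 R0" for x
      using that by (intro grad_eq T_has_derivative) simp
    have T': "cartesian (\<lambda>r \<zeta>. \<theta> r) differentiable (at x)" if "x \<in> cball 0 R0" for x
      using that T_has_derivative[of x] by (auto simp: differentiable_def)
    have G_diff: "?G differentiable (at x)" for x
      using star.G_der unfolding differentiable_def by blast
    have F_diff: "F \<epsilon> differentiable (at x)" for x
      using star.F_der unfolding differentiable_def by blast
    show "\<exists>U. open U \<and> cball 0 R0 \<subseteq> U \<and> (\<forall>x\<in>U. F \<epsilon> differentiable (at x))"
      using F_diff by (intro exI[of _ UNIV]) auto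
    show "continuous_on (cball 0 R0) (grad (F \<epsilon>))"
      unfolding star.grad_F by (rule continuous_on_subset[OF star.contG]) simp
    show "cartesian (\<lambda>r \<zeta>. \<theta> r) differentiable (at x)" if "x \<in> cball 0 R0" for x
      by (rule T'[OF that])
    show "norm (grad (F \<epsilon>) x - grad (cartesian (\<lambda>r \<zeta>. \<theta> r)) x) \<le> C * \<epsilon>" if "x \<in> cball 0 R0" for x
      unfolding star.grad_F T[OF that] using that by (intro close) simp
    show "grad (F \<epsilon>) differentiable (at x)" for x
      unfolding star.grad_F by (rule G_diff)
    show "holder_continuous_on (cball 0 R0) (partial_deriv j (partial_deriv i (F \<epsilon>)))" for i j
      by (rule star.holder_second_derivatives)
    show "\<exists>!X. surface_radius (\<Theta> \<epsilon>) \<xi>1 \<zeta> X" if "\<zeta> \<in> {-1..1}" for \<zeta>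
      by (rule surface.surface_radius_ex1[OF that])
    show "(\<lambda>\<zeta>. THE X. surface_radius (\<Theta> \<epsilon>) \<xi>1 \<zeta> X) C1_differentiable_on {-1<..<1}"
      by (rule surface.surface_radius_C1)
    show "\<exists>!N. unit_outer_normal surface.D p N" if "p \<in> frontier surface.D" for p
      by (rule surface.outer_normal(1)[OF that])
    show "((\<lambda>t. F \<epsilon> (p + t *\<^sub>R N)) has_real_derivative grad (F \<epsilon>) p \<bullet> N) (at 0)"
      "grad (F \<epsilon>) p \<bullet> N < 0" if "p \<in> frontier surface.D" "unit_outer_normal surface.D p N" for p N
      using surface.outer_normal(2,3)[OF that] .
    show "frontier surface.D = {x \<in> cball 0 R0. F \<epsilon> x = 0}" by (rule surface.frontier_D)
    show "C1_submanifold 2 (frontier surface.D)" by (rule surface.submanifold)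
  qed (use \<epsilon>0 C in auto)
qed

end
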